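(* Let $\mathcal K$ be a virtual or flat knot and let $H=\mathbb Z$ or $\mathbb Z_2$. Fix a primitive based matrix $T_\bullet$ homologous to the based matrices $T(D)$ of the diagrams $D$ of $\mathcal K$, and let $\bar A^{st}(\mathcal K)=\bar A^{st}(T_\bullet)$. Then the family of the maps $\bar p^{st}_{T(D)}\colon\mathcal V(D)\to\bar A^{st}(\mathcal K)$, where $D$ ranges over the diagrams of $\mathcal K$, is a parity on diagrams of the knot $\mathcal K$ with coefficients in the group $\bar A^{st}(\mathcal K)$.
   Context: **Knots and diagrams.** An oriented virtual knot is an equivalence class of pairs $(S,D)$, where $S$ is a closed oriented surface and $D$ is an oriented one-component knot diagram in $S$ with classical crossings, modulo diagram isotopies, classical Reidemeister moves and (de)stabilizations of $S$. Flat knots are obtained in the same way from diagrams without over/under information, modulo flat Reidemeister moves. $\mathcal V(D)$ is the set of (classical) crossings of $D$. A sequence $f\colon D\to D'$ of isotopies and Reidemeister moves induces a partial bijection $f_*\colon\mathcal V(D)\to\mathcal V(D')$ between surviving crossings. **Parity on diagrams.** A parity on the diagrams of $\mathcal K$ with coefficients in an abelian group $A$ is a family of maps $p_D\colon\mathcal V(D)\to A$, for all diagrams $D$ of $\mathcal K$, such that Reidemeister moves do not change the value of any crossing which survives under the move, and the sum of the values of the crossings participating in a Reidemeister move is zero (one crossing for a first, two for a second, three for a third Reidemeister move). **Based matrices.** A based matrix with coefficients in $H$ is a triple $T=(G,s,b)$ with $G$ a finite set, $s\in G$, and $b\colon G\times G\to H$ with $b(h,g)=-b(g,h)$ and $b(s,s)=0$.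 Put $G^\circ=G\setminus\{s\}$. Extend $b$ biadditively to $\mathbb Z[G]$, and put $\chi_C=\sum_{g\in C}g$ for $C\subset G$. An element $g\in G^\circ$ is annihilating if $b(g,h)=0$ for all $h\in G$, core if $b(g,h)=b(s,h)$ for all $h\in G$; $g_1,g_2\in G^\circ$ are complementary if $b(g_1,h)+b(g_2,h)=b(s,h)$ for all $h\in G$. Operation $M_1$ (resp. $M_2$) adjoins an annihilating (resp. core) element, extending $b$; operation $M_3$ adjoins a pair of complementary elements, by any skew-symmetric extension of $b$ with this property. Based matrices connected by operations $M_i^{\pm1}$ are homologous. A based matrix is primitive if it has no annihilating, core or complementary elements. (Known, due to Turaev: every based matrix is homologous to a primitive one, unique up to isomorphism; equivalent diagrams have homologous based matrices.) $Aut(T)$ is the group of bijections of $G$ fixing $s$ and preserving $b$. **Based matrix of a diagram.** At a crossing $c$ of $D$, drawn with both strands oriented upward, the oriented smoothing splits $D$ into two closed curves; the left half $D^l_c$ is the one containing the left arc of the smoothing. Put $T(D)=(G(D),s,b_D)$ with $G(D)=\mathcal V(D)\sqcup\{s\}$, where $s$ is a formal element, and $b_D(c,c')=D^l_c\cdot D^l_{c'}$, $b_D(c,s)=D^l_c\cdot D$, $b_D(s,s)=0$, where $\cdot$ is the intersection form on $H_1(S,H)$ with values in $H$. **Stable partition.** For a partition $\mathfrak C$ of $G$ with $\{s\}\in\mathfrak C$ let $$Ann(\mathfrak C)=\{v\in\mathbb Z[G^\circ]\mid\exists k\in\mathbb Z\ \forall C\in\mathfrak C:\ b(v,\chi_C)=k\cdot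 b(s,\chi_C)\},$$ and let $A\mathfrak C$ be the partition consisting of $\{s\}$ and the classes of the equivalence relation on $G^\circ$: $g_1\simeq g_2$ iff $g_1-g_2\in Ann(\mathfrak C)$ or $g_1+g_2\in Ann(\mathfrak C)$. Let $\mathfrak C_0$ be the partition of $G$ into singletons, $\mathfrak C_n=A^n\mathfrak C_0$; these become successively coarser and stabilize to the stable partition $\mathfrak C_\infty(T)$. Its classes are called tribes. If $T'$ is obtained from $T=(G,s,b)$ by $M_1,M_2$ or $M_3$, then $\mathfrak C_\infty(T)$ consists of the nonempty sets $C'\cap G$, $C'\in\mathfrak C_\infty(T')$. **Primitive tribes and zero tribe.** A tribe of $T$ is primitive if it meets the underlying set of a primitive based matrix obtained from $T$ by successively deleting annihilating elements, core elements and complementary pairs (independently of the choice of that primitive matrix). Under an operation $M_i$ from $T=(G,s,b)$ to $T'$, $C'\mapsto C'\cap G$ is a bijection from the primitive tribes of $T'$ to those of $T$. The zero tribe $C_0(T)$ is $C'\cap G$, where $C'$ is the tribe containing $g'$ after adjoining an annihilating element $g'$ to $T$ by $M_1$; it may be empty. **The reduced stable parity $\bar p^{st}$.** Let $\bar{\mathfrak C}(T_\bullet)$ be the finest partition of the underlying set of $T_\bullet$ whose classes are unions of stable tribes and are each invariant under every $\phi\in Aut(T_\bullet)$. All tribes of $T_\bullet$ are primitive, so this gives a partition of the set of primitive tribes of $T_\bullet$. For $T=(G,s,b)$ homologous to $T_\bullet$, transport it to a partition of the set of primitive tribes of $T$ along a chain of operations $M_i^{\pm1}$ from $T$ to $T_\bullet$,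 using for each operation $M_i$ $(i=1,2,3)$ from a based matrix $T_1=(G_1,s,b_1)$ to a based matrix $T_2$ the bijection $C'\mapsto C'\cap G_1$ from the primitive tribes of $T_2$ to those of $T_1$, or its inverse (the result is independent of the chain of operations). Let $\bar{\mathfrak C}(T)_{prim}$ be the set of resulting classes, each regarded as a subset of $G$ (the union of the tribes in it), and let $\bar{\mathfrak C}(T)^*_{prim}$ be obtained from it by removing the class containing $C_0(T)$ if $C_0(T)$ is primitive (and nothing otherwise). Put $$\bar A^{st}(T)=H[\bar{\mathfrak C}(T)^*_{prim}]/\Big\langle\sum_{\bar C\in\bar{\mathfrak C}(T)^*_{prim}}b(s,\chi_{\bar C})\cdot\bar C\Big\rangle,$$ $$\bar P^{st}_T(g)=\sum_{\bar C\in\bar{\mathfrak C}(T)^*_{prim}}\Big(b(g,\chi_{\bar C})-\Big\lfloor\tfrac{|\bar C|}2\Big\rfloor b(g,s)\Big)\cdot\bar C\in\bar A^{st}(T),\quad g\in G,$$ where $H[X]$ is the group of formal sums of elements of $X$ with coefficients in $H$ and $\langle x\rangle$ is the cyclic subgroup generated by $x$. For an operation $f\colon T\to T'$ of type $M_i$, $\bar A^{st}(f)$ sends $\sum\lambda_{\bar C}\cdot\bar C$ to $\sum\lambda_{\bar C}\cdot f(\bar C)$, where $f(\bar C)$ is the unique class of $T'$ with $f(\bar C)\cap G=\bar C$; inverse operations give inverse maps and chains give compositions. For a chain $f\colon T\to T_\bullet$ of operations $M_i^{\pm1}$ the map $\bar A^{st}(f)$ is an isomorphism independent of $f$, and $\bar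 p^{st}_T=\bar A^{st}(f)\circ\bar P^{st}_T\colon G\to\bar A^{st}(T_\bullet)$. The map $\bar p^{st}_{T(D)}$ is restricted to $\mathcal V(D)=G(D)^\circ$.
   Formalization: For H = Z the sum of the three values at a third Reidemeister move is claimed only when the triangle is coherently oriented, since it can be nonzero at other oriented third moves; for H = Z_2 all third moves are included, and surviving crossings keep their values under all moves in both cases. *)

theory Defs
  imports
    "HOL-Algebra.Free_Abelian_Groups"
    "HOL-Algebra.Generated_Groups"
    "HOL-Library.Disjoint_Sets"
    "HOL-Library.Z2"
begin

section \<open>Virtual and flat knots\<close>

text \<open>
  A diagram \<open>D\<close> in a closed oriented surface \<open>S\<close>, up to isotopy and (de)stabilization of \<open>S\<close>, is
  determined by an oriented neighbourhood of \<open>D\<close> in \<open>S\<close>, and hence by its Gauss code. Draw a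
  crossing with both strands oriented upward. The strand that runs from bottom left to top right
  is the \<open>Rightward\<close> one (it crosses the other strand from the left to the right), the strand that
  runs from bottom right to top left is the \<open>Leftward\<close> one. The word lists the passages of the
  crossings in the order in which they are met along \<open>D\<close>, from some base point.
  The field \<open>positive\<close> is \<open>None\<close> for flat diagrams; for diagrams with over/under information it
  is the set of positive crossings, i.e. of those where the \<open>Rightward\<close> strand passes over.
  Since the neighbourhood is all that is recorded, (de)stabilizations do not change a diagram,
  and a second move may be applied to any two arcs.
\<close>

datatype strand = Rightward | Leftward

fun opposite :: "strand \<Rightarrow> strand" where
  "opposite Rightward = Leftward"
| "opposite Leftward = Rightward"

type_synonym passage = "nat \<times> strand"

record diagram =
  "word" :: "passage list"
  positive :: "nat set option"

definition crossings :: "diagram \<Rightarrow> nat set" where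
  "crossings D = fst ` set (word D)"

definition wf_diagram :: "diagram \<Rightarrow> bool" where
  "wf_diagram D \<longleftrightarrow>
     distinct (word D) \<and> set (word D) = crossings D \<times> UNIV \<and>
     (\<forall>P. positive D = Some P \<longrightarrow> P \<subseteq> crossings D)"


subsection \<open>Isotopies and Reidemeister moves\<close>

text \<open>An isotopy may move the base point; \<open>\<phi>\<close> is the induced bijection of crossings.\<close>

definition isotopy :: "(nat \<Rightarrow> nat) \<Rightarrow> diagram \<Rightarrow> diagram \<Rightarrow> bool" where
  "isotopy \<phi> D D' \<longleftrightarrow>
     wf_diagram D \<and> wf_diagram D' \<and> inj_on \<phi> (crossings D) \<and>
     (\<exists>k. word D' = rotate k (map (map_prod \<phi> id) (word D))) \<and>
     positive D' = map_option (image \<phi>) (positive D)"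

text \<open>
  In the Reidemeister moves, crossings which survive keep their names. \<open>same_signs\<close> says that
  both diagrams are flat, or both have over/under information, which agrees at the common crossings.
\<close>

definition same_signs :: "diagram \<Rightarrow> diagram \<Rightarrow> bool" where
  "same_signs D D' \<longleftrightarrow>
     rel_option (\<lambda>P P'. P \<inter> crossings D' = P' \<inter> crossings D) (positive D) (positive D')"

definition move1 :: "diagram \<Rightarrow> diagram \<Rightarrow> nat \<Rightarrow> bool" where
  "move1 D D' c \<longleftrightarrow>
     wf_diagram D \<and> wf_diagram D' \<and> same_signs D D' \<and>
     (\<exists>\<sigma> u v. word D = u @ v \<and> word D' = u @ [(c, \<sigma>), (c, opposite \<sigma>)] @ v)"

text \<open>
  The two strands of a bigon cross each other in opposite directions at its two corners; they may
  be oriented in the same way or oppositely. One of the strands is over at both corners, which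
  means that exactly one of the two crossings is positive.
\<close>

definition move2 :: "diagram \<Rightarrow> diagram \<Rightarrow> nat \<Rightarrow> nat \<Rightarrow> bool" where
  "move2 D D' c d \<longleftrightarrow>
     wf_diagram D \<and> wf_diagram D' \<and> same_signs D D' \<and>
     (\<exists>\<sigma> u v w s. word D = u @ v @ w \<and>
        word D' = u @ [(c, \<sigma>), (d, opposite \<sigma>)] @ v @ s @ w \<and>
        (s = [(c, opposite \<sigma>), (d, \<sigma>)] \<or> s = [(d, \<sigma>), (c, opposite \<sigma>)])) \<and>
     (\<forall>P. positive D' = Some P \<longrightarrow> (c \<in> P) \<noteq> (d \<in> P))"

text \<open>
  Number the three strands so that the sides of the triangle lying on the strands 1, 2, 3 follow
  each other counterclockwise, and let \<open>x, y, z\<close> be the crossings of the strands 1 and 2, 2 and 3,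
  3 and 1. Let \<open>d i\<close> say that strand \<open>i\<close> runs counterclockwise along the triangle. Then strand
  \<open>i\<close> crosses strand \<open>i + 1\<close> from the left to the right iff \<open>d i = d (i + 1)\<close>. The move
  reverses the order of the two passages on each strand, and leaves the directions of crossing
  unchanged. All values of \<open>d\<close> occur. On the knot, the strands can follow each other in either of
  the two cyclic orders. The last condition says that over/under information does not make each
  strand pass over the next one, or each strand under the next one.
\<close>

definition side :: "bool \<Rightarrow> passage \<Rightarrow> passage \<Rightarrow> passage list" where
  "side e p q = (if e then [p, q] else [q, p])"

definition dir :: "bool \<Rightarrow> bool \<Rightarrow> strand" where
  "dir e e' = (if e = e' then Rightward else Leftward)"

definition oriented_move3 ::
  "bool \<Rightarrow> bool \<Rightarrow> bool \<Rightarrow> diagram \<Rightarrow> diagram \<Rightarrow> nat \<Rightarrow> nat \<Rightarrow> nat \<Rightarrow> bool" where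
  "oriented_move3 d1 d2 d3 D D' x y z \<longleftrightarrow>
     wf_diagram D \<and> wf_diagram D' \<and> same_signs D D' \<and>
     (let s1 = (\<lambda>e. side e (z, opposite (dir d3 d1)) (x, dir d1 d2));
          s2 = (\<lambda>e. side e (x, opposite (dir d1 d2)) (y, dir d2 d3));
          s3 = (\<lambda>e. side e (y, opposite (dir d2 d3)) (z, dir d3 d1))
      in \<exists>t u v w.
          word D = t @ s1 d1 @ u @ s2 d2 @ v @ s3 d3 @ w \<and>
          word D' = t @ s1 (\<not> d1) @ u @ s2 (\<not> d2) @ v @ s3 (\<not> d3) @ w \<or>
          word D = t @ s1 d1 @ u @ s3 d3 @ v @ s2 d2 @ w \<and>
          word D' = t @ s1 (\<not> d1) @ u @ s3 (\<not> d3) @ v @ s2 (\<not> d2) @ w) \<and>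
     (\<forall>P. positive D = Some P \<longrightarrow>
        (let o1 = (x \<in> P \<longleftrightarrow> dir d1 d2 = Rightward);
             o2 = (y \<in> P \<longleftrightarrow> dir d2 d3 = Rightward);
             o3 = (z \<in> P \<longleftrightarrow> dir d3 d1 = Rightward)
         in \<not> (o1 = o2 \<and> o2 = o3)))"

definition move3 :: "diagram \<Rightarrow> diagram \<Rightarrow> nat \<Rightarrow> nat \<Rightarrow> nat \<Rightarrow> bool" where
  "move3 D D' x y z \<longleftrightarrow> (\<exists>d1 d2 d3. oriented_move3 d1 d2 d3 D D' x y z)"

text \<open>
  Third moves whose triangle is coherently oriented. All other oriented third moves are
  compositions of these and of second moves. At those other moves the sum of the three left
  halves is \<open>D\<close> plus twice one of them, or just twice one of them, hence need not be a multiple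
  of \<open>D\<close> unless the coefficients have characteristic 2; at coherent triangles it is \<open>D\<close> or
  \<open>2 D\<close>.
\<close>

definition coherent_move3 :: "diagram \<Rightarrow> diagram \<Rightarrow> nat \<Rightarrow> nat \<Rightarrow> nat \<Rightarrow> bool" where
  "coherent_move3 D D' x y z \<longleftrightarrow> (\<exists>d. oriented_move3 d d d D D' x y z)"

definition reidemeister :: "diagram \<Rightarrow> diagram \<Rightarrow> bool" where
  "reidemeister D D' \<longleftrightarrow>
     (\<exists>c. move1 D D' c) \<or> (\<exists>c d. move2 D D' c d) \<or> (\<exists>x y z. move3 D D' x y z)"

definition diagram_equiv :: "(diagram \<times> diagram) set" where
  "diagram_equiv = {(D, D'). wf_diagram D \<and> wf_diagram D' \<and>
     equivclp (\<lambda>E E'. (\<exists>\<phi>. isotopy \<phi> E E') \<or> reidemeister E E') D D'}"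

text \<open>
  A virtual or flat knot is the set of its diagrams. No move relates a flat diagram to one with
  over/under information.
\<close>

definition knots :: "diagram set set" where
  "knots = {D. wf_diagram D} // diagram_equiv"


subsection \<open>Parities\<close>

text \<open>
  A parity with coefficients in the (multiplicatively written) group \<open>A\<close>. The parameter \<open>\<Delta>\<close> is
  the set of oriented third moves \<open>\<Delta> D D' x y z\<close> at which the values of the three participating
  crossings are required to sum to zero; surviving crossings keep their value under all moves.
\<close>

definition parity_on ::
  "(diagram \<Rightarrow> diagram \<Rightarrow> nat \<Rightarrow> nat \<Rightarrow> nat \<Rightarrow> bool) \<Rightarrow> diagram set \<Rightarrow> ('a, 'm) monoid_scheme \<Rightarrow>
    (diagram \<Rightarrow> nat \<Rightarrow> 'a) \<Rightarrow> bool" where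
  "parity_on \<Delta> K A p \<longleftrightarrow>
     comm_group A \<and>
     (\<forall>D\<in>K. \<forall>c\<in>crossings D. p D c \<in> carrier A) \<and>
     (\<forall>D\<in>K. \<forall>D'\<in>K. \<forall>\<phi>. isotopy \<phi> D D' \<longrightarrow> (\<forall>c\<in>crossings D. p D' (\<phi> c) = p D c)) \<and>
     (\<forall>D\<in>K. \<forall>D'\<in>K. reidemeister D D' \<longrightarrow>
        (\<forall>c\<in>crossings D \<inter> crossings D'. p D' c = p D c)) \<and>
     (\<forall>D\<in>K. \<forall>D'\<in>K. \<forall>c. move1 D D' c \<longrightarrow> p D' c = \<one>\<^bsub>A\<^esub>) \<and>
     (\<forall>D\<in>K. \<forall>D'\<in>K. \<forall>c d. move2 D D' c d \<longrightarrow> p D' c \<otimes>\<^bsub>A\<^esub> p D' d = \<one>\<^bsub>A\<^esub>) \<and>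
     (\<forall>D\<in>K. \<forall>D'\<in>K. \<forall>x y z. \<Delta> D D' x y z \<longrightarrow>
        p D x \<otimes>\<^bsub>A\<^esub> p D y \<otimes>\<^bsub>A\<^esub> p D z = \<one>\<^bsub>A\<^esub>)"


section \<open>Based matrices\<close>

record ('g, 'h) based_matrix =
  elems :: "'g set"
  base :: 'g
  form :: "'g \<Rightarrow> 'g \<Rightarrow> 'h"

definition wf_matrix :: "('g, 'h::comm_ring_1) based_matrix \<Rightarrow> bool" where
  "wf_matrix T \<longleftrightarrow>
     finite (elems T) \<and> base T \<in> elems T \<and>
     (\<forall>g\<in>elems T. \<forall>h\<in>elems T. form T h g = - form T g h) \<and> form T (base T) (base T) = 0"

abbreviation proper_elems :: "('g, 'h) based_matrix \<Rightarrow> 'g set" where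
  "proper_elems T \<equiv> elems T - {base T}"

definition annihilating :: "('g, 'h::comm_ring_1) based_matrix \<Rightarrow> 'g \<Rightarrow> bool" where
  "annihilating T g \<longleftrightarrow> g \<in> proper_elems T \<and> (\<forall>h\<in>elems T. form T g h = 0)"

definition core :: "('g, 'h::comm_ring_1) based_matrix \<Rightarrow> 'g \<Rightarrow> bool" where
  "core T g \<longleftrightarrow> g \<in> proper_elems T \<and> (\<forall>h\<in>elems T. form T g h = form T (base T) h)"

definition complementary :: "('g, 'h::comm_ring_1) based_matrix \<Rightarrow> 'g \<Rightarrow> 'g \<Rightarrow> bool" where
  "complementary T g g' \<longleftrightarrow>
     g \<in> proper_elems T \<and> g' \<in> proper_elems T \<and> g \<noteq> g' \<and>
     (\<forall>h\<in>elems T. form T g h + form T g' h = form T (base T) h)"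

definition extends ::
  "('g, 'h::comm_ring_1) based_matrix \<Rightarrow> 'g set \<Rightarrow> ('g, 'h) based_matrix \<Rightarrow> bool" where
  "extends T X T' \<longleftrightarrow>
     wf_matrix T \<and> wf_matrix T' \<and> base T' = base T \<and>
     X \<inter> elems T = {} \<and> elems T' = elems T \<union> X \<and>
     (\<forall>g\<in>elems T. \<forall>h\<in>elems T. form T' g h = form T g h)"

definition M1 :: "('g, 'h::comm_ring_1) based_matrix \<Rightarrow> 'g \<Rightarrow> ('g, 'h) based_matrix \<Rightarrow> bool" where
  "M1 T g T' \<longleftrightarrow> extends T {g} T' \<and> annihilating T' g"

definition M2 :: "('g, 'h::comm_ring_1) based_matrix \<Rightarrow> 'g \<Rightarrow> ('g, 'h) based_matrix \<Rightarrow> bool" where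
  "M2 T g T' \<longleftrightarrow> extends T {g} T' \<and> core T' g"

definition M3 ::
  "('g, 'h::comm_ring_1) based_matrix \<Rightarrow> 'g \<Rightarrow> 'g \<Rightarrow> ('g, 'h) based_matrix \<Rightarrow> bool" where
  "M3 T g g' T' \<longleftrightarrow> extends T {g, g'} T' \<and> complementary T' g g'"

definition operation ::
  "('g, 'h::comm_ring_1) based_matrix \<Rightarrow> ('g, 'h) based_matrix \<Rightarrow> bool" where
  "operation T T' \<longleftrightarrow> (\<exists>g. M1 T g T') \<or> (\<exists>g. M2 T g T') \<or> (\<exists>g g'. M3 T g g' T')"

text \<open>
  A chain of operations and inverse operations is given by the list of the based matrices that
  it passes through.
\<close>

definition chain ::
  "('g, 'h::comm_ring_1) based_matrix list \<Rightarrow> ('g, 'h) based_matrix \<Rightarrow> ('g, 'h) based_matrix \<Rightarrow> bool"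
  where
  "chain f T T' \<longleftrightarrow> f \<noteq> [] \<and> hd f = T \<and> last f = T' \<and> successively (symclp operation) f"

definition homologous ::
  "('g, 'h::comm_ring_1) based_matrix \<Rightarrow> ('g, 'h) based_matrix \<Rightarrow> bool" where
  "homologous T T' \<longleftrightarrow> (\<exists>f. chain f T T')"

definition primitive :: "('g, 'h::comm_ring_1) based_matrix \<Rightarrow> bool" where
  "primitive T \<longleftrightarrow>
     wf_matrix T \<and>
     \<not> (\<exists>g. annihilating T g) \<and> \<not> (\<exists>g. core T g) \<and> \<not> (\<exists>g g'. complementary T g g')"

text \<open>The values outside \<open>elems T\<close> of the members of \<open>Aut T\<close> are irrelevant.\<close>

definition Aut :: "('g, 'h::comm_ring_1) based_matrix \<Rightarrow> ('g \<Rightarrow> 'g) set" where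
  "Aut T = {\<phi>. bij_betw \<phi> (elems T) (elems T) \<and> \<phi> (base T) = base T \<and>
     (\<forall>g\<in>elems T. \<forall>h\<in>elems T. form T (\<phi> g) (\<phi> h) = form T g h)}"


subsection \<open>The based matrix of a diagram\<close>

text \<open>
  Edge \<open>i\<close> of a diagram with word \<open>w\<close> of length \<open>n\<close> is the arc of \<open>D\<close> from the passage \<open>w ! i\<close> to
  the next one. A function \<open>x\<close> on \<open>{..<n}\<close> is a cellular 1-chain of the 4-valent graph \<open>D\<close> in \<open>S\<close>.
\<close>

definition position :: "diagram \<Rightarrow> passage \<Rightarrow> nat" where
  "position D l = (THE i. i < length (word D) \<and> word D ! i = l)"

definition out_edge :: "diagram \<Rightarrow> passage \<Rightarrow> nat" where
  "out_edge D l = position D l"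

definition in_edge :: "diagram \<Rightarrow> passage \<Rightarrow> nat" where
  "in_edge D l = (position D l + length (word D) - 1) mod length (word D)"

text \<open>
  The left arc of the smoothing at \<open>c\<close> enters at the bottom left and leaves at the top left, so
  the left half leaves \<open>c\<close> along the \<open>Leftward\<close> strand and returns along the \<open>Rightward\<close> one.
\<close>

definition left_half :: "diagram \<Rightarrow> nat \<Rightarrow> nat \<Rightarrow> int" where
  "left_half D c i =
     (let n = length (word D); a = position D (c, Leftward); b = position D (c, Rightward)
      in if i < n \<and> (i + n - a) mod n < (b + n - a) mod n then 1 else 0)"

definition whole_curve :: "diagram \<Rightarrow> nat \<Rightarrow> int" where
  "whole_curve D i = (if i < length (word D) then 1 else 0)"

text \<open>
  The intersection number of two 1-cycles of the graph \<open>D\<close> in \<open>S\<close>. The four half-edges at a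
  crossing are taken in the counterclockwise order NE, NW, SW, SE, and \<open>flux\<close> lists the outward
  coefficients of a cycle there. For two arcs crossing transversally at \<open>c\<close> the local sum is 2 or
  -2 (2 if the first arc goes from SW to NE, the second one from SE to NW). Arcs with a common
  half-edge contribute 0, 1 or -1: the local sum adds up the intersections for the two ways to
  push the second cycle off the first one, to the left or to the right. The total is therefore
  twice the intersection number, and the division is exact on cycles.
\<close>

definition flux :: "diagram \<Rightarrow> (nat \<Rightarrow> int) \<Rightarrow> nat \<Rightarrow> int list" where
  "flux D x c =
     [x (out_edge D (c, Rightward)), x (out_edge D (c, Leftward)),
      - x (in_edge D (c, Rightward)), - x (in_edge D (c, Leftward))]"

definition intersection_number :: "diagram \<Rightarrow> (nat \<Rightarrow> int) \<Rightarrow> (nat \<Rightarrow> int) \<Rightarrow> int" where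
  "intersection_number D x y =
     (\<Sum>c\<in>crossings D. \<Sum>j<4. \<Sum>i<j.
        flux D x c ! i * flux D y c ! j - flux D x c ! j * flux D y c ! i) div 2"

text \<open>The formal element \<open>s\<close> is \<open>None\<close>; its cycle is \<open>D\<close> itself, and \<open>D \<cdot> D = 0\<close>.\<close>

primrec cycle_of :: "diagram \<Rightarrow> nat option \<Rightarrow> nat \<Rightarrow> int" where
  "cycle_of D None = whole_curve D"
| "cycle_of D (Some c) = left_half D c"

definition diagram_matrix :: "diagram \<Rightarrow> (nat option, 'h::comm_ring_1) based_matrix" where
  "diagram_matrix D =
     \<lparr>elems = insert None (Some ` crossings D), base = None,
      form = (\<lambda>g h. of_int (intersection_number D (cycle_of D g) (cycle_of D h)))\<rparr>"


subsection \<open>Tribes\<close>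

text \<open>The biadditive extension of the form to the free abelian group on \<open>elems T\<close>.\<close>

definition bform ::
  "('g, 'h::comm_ring_1) based_matrix \<Rightarrow> ('g \<Rightarrow>\<^sub>0 int) \<Rightarrow> ('g \<Rightarrow>\<^sub>0 int) \<Rightarrow> 'h" where
  "bform T v w = (\<Sum>g\<in>Poly_Mapping.keys v. \<Sum>h\<in>Poly_Mapping.keys w.
     of_int (Poly_Mapping.lookup v g * Poly_Mapping.lookup w h) * form T g h)"

definition chi :: "'g set \<Rightarrow> ('g \<Rightarrow>\<^sub>0 int)" where
  "chi C = (\<Sum>g\<in>C. frag_of g)"

definition Ann :: "('g, 'h::comm_ring_1) based_matrix \<Rightarrow> 'g set set \<Rightarrow> ('g \<Rightarrow>\<^sub>0 int) set" where
  "Ann T \<CC> = {v. Poly_Mapping.keys v \<subseteq> proper_elems T \<and>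
     (\<exists>k::int. \<forall>C\<in>\<CC>. bform T v (chi C) = of_int k * bform T (frag_of (base T)) (chi C))}"

definition coarsen :: "('g, 'h::comm_ring_1) based_matrix \<Rightarrow> 'g set set \<Rightarrow> 'g set set" where
  "coarsen T \<CC> = insert {base T}
     (proper_elems T // {(g, g'). g \<in> proper_elems T \<and> g' \<in> proper_elems T \<and>
        (frag_of g - frag_of g' \<in> Ann T \<CC> \<or> frag_of g + frag_of g' \<in> Ann T \<CC>)})"

definition partition_seq :: "('g, 'h::comm_ring_1) based_matrix \<Rightarrow> nat \<Rightarrow> 'g set set" where
  "partition_seq T n = (coarsen T ^^ n) ((\<lambda>g. {g}) ` elems T)"

definition tribes :: "('g, 'h::comm_ring_1) based_matrix \<Rightarrow> 'g set set" where
  "tribes T = partition_seq T (LEAST n. partition_seq T (Suc n) = partition_seq T n)"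

definition primitive_tribes :: "('g, 'h::comm_ring_1) based_matrix \<Rightarrow> 'g set set" where
  "primitive_tribes T = {C \<in> tribes T.
     \<exists>P. operation\<inverse>\<inverse>\<^sup>*\<^sup>* T P \<and> primitive P \<and> C \<inter> elems P \<noteq> {}}"

text \<open>The zero tribe is defined for based matrices over an infinite type of elements; it does not
  depend on the choice of the adjoined element.\<close>

definition zero_tribe :: "('g, 'h::comm_ring_1) based_matrix \<Rightarrow> 'g set" where
  "zero_tribe T = {h \<in> elems T. \<exists>T' g. M1 T g T' \<and> (\<exists>C'\<in>tribes T'. g \<in> C' \<and> h \<in> C')}"


section \<open>The reduced stable parity\<close>

definition admissible_partition ::
  "('g, 'h::comm_ring_1) based_matrix \<Rightarrow> 'g set set \<Rightarrow> bool" where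
  "admissible_partition T Q \<longleftrightarrow>
     partition_on (elems T) Q \<and>
     (\<forall>C\<in>Q. (\<exists>\<T>\<subseteq>tribes T. C = \<Union>\<T>) \<and> (\<forall>\<phi>\<in>Aut T. \<phi> ` C = C))"

definition reduced_partition :: "('g, 'h::comm_ring_1) based_matrix \<Rightarrow> 'g set set" where
  "reduced_partition T =
     (THE Q. admissible_partition T Q \<and>
        (\<forall>Q'. admissible_partition T Q' \<longrightarrow> refines (elems T) Q Q'))"

text \<open>The bijection between the primitive tribes of \<open>T\<close> and of \<open>T'\<close>, if one is obtained from
  the other by an operation.\<close>

definition tribe_map ::
  "('g, 'h::comm_ring_1) based_matrix \<Rightarrow> ('g, 'h) based_matrix \<Rightarrow> 'g set \<Rightarrow> 'g set" where
  "tribe_map T T' C =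
     (if operation T' T then C \<inter> elems T'
      else (THE C'. C' \<in> primitive_tribes T' \<and> C' \<inter> elems T = C))"

text \<open>For a chain \<open>f\<close> from \<open>T\<close> to the primitive matrix \<open>T\<^sub>\<bullet>\<close>: the partition of the
  primitive tribes of \<open>T\<close> transported along \<open>f\<close>, each class being the union of its tribes.\<close>

fun prim_classes :: "('g, 'h::comm_ring_1) based_matrix list \<Rightarrow> 'g set set" where
  "prim_classes [] = {}"
| "prim_classes [T] = reduced_partition T"
| "prim_classes (T # T' # f) =
     (\<lambda>C. \<Union> (tribe_map T' T ` {X \<in> primitive_tribes T'. X \<subseteq> C})) ` prim_classes (T' # f)"

definition star_classes :: "('g, 'h::comm_ring_1) based_matrix list \<Rightarrow> 'g set set" where
  "star_classes f = {C \<in> prim_classes f.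
     \<not> (zero_tribe (hd f) \<in> primitive_tribes (hd f) \<and> zero_tribe (hd f) \<subseteq> C)}"

text \<open>The group of formal sums of elements of \<open>X\<close> with coefficients in \<open>'h\<close>.\<close>

definition formal_sums :: "'x set \<Rightarrow> ('x \<Rightarrow>\<^sub>0 'h::comm_ring_1) monoid" where
  "formal_sums X = \<lparr>carrier = {a. Poly_Mapping.keys a \<subseteq> X}, mult = (+), one = 0\<rparr>"

definition relations ::
  "('g, 'h::comm_ring_1) based_matrix list \<Rightarrow> ('g set \<Rightarrow>\<^sub>0 'h) set" where
  "relations f = generate (formal_sums (star_classes f))
     {\<Sum>C\<in>star_classes f. Poly_Mapping.single C (bform (hd f) (frag_of (base (hd f))) (chi C))}"

definition stable_group ::
  "('g, 'h::comm_ring_1) based_matrix list \<Rightarrow> ('g set \<Rightarrow>\<^sub>0 'h) set monoid" where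
  "stable_group f = formal_sums (star_classes f) Mod relations f"

definition stable_value ::
  "('g, 'h::comm_ring_1) based_matrix list \<Rightarrow> 'g \<Rightarrow> ('g set \<Rightarrow>\<^sub>0 'h) set" where
  "stable_value f g = relations f #>\<^bsub>formal_sums (star_classes f)\<^esub>
     (\<Sum>C\<in>star_classes f. Poly_Mapping.single C
        (bform (hd f) (frag_of g) (chi C) - of_nat (card C div 2) * form (hd f) g (base (hd f))))"

text \<open>The isomorphism induced by a chain, on the cosets that make up the quotient group.\<close>

definition class_map ::
  "('g, 'h::comm_ring_1) based_matrix \<Rightarrow> ('g, 'h) based_matrix \<Rightarrow> 'g set set \<Rightarrow> 'g set \<Rightarrow> 'g set"
  where
  "class_map T T' Q' C =
     (if operation T' T then C \<inter> elems T' else (THE C'. C' \<in> Q' \<and> C' \<inter> elems T = C))"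

definition push_sum :: "('x \<Rightarrow> 'y) \<Rightarrow> ('x \<Rightarrow>\<^sub>0 'h::comm_ring_1) \<Rightarrow> ('y \<Rightarrow>\<^sub>0 'h)" where
  "push_sum m a = (\<Sum>C\<in>Poly_Mapping.keys a. Poly_Mapping.single (m C) (Poly_Mapping.lookup a C))"

fun induced_map ::
  "('g, 'h::comm_ring_1) based_matrix list \<Rightarrow> ('g set \<Rightarrow>\<^sub>0 'h) set \<Rightarrow> ('g set \<Rightarrow>\<^sub>0 'h) set" where
  "induced_map [] U = U"
| "induced_map [T] U = U"
| "induced_map (T # T' # f) U =
     induced_map (T' # f) (push_sum (class_map T T' (star_classes (T' # f))) ` U)"

text \<open>
  The coefficient group, computed at the primitive matrix \<open>T\<^sub>\<bullet>\<close> (with the chain of length zero),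
  and the parity, which does not depend on the choice of the chain from \<open>T\<close> to \<open>T\<^sub>\<bullet>\<close>.
\<close>

definition stable_coeffs ::
  "('g, 'h::comm_ring_1) based_matrix \<Rightarrow> ('g set \<Rightarrow>\<^sub>0 'h) set monoid" where
  "stable_coeffs Tp = stable_group [Tp]"

definition reduced_stable_parity ::
  "('g, 'h::comm_ring_1) based_matrix \<Rightarrow> ('g, 'h) based_matrix \<Rightarrow> 'g \<Rightarrow> ('g set \<Rightarrow>\<^sub>0 'h) set" where
  "reduced_stable_parity Tp T g =
     (let f = (SOME f. chain f T Tp) in induced_map f (stable_value f g))"

end

theory Submission
  imports Defs
begin

text \<open>
  The tribe relation is the least fixed point of a monotone coarsening operator on equivalence
  relations. If a set of at most two elements whose rows add up to \<open>0\<close> or to the row of \<open>s\<close> is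
  adjoined, closed relations restrict and extend, so tribes and the zero tribe are compatible with
  the operations. Deletions are confluent, by isomorphisms that preserve tribes. Hence all primitive
  reducts of \<open>T\<close> are isomorphic to \<open>T\<^sub>\<bullet>\<close>, and the class of \<open>T\<close> that corresponds to a class \<open>C\<close> of
  \<open>T\<^sub>\<bullet>\<close> consists of the tribes that meet the preimage of \<open>C\<close> in a reduct. It does not depend on
  choices because \<open>C\<close> is invariant under automorphisms, so the value of the parity at \<open>g\<close> is
  given by a formula that does not involve the chain of operations.

  This formula is linear in the row of \<open>g\<close>, and gives zero in the quotient if the row is a multiple
  of the row of \<open>s\<close>. An operation changes neither the class sums nor the weights: annihilating and
  core elements lie in the zero tribe, and a complementary pair changes \<open>b(g,\<chi>\<^sub>C)\<close> and
  \<open>\<lfloor>|C|/2\<rfloor> b(g,s)\<close> by the same amount. It remains to see that a first move adjoins an annihilating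
  or core element to the matrix of the diagram, that a second move adjoins a complementary pair, and
  that a third move preserves the matrix, with the rows of its three crossings adding up to a
  multiple of the row of \<open>s\<close> plus twice the row of one of them, which is absent at coherent triangles.
\<close>

section \<open>The tribe relation\<close>

text \<open>The definitions choose at every turn: a chain by \<open>SOME\<close>, tribes and classes
  by \<open>THE\<close>, and partitions carried back from the far end of the chain. Everything is
  therefore indexed by the classes of the one fixed matrix \<open>Tp\<close>. The choices then
  survive only as isomorphisms between reducts, and these can be taken to move each element within
  its tribe, which is more than uniqueness of the primitive matrix up to isomorphism.

  The shape of the coefficients answers three defects of bare class sums of a row g. An annihilating
  and a core element enlarge a class equally but add 0 and b(g,s) to the sum, so no correction by
  the size serves both, and the class of the zero tribe must go. A complementary pair always adds
  b(g,s) while the size grows by two; hence half the size as coefficient, where rounding is harmless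
  because the parity of the size stays the same. The quotient kills multiples of the row of s.

  Isotopies and third moves give isomorphisms of matrices and not operations, so invariance under
  isomorphisms is a separate strand of the proof.\<close>

lemma bform_superset:
  assumes "finite S" "finite S'" "Poly_Mapping.keys v \<subseteq> S"
    "Poly_Mapping.keys w \<subseteq> S'"
  shows "bform T v w = (\<Sum>g\<in>S. \<Sum>h\<in>S'.
    of_int (Poly_Mapping.lookup v g * Poly_Mapping.lookup w h) * form T g h)"
proof -
  have "bform T v w = (\<Sum>g\<in>Poly_Mapping.keys v. \<Sum>h\<in>S'.
    of_int (Poly_Mapping.lookup v g * Poly_Mapping.lookup w h) * form T g h)"
    unfolding bform_def
    by (intro sum.cong sum.mono_neutral_left) (use assms in \<open>auto simp: in_keys_iff\<close>)
  also have "\<dots> = (\<Sum>g\<in>S. \<Sum>h\<in>S'.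
    of_int (Poly_Mapping.lookup v g * Poly_Mapping.lookup w h) * form T g h)"
    by (intro sum.mono_neutral_left) (use assms in \<open>auto simp: in_keys_iff\<close>)
  finally show ?thesis .
qed

lemma bform_add_left: "bform T (v + v') w = bform T v w + bform T v' w"
proof -
  let ?S = "Poly_Mapping.keys v \<union> Poly_Mapping.keys v'"
  have *: "bform T u w = (\<Sum>g\<in>?S. \<Sum>h\<in>Poly_Mapping.keys w.
      of_int (Poly_Mapping.lookup u g * Poly_Mapping.lookup w h) * form T g h)"
    if "Poly_Mapping.keys u \<subseteq> ?S" for u
    by (rule bform_superset) (use that in auto)
  have "Poly_Mapping.keys (v + v') \<subseteq> ?S" by (rule Poly_Mapping.keys_add)
  from *[OF this] show ?thesis
    using *[of v] *[of v']
      by (simp only: Un_upper1 Un_upper2 lookup_add distrib_right of_int_add sum.distrib)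
qed

lemma bform_minus_left: "bform T (- v) w = - bform T v w"
  by (simp add: bform_def keys_minus lookup_minus sum_negf)

lemma bform_diff_left: "bform T (v - v') w = bform T v w - bform T v' w"
  using bform_add_left[of T v "- v'" w] by (simp add: bform_minus_left)

lemma lookup_chi:
  "finite C \<Longrightarrow> Poly_Mapping.lookup (chi C) g = (if g \<in> C then 1 else 0)"
proof (induction C rule: finite_induct)
  case (insert x C)
  then have "chi (insert x C) = frag_of x + chi C" by (simp add: chi_def)
  then show ?case using insert by (simp add: lookup_add lookup_single when_def)
qed (simp add: chi_def)

lemma keys_chi:
  assumes "finite C"
  shows "Poly_Mapping.keys (chi C) = C"
proof (rule Set.set_eqI)
  show "x \<in> Poly_Mapping.keys (chi C) \<longleftrightarrow> x \<in> C" for x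
    by (cases
      "x \<in> C") (simp_all only: in_keys_iff lookup_chi[OF assms] if_True if_False, simp_all)
qed

lemma bform_frag_chi:
  assumes "finite C"
  shows "bform T (frag_of g) (chi C) = sum (form T g) C"
proof -
  have "bform T (frag_of g) (chi C) = (\<Sum>h\<in>C. of_int (Poly_Mapping.lookup (chi C) h) * form T g h)"
    by (simp add: bform_def keys_chi[OF assms])
  also have "\<dots> = sum (form T g) C"
    by (rule sum.cong) (simp_all only: lookup_chi[OF assms] if_True of_int_1 mult_1)
  finally show ?thesis .
qed

text \<open>The condition defining \<open>Ann\<close>, put on the row \<open>r\<close> of a formal
  sum instead of the sum itself, since only class sums of the row enter. As in \<open>Ann\<close>
  the factor is an integer, even if the form takes values in another ring.\<close>

definition proportional ::
  "('g, 'h::comm_ring_1) based_matrix \<Rightarrow> ('g \<times> 'g) set \<Rightarrow> ('g \<Rightarrow> 'h) \<Rightarrow> bool" where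
  "proportional T E r \<longleftrightarrow>
     (\<exists>k::int. \<forall>C\<in>elems T // E. sum r C = of_int k * sum (form T (base T)) C)"

text \<open>The pair of base elements keeps \<open>{s}\<close> a class of its own; the two
  alternatives are the two signs in the definition of the equivalence on proper elements.\<close>

definition coarsening ::
  "('g, 'h::comm_ring_1) based_matrix \<Rightarrow> ('g \<times> 'g) set \<Rightarrow> ('g \<times> 'g) set" where
  "coarsening T E = insert (base T, base T)
     {(g, g'). g \<in> proper_elems T \<and> g' \<in> proper_elems T \<and>
        (proportional T E (\<lambda>h. form T g h - form T g' h) \<or>
         proportional T E (\<lambda>h. form T g h + form T g' h))}"

definition based_equiv ::
  "('g, 'h::comm_ring_1) based_matrix \<Rightarrow> ('g \<times> 'g) set \<Rightarrow> bool" where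
  "based_equiv T E \<longleftrightarrow> equiv (elems T) E \<and> E `` {base T} = {base T}"

lemma proportional_zero: "proportional T E (\<lambda>_. 0)"
  unfolding proportional_def by (rule exI[of _ 0]) simp

lemma proportional_add:
  assumes "proportional T E r" "proportional T E r'"
  shows "proportional T E (\<lambda>h. r h + r' h)"
proof -
  from assms obtain k k'
    where "\<forall>C\<in>elems T // E. sum r C = of_int k * sum (form T (base T)) C"
    "\<forall>C\<in>elems T // E. sum r' C = of_int k' * sum (form T (base T)) C"
    unfolding proportional_def by blast
  then show ?thesis unfolding proportional_def
    by (intro exI[of _ "k + k'"]) (simp add: sum.distrib algebra_simps)
qed

lemma proportional_minus:
  assumes "proportional T E r"
  shows "proportional T E (\<lambda>h. - r h)"
proof -
  from assms obtain k
    where "\<forall>C\<in>elems T // E. sum r C = of_int k * sum (form T (base T)) C"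
    unfolding proportional_def by blast
  then show ?thesis unfolding proportional_def
    by (intro exI[of _ "- k"]) (simp add: sum_negf)
qed

lemma proportional_diff:
  assumes "proportional T E r" "proportional T E r'"
  shows "proportional T E (\<lambda>h. r h - r' h)"
  using proportional_add[OF assms(1) proportional_minus[OF assms(2)]] by simp

text \<open>Each class of \<open>F\<close> is a disjoint union of classes of \<open>E\<close>, and
  the factor does not depend on the class, so the equations for the classes of \<open>E\<close> can
  be added.\<close>

lemma proportional_mono:
  assumes fin: "finite (elems T)" and E: "equiv (elems T) E" and F: "equiv (elems T) F"
    and sub: "E \<subseteq> F" and r: "proportional T E r"
  shows "proportional T F r"
proof -
  from r obtain k
    where k: "\<And>C. C \<in> elems T // E \<Longrightarrow> sum r C
    = of_int k * sum (form T (base T)) C"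
    unfolding proportional_def by blast
  have "sum r D = of_int k * sum (form T (base T)) D" if D: "D \<in> elems T // F" for D
  proof -
    let ?P = "(\<lambda>x. E `` {x}) ` D"
    have DG: "D \<subseteq> elems T" using D F by (simp add: in_quotient_imp_subset)
    have sub': "E `` {x} \<subseteq> D" if "x \<in> D" for x
      using in_quotient_imp_closed[OF F D that] sub by blast
    have U: "\<Union> ?P = D"
    proof
      show "\<Union> ?P \<subseteq> D" using sub' by blast
      show "D \<subseteq> \<Union> ?P" using equiv_class_self[OF E] DG by blast
    qed
    have q: "?P \<subseteq> elems T // E" using DG by (auto intro: quotientI)
    have finD: "finite D" using fin DG finite_subset by blast
    have fA: "\<forall>A\<in>?P. finite A" using finD U by (metis Union_upper finite_subset)
    have dis:
      "\<forall>A\<in>?P. \<forall>B\<in>?P. A \<noteq> B \<longrightarrow> A \<inter> B = {}"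
      using quotient_disj[OF E] q by blast
    have "sum r D = (\<Sum>A\<in>?P. sum r A)" 
      using sum.Union_disjoint[OF fA dis, of r] U by (simp add: comp_def)
    also have "\<dots> = (\<Sum>A\<in>?P. of_int k * sum (form T (base T)) A)"
      by (rule sum.cong) (use k q in blast)+
    also have "\<dots> = of_int k * (\<Sum>A\<in>?P. sum (form T (base T)) A)"
      by (simp add: sum_distrib_left)
    also have "(\<Sum>A\<in>?P. sum (form T (base T)) A) = sum (form T (base T)) D"
      using sum.Union_disjoint[OF fA dis, of "form T (base T)"] U by (simp add: comp_def)
    finally show ?thesis .
  qed
  then show ?thesis unfolding proportional_def by blast
qed

lemma coarsening_mono:
  assumes "finite (elems T)" "equiv (elems T) E" "equiv (elems T) F" "E \<subseteq> F"
  shows "coarsening T E \<subseteq> coarsening T F"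
  unfolding coarsening_def using proportional_mono[OF assms] by blast

text \<open>Relatedness by a difference and relatedness by a sum compose like the signs + and -,
  because proportional rows are closed under addition and negation. This gives transitivity of their
  union.\<close>

lemma based_equiv_coarsening:
  assumes "base T \<in> elems T"
  shows "based_equiv T (coarsening T E)"
proof -
  let ?d = "\<lambda>g g'. proportional T E (\<lambda>h. form T g h - form T g' h)"
  let ?s = "\<lambda>g g'. proportional T E (\<lambda>h. form T g h + form T g' h)"
  have d_sym: "?d g' g" if "?d g g'" for g g'
    using proportional_minus[OF that] by simp
  have s_sym: "?s g' g" if "?s g g'" for g g'
    using that by (simp add: add.commute)
  have dd: "?d x z" if "?d x y" "?d y z" for x y z
    using proportional_add[OF that] by simp
  have ds: "?s x z" if "?d x y" "?s y z" for x y z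
    using proportional_add[OF that] by simp
  have ss: "?d x z" if "?s x y" "?s y z" for x y z
    using proportional_diff[OF that] by simp
  have sd: "?s x z" if "?s x y" "?d y z" for x y z
    using ds[OF d_sym[OF that(2)] s_sym[OF that(1)]] by (simp add: add.commute)
  have "refl_on (elems T) (coarsening T E)"
    unfolding refl_on_def coarsening_def using assms proportional_zero by auto
  moreover have "sym (coarsening T E)"
    unfolding sym_def coarsening_def using d_sym s_sym by blast
  moreover have "trans (coarsening T E)"
    unfolding trans_def coarsening_def using dd ds ss sd by blast
  moreover have "coarsening T E \<subseteq> elems T \<times> elems T"
    unfolding coarsening_def using assms by blast
  moreover have "coarsening T E `` {base T} = {base T}"
    unfolding coarsening_def by auto
  ultimately show ?thesis by (simp add: based_equiv_def equiv_def)
qed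

lemma mem_Ann_quotient:
  assumes fin: "finite (elems T)" and E: "equiv (elems T) E"
    and keys: "Poly_Mapping.keys v \<subseteq> proper_elems T"
    and r: "\<And>C. finite C \<Longrightarrow> bform T v (chi C) = sum r C"
  shows "v \<in> Ann T (elems T // E) \<longleftrightarrow> proportional T E r"
proof -
  have "finite C" if "C \<in> elems T // E" for C
    using that fin E by (meson finite_subset in_quotient_imp_subset)
  then show ?thesis
    unfolding Ann_def proportional_def using keys by (simp add: bform_frag_chi r)
qed

text \<open>Bridge between the operator on partitions, defined by formal sums, and the one on
  relations, defined by rows.\<close>

lemma coarsen_quotient:
  assumes fin: "finite (elems T)" and base: "base T \<in> elems T" and E: "equiv (elems T) E"
  shows "coarsen T (elems T // E) = elems T // coarsening T E"
proof -
  let ?R = "{(g, g'). g \<in> proper_elems T \<and> g' \<in> proper_elems T \<and>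
        (frag_of g - frag_of g' \<in> Ann T (elems T // E) \<or> frag_of g + frag_of g' \<in> Ann T (elems T // E))}"
  have R: "coarsening T E = insert (base T, base T) ?R"
  proof -
    have "frag_of g - frag_of g' \<in> Ann T (elems T // E) \<longleftrightarrow> proportional T E (\<lambda>h. form T g h - form T g' h)"
      "frag_of g + frag_of g' \<in> Ann T (elems T // E) \<longleftrightarrow> proportional T E (\<lambda>h. form T g h + form T g' h)"
      if "g \<in> proper_elems T" "g' \<in> proper_elems T" for g g'
    proof -
      have "Poly_Mapping.keys (frag_of g - frag_of g') \<subseteq> proper_elems T"
        "Poly_Mapping.keys (frag_of g + frag_of g') \<subseteq> proper_elems T"
        using keys_diff[of "frag_of g" "frag_of g'"] Poly_Mapping.keys_add[of "frag_of g"
          "frag_of g'"] that by auto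
      from this[THEN mem_Ann_quotient[OF fin E]]
      show "frag_of g - frag_of g' \<in> Ann T (elems T // E)
        \<longleftrightarrow> proportional T E (\<lambda>h. form T g h - form T g' h)"
        "frag_of g + frag_of g' \<in> Ann T (elems T // E) \<longleftrightarrow> proportional T E (\<lambda>h. form T g h + form T g' h)"
        by (simp_all add: bform_diff_left bform_add_left bform_frag_chi sum.distrib sum_subtractf)
    qed
    then show ?thesis unfolding coarsening_def by blast
  qed
  have 1: "coarsening T E `` {base T} = {base T}"
    using based_equiv_coarsening[OF base] by (simp add: based_equiv_def)
  have 2: "coarsening T E `` {g} = ?R `` {g}" if "g \<in> proper_elems T" for g
    using that unfolding R by auto
  have "elems T // coarsening T E = (\<lambda>g. coarsening T E `` {g}) ` elems T"
    by (auto simp: quotient_def)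
  \<comment> \<open>\<open>coarsen\<close> inserts \<open>{s}\<close> by hand, while on the side of
    relations it is the class of s; splitting s off the index set makes the two comparable.\<close>
  also have "\<dots> = (\<lambda>g. coarsening T E `` {g}) ` insert (base T) (proper_elems T)"
    using base by (simp add: insert_absorb)
  also have "(\<lambda>g. coarsening T E `` {g}) ` insert (base T) (proper_elems T) =
      insert (coarsening T E `` {base T}) ((\<lambda>g. coarsening T E `` {g}) ` proper_elems T)"
    by (rule image_insert)
  also have "\<dots> = insert {base T} ((\<lambda>g. ?R `` {g}) ` proper_elems T)"
    unfolding 1 using 2 by (intro arg_cong[where f="insert {base T}"] image_cong) simp_all
  also have "\<dots> = coarsen T (elems T // E)"
    unfolding coarsen_def quotient_def by blast
  finally show ?thesis by simp
qed

lemma equiv_from_quotient: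
  assumes "equiv A r"
  shows "{(x, y). \<exists>C\<in>A // r. x \<in> C \<and> y \<in> C} = r"
proof (intro subset_antisym subrelI)
  fix x y assume "(x, y) \<in> {(x, y). \<exists>C\<in>A // r. x \<in> C \<and> y \<in> C}"
  then show "(x, y) \<in> r" using in_quotient_imp_in_rel[OF assms] by blast
next
  fix x y assume xy: "(x, y) \<in> r"
  then have "x \<in> A" using assms by (auto simp: equiv_def)
  then have "r `` {x} \<in> A // r" "x \<in> r `` {x}"
    using equiv_class_self[OF assms] by (auto intro: quotientI)
  with xy show "(x, y) \<in> {(x, y). \<exists>C\<in>A // r. x \<in> C \<and> y \<in> C}" by blast
qed

lemma equiv_eq_from_quotient:
  assumes "equiv A r" "equiv A s" "A // r = A // s"
  shows "r = s"
  by (rule trans[OF equiv_from_quotient[OF assms(1), symmetric]],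
      subst assms(3), rule equiv_from_quotient[OF assms(2)])

section \<open>Tribes as a least fixed point\<close>

definition tribe_rel ::
  "('g, 'h::comm_ring_1) based_matrix \<Rightarrow> ('g \<times> 'g) set" where
  "tribe_rel T = {(x, y). \<exists>C\<in>tribes T. x \<in> C \<and> y \<in> C}"

text \<open>Otherwise every step adds an element, and the cardinalities exceed that of
  \<open>A\<close>.\<close>

lemma ascending_sequence_stabilizes:
  fixes S :: "nat \<Rightarrow> 'a set"
  assumes "finite A" "\<And>n. S n \<subseteq> A" "\<And>n. S n \<subseteq> S (Suc n)"
  shows "\<exists>n. S (Suc n) = S n"
proof (rule ccontr)
  assume "\<nexists>n. S (Suc n) = S n"
  then have *: "S n \<subset> S (Suc n)" for n using assms(3)[of n] by blast
  have "n \<le> card (S n)" for n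
  proof (induction n)
    case (Suc n)
    have "card (S n) < card (S (Suc n))"
      using * assms(1,2) by (meson finite_subset psubset_card_mono)
    with Suc show ?case by simp
  qed simp
  moreover have "card (S n) \<le> card A" for n using assms(1,2) by (meson card_mono)
  ultimately have "Suc (card A) \<le> card A" using le_trans by blast
  then show False by simp
qed

text \<open>Iteration from the identity relation, which lies below every equivalence relation. In
  the minimality clause a relation that the operator maps into itself suffices; this is the form in
  which it is applied to pulled back and restricted relations.\<close>

lemma tribe_rel_facts:
  assumes fin: "finite (elems T)" and base: "base T \<in> elems T"
  shows tribes_eq_quotient: "tribes T = elems T // tribe_rel T"
    and based_equiv_tribe_rel: "based_equiv T (tribe_rel T)"
    and coarsening_tribe_rel: "coarsening T (tribe_rel T) = tribe_rel T"
    and tribe_rel_least: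
      "\<And>F. based_equiv T F \<Longrightarrow> coarsening T F \<subseteq> F
        \<Longrightarrow> tribe_rel T \<subseteq> F"
proof -
  define E where "E = (\<lambda>n. (coarsening T ^^ n) (Id_on (elems T)))"
  have E_Suc: "E (Suc n) = coarsening T (E n)" for n by (simp add: E_def)
  have be0: "based_equiv T (E 0)"
    unfolding based_equiv_def E_def equiv_def refl_on_def sym_def trans_def using base by auto
  have be: "based_equiv T (E n)" for n
    using be0 based_equiv_coarsening[OF base] by (cases n) (simp_all add: E_Suc)
  then have eq: "equiv (elems T) (E n)" for n by (simp add: based_equiv_def)
  have ps: "partition_seq T n = elems T // E n" for n
  proof (induction n)
    case 0
    have "Id_on (elems T) `` {g} = {g}" if "g \<in> elems T" for g using that by auto
    then show ?case by (auto simp: partition_seq_def E_def quotient_def)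
  next
    case (Suc n)
    have "partition_seq T (Suc n) = coarsen T (partition_seq T n)" by (simp add: partition_seq_def)
    then show ?case using Suc coarsen_quotient[OF fin base eq] by (simp add: E_Suc)
  qed
  have "Id_on (elems T) \<subseteq> F" if "equiv (elems T) F" for F
    using that by (auto simp: equiv_def refl_on_def)
  then have E0: "E 0 \<subseteq> F" if "equiv (elems T) F" for F using that by (simp add: E_def)
  have mono: "E n \<subseteq> E (Suc n)" for n
  proof (induction n)
    case 0
    then show ?case using E0 eq by blast
  next
    case (Suc n)
    then show ?case unfolding E_Suc[of "Suc n"] using coarsening_mono[OF fin eq eq Suc]
      by (simp add: E_Suc)
  qed
  have "E n \<subseteq> elems T \<times> elems T" for n using eq[of n] by (simp add: equiv_def)
  then have "\<exists>n. E (Suc n) = E n"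
    using ascending_sequence_stabilizes[of "elems T \<times> elems T" E] fin mono by auto
  \<comment> \<open>This makes the \<open>LEAST\<close> in the definition of \<open>tribes\<close>
    meaningful.\<close>
  then have ex: "\<exists>n. partition_seq T (Suc n) = partition_seq T n" by (metis ps)
  define N where "N = (LEAST n. partition_seq T (Suc n) = partition_seq T n)"
  have N: "tribes T = partition_seq T N" "partition_seq T (Suc N) = partition_seq T N"
    using LeastI_ex[OF ex] by (simp_all add: tribes_def N_def)
  have R: "tribe_rel T = E N"
    unfolding tribe_rel_def N(1) ps by (rule equiv_from_quotient[OF eq])
  show "tribes T = elems T // tribe_rel T" by (simp add: R N(1) ps)
  show "based_equiv T (tribe_rel T)" by (simp add: R be)
  \<comment> \<open>Only the partitions are known to agree at N; an equivalence relation is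
    recovered from its quotient.\<close>
  have "E (Suc N) = E N" using N(2) equiv_eq_from_quotient[OF eq eq] by (simp add: ps)
  then show "coarsening T (tribe_rel T) = tribe_rel T" by (simp add: R E_Suc)
  show "tribe_rel T \<subseteq> F" if F: "based_equiv T F" "coarsening T F \<subseteq> F" for F
  proof -
    have eF: "equiv (elems T) F" using F by (simp add: based_equiv_def)
    have "E n \<subseteq> F" for n
    proof (induction n)
      case 0
      show ?case using E0 eF by blast
    next
      case (Suc n)
      have "E (Suc n) \<subseteq> coarsening T F" unfolding E_Suc
        by (rule coarsening_mono[OF fin eq eF Suc])
      then show ?case using F by blast
    qed
    then show ?thesis by (simp add: R)
  qed
qed

lemma wf_matrixD:
  assumes "wf_matrix T"
  shows "finite (elems T)" "base T \<in> elems T" "form T (base T) (base T) = 0"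
    "\<And>g h. g \<in> elems T \<Longrightarrow> h \<in> elems T \<Longrightarrow> form T h g
      = - form T g h"
  using assms unfolding wf_matrix_def by blast+

lemma proportional_cong:
  assumes "equiv (elems T) E" "\<And>x. x \<in> elems T \<Longrightarrow> r x = r' x"
  shows "proportional T E r \<longleftrightarrow> proportional T E r'"
proof -
  have "sum r C = sum r' C" if "C \<in> elems T // E" for C
    using in_quotient_imp_subset[OF assms(1) that] assms(2) by (intro sum.cong) auto
  then show ?thesis by (simp add: proportional_def)
qed

lemma tribe_rel_equiv:
  assumes "wf_matrix T"
  shows "equiv (elems T) (tribe_rel T)"
  using based_equiv_tribe_rel wf_matrixD(1,2)[OF assms] by (auto simp: based_equiv_def)

lemma tribe_rel_base:
  assumes "wf_matrix T" "(base T, g) \<in> tribe_rel T \<or> (g, base T) \<in> tribe_rel T"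
  shows "g = base T"
proof -
  have be: "based_equiv T (tribe_rel T)" using based_equiv_tribe_rel wf_matrixD(1,2)[OF assms(1)]
    by blast
  then have "(base T, g) \<in> tribe_rel T" using assms(2)
    by (auto simp: based_equiv_def equiv_def sym_def)
  then show ?thesis using be by (auto simp: based_equiv_def)
qed

lemma tribe_rel_iff:
  assumes "wf_matrix T" "g \<in> proper_elems T" "g' \<in> proper_elems T"
  shows "(g, g') \<in> tribe_rel T \<longleftrightarrow>
     proportional T (tribe_rel T) (\<lambda>h. form T g h - form T g' h) \<or>
     proportional T (tribe_rel T) (\<lambda>h. form T g h + form T g' h)"
proof -
  have "(g, g') \<in> tribe_rel T \<longleftrightarrow> (g, g') \<in> coarsening T (tribe_rel T)"
    using coarsening_tribe_rel wf_matrixD(1,2)[OF assms(1)] by metis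
  then show ?thesis using assms(2,3) by (auto simp: coarsening_def)
qed

lemma proportional_base:
  assumes "equiv (elems T) E"
    "\<And>x. x \<in> elems T \<Longrightarrow> r x = of_int k * form T (base T) x"
  shows "proportional T E r"
proof -
  have "sum r C = of_int k * sum (form T (base T)) C" if "C \<in> elems T // E" for C
    unfolding sum_distrib_left
    using in_quotient_imp_subset[OF assms(1) that] assms(2) by (intro sum.cong) auto
  then show ?thesis by (auto simp: proportional_def)
qed

section \<open>Isomorphisms of based matrices\<close>

definition matrix_iso ::
  "('g \<Rightarrow> 'k) \<Rightarrow> ('g, 'h::comm_ring_1) based_matrix \<Rightarrow> ('k, 'h) based_matrix \<Rightarrow> bool" where
  "matrix_iso \<theta> T T' \<longleftrightarrow> bij_betw \<theta> (elems T) (elems T')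
    \<and> \<theta> (base T) = base T' \<and>
     (\<forall>g\<in>elems T. \<forall>h\<in>elems T. form T' (\<theta> g) (\<theta> h) = form T g h)"

lemma matrix_iso_mem:
  "matrix_iso \<theta> T T' \<Longrightarrow> g \<in> elems T
  \<Longrightarrow> \<theta> g \<in> elems T'"
  by (auto simp: matrix_iso_def bij_betw_def)

lemma matrix_iso_inj:
  "matrix_iso \<theta> T T' \<Longrightarrow> g \<in> elems T \<Longrightarrow> h \<in> elems T
  \<Longrightarrow> \<theta> g = \<theta> h \<longleftrightarrow> g = h"
  by (auto simp: matrix_iso_def bij_betw_def inj_on_def)

lemma matrix_iso_proper:
  assumes "matrix_iso \<theta> T T'" "base T \<in> elems T" "g \<in> elems T"
  shows "\<theta> g \<in> proper_elems T' \<longleftrightarrow> g \<in> proper_elems T"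
  using assms matrix_iso_mem[OF assms(1,3)] matrix_iso_inj[OF assms(1,3,2)]
  by (auto simp: matrix_iso_def)

lemma matrix_iso_form:
  "matrix_iso \<theta> T T' \<Longrightarrow> g \<in> elems T \<Longrightarrow> h \<in> elems T
    \<Longrightarrow> form T' (\<theta> g) (\<theta> h) = form T g h"
  by (auto simp: matrix_iso_def)

lemma matrix_iso_surj:
  assumes "matrix_iso \<theta> T T'" "y \<in> elems T'"
  obtains x where "x \<in> elems T" "y = \<theta> x"
proof -
  have "y \<in> \<theta> ` elems T" using assms by (simp add: matrix_iso_def bij_betw_def)
  then show thesis using that by blast
qed

lemma matrix_iso_inv:
  assumes "matrix_iso \<theta> T T'" "base T \<in> elems T"
  shows "matrix_iso (inv_into (elems T) \<theta>) T' T"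
proof -
  let ?i = "inv_into (elems T) \<theta>"
  have b: "bij_betw \<theta> (elems T) (elems T')" using assms by (simp add: matrix_iso_def)
  have i: "?i (\<theta> x) = x" if "x \<in> elems T" for x
    using that b by (simp add: bij_betw_def)
  have "form T (?i g) (?i h) = form T' g h" if gh: "g \<in> elems T'" "h \<in> elems T'" for g h
  proof -
    obtain x y where "x \<in> elems T" "g = \<theta> x" "y \<in> elems T" "h = \<theta> y"
      using gh matrix_iso_surj[OF assms(1)] by metis
    then show ?thesis using i assms by (simp add: matrix_iso_def)
  qed
  moreover have "?i (base T') = base T" using i[OF assms(2)] assms by (simp add: matrix_iso_def)
  ultimately show ?thesis using bij_betw_inv_into[OF b] by (simp add: matrix_iso_def)
qed

lemma matrix_iso_comp:
  assumes "matrix_iso \<theta> T T'" "matrix_iso \<eta> T' T''"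
  shows "matrix_iso (\<eta> \<circ> \<theta>) T T''"
  using assms bij_betw_trans[of \<theta> "elems T" "elems T'" \<eta> "elems T''"]
    matrix_iso_mem[OF assms(1)] by (simp add: matrix_iso_def)

lemma matrix_iso_sum:
  assumes "matrix_iso \<theta> T T'" "C \<subseteq> elems T"
  shows "sum r (\<theta> ` C) = sum (r \<circ> \<theta>) C"
  by (rule sum.reindex) (use assms in \<open>auto simp: matrix_iso_def bij_betw_def intro: inj_on_subset\<close>)

lemma matrix_iso_sum_form:
  assumes "matrix_iso \<theta> T T'" "C \<subseteq> elems T" "g \<in> elems T"
  shows "sum (form T' (\<theta> g)) (\<theta> ` C) = sum (form T g) C"
  unfolding matrix_iso_sum[OF assms(1,2)]
  by (rule sum.cong) (use assms matrix_iso_form[OF assms(1)] in auto)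

text \<open>With \<open>E\<close> the pullback of \<open>E'\<close>, the map \<theta> sends the
  classes of \<open>E\<close> bijectively onto those of \<open>E'\<close>, so the class sums on both
  sides are literally the same and the factor is kept.\<close>

lemma proportional_pullback:
  assumes iso: "matrix_iso \<theta> T T'" and base: "base T \<in> elems T"
    and E': "equiv (elems T') E'"
    and E: "E = {(x, y). x \<in> elems T \<and> y \<in> elems T
      \<and> (\<theta> x, \<theta> y) \<in> E'}"
    and r: "\<And>x. x \<in> elems T \<Longrightarrow> r' (\<theta> x) = r x"
    and p: "proportional T E r"
  shows "proportional T' E' r'"
proof -
  obtain k where k:
    "\<And>C. C \<in> elems T // E \<Longrightarrow> sum r C = of_int k * sum (form T (base T)) C"
    using p by (auto simp: proportional_def)
  have "sum r' C' = of_int k * sum (form T' (base T')) C'" if C': "C' \<in> elems T' // E'" for C'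
  proof -
    obtain y where y: "y \<in> elems T'" "C' = E' `` {y}" using C' by (auto elim: quotientE)
    obtain x where x: "x \<in> elems T" "y = \<theta> x" using matrix_iso_surj[OF iso y(1)] .
    let ?C = "E `` {x}"
    have C: "?C \<in> elems T // E" "?C \<subseteq> elems T" using x(1)
      by (rule quotientI) (auto simp: E)
    have "C' \<subseteq> elems T'" using E' C' by (simp add: in_quotient_imp_subset)
    then have "C' \<subseteq> \<theta> ` ?C"
    proof (intro subsetI)
      fix z assume z: "z \<in> C'"
      then obtain w where "w \<in> elems T" "z = \<theta> w"
        using matrix_iso_surj[OF iso] \<open>C' \<subseteq> elems T'\<close> by blast
      then show "z \<in> \<theta> ` ?C" using z x y by (auto simp: E)
    qed
    moreover have "\<theta> ` ?C \<subseteq> C'" using x y by (auto simp: E)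
    ultimately have eq: "C' = \<theta> ` ?C" by blast
    have "sum r' C' = sum (r' \<circ> \<theta>) ?C" unfolding eq
      by (rule matrix_iso_sum[OF iso C(2)])
    also have "\<dots> = sum r ?C" by (rule sum.cong) (use r C(2) in auto)
    also have "\<dots> = of_int k * sum (form T (base T)) ?C" by (rule k[OF C(1)])
    also have "sum (form T (base T)) ?C = sum (form T' (base T')) C'"
      using matrix_iso_sum_form[OF iso C(2) base] iso by (simp add: eq matrix_iso_def)
    finally show ?thesis .
  qed
  then show ?thesis by (auto simp: proportional_def)
qed

lemma wf_matrix_iso:
  assumes iso: "matrix_iso \<theta> T T'" and wf: "wf_matrix T"
  shows "wf_matrix T'"
proof -
  have "form T' h g = - form T' g h" if gh: "g \<in> elems T'" "h \<in> elems T'" for g h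
  proof -
    obtain x y where "x \<in> elems T" "g = \<theta> x" "y \<in> elems T" "h = \<theta> y"
      using gh matrix_iso_surj[OF iso] by metis
    then show ?thesis using wf_matrixD(4)[OF wf] matrix_iso_form[OF iso] by metis
  qed
  moreover have "finite (elems T')"
    using iso wf_matrixD(1)[OF wf] by (auto simp: matrix_iso_def bij_betw_finite)
  moreover have "base T' \<in> elems T'"
    using matrix_iso_mem[OF iso wf_matrixD(2)[OF wf]] iso by (simp add: matrix_iso_def)
  moreover have "form T' (base T') (base T') = 0"
    using matrix_iso_form[OF iso wf_matrixD(2,2)[OF wf]] iso wf_matrixD(3)[OF wf]
      by (simp add: matrix_iso_def)
  ultimately show ?thesis unfolding wf_matrix_def by blast
qed

text \<open>The pullback of the tribe relation of \<open>T'\<close> is mapped into itself by the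
  operator of \<open>T\<close>, hence contains the least such relation. The converse inclusion comes
  from the inverse isomorphism.\<close>

lemma tribe_rel_iso_mono:
  assumes iso: "matrix_iso \<theta> T T'" and wf: "wf_matrix T" and xy: "(x, y) \<in> tribe_rel T"
  shows "(\<theta> x, \<theta> y) \<in> tribe_rel T'"
proof -
  note wf' = wf_matrix_iso[OF iso wf]
  note base = wf_matrixD(2)[OF wf]
  let ?F = "{(x, y). x \<in> elems T \<and> y \<in> elems T \<and> (\<theta> x, \<theta> y) \<in> tribe_rel T'}"
  note E' = tribe_rel_equiv[OF wf']
  have "equiv (elems T) ?F"
    using E' matrix_iso_mem[OF iso] unfolding equiv_def refl_on_def sym_def trans_def by blast
  moreover have "?F `` {base T} = {base T}"
  proof -
    have "(\<theta> (base T), \<theta> y) \<in> tribe_rel T' \<longleftrightarrow> y = base T"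
      if "y \<in> elems T" for y
      using tribe_rel_base[OF wf', of
        "\<theta> y"] matrix_iso_inj[OF iso that base] iso E' wf_matrixD(2)[OF wf']
      by (auto simp: matrix_iso_def equiv_def refl_on_def)
    then show ?thesis using base by auto
  qed
  ultimately have be: "based_equiv T ?F" by (simp add: based_equiv_def)
  have "coarsening T ?F \<subseteq> ?F"
  proof (intro subrelI)
    fix g g' assume gg: "(g, g') \<in> coarsening T ?F"
    show "(g, g') \<in> ?F"
    proof (cases "(g, g') = (base T, base T)")
      case True
      then show ?thesis using base iso E' wf_matrixD(2)[OF wf']
        by (auto simp: matrix_iso_def equiv_def refl_on_def)
    next
      case False
      then have g: "g \<in> proper_elems T" "g' \<in> proper_elems T"
        and p: "proportional T ?F (\<lambda>h. form T g h - form T g' h) \<or>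
          proportional T ?F (\<lambda>h. form T g h + form T g' h)"
        using gg by (auto simp: coarsening_def)
      then have *:
        "form T' (\<theta> g) (\<theta> x) - form T' (\<theta> g') (\<theta> x)
        = form T g x - form T g' x"
        "form T' (\<theta> g) (\<theta> x) + form T' (\<theta> g') (\<theta> x) = form T g x
          + form T g' x" if "x \<in> elems T" for x
        using that matrix_iso_form[OF iso] by simp_all
      have "proportional T' (tribe_rel T') (\<lambda>h. form T' (\<theta> g) h - form T' (\<theta> g') h) \<or>
          proportional T' (tribe_rel T') (\<lambda>h. form T' (\<theta> g) h + form T' (\<theta> g') h)"
        using p proportional_pullback[OF iso base E' refl, of
          "\<lambda>h. form T' (\<theta> g) h - form T' (\<theta> g') h", OF *(1)]
          proportional_pullback[OF iso base E' refl, of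
            "\<lambda>h. form T' (\<theta> g) h + form T' (\<theta> g') h", OF *(2)]
        by blast
      then have "(\<theta> g, \<theta> g') \<in> tribe_rel T'"
        using tribe_rel_iff[OF wf'] g matrix_iso_proper[OF iso base] by blast
      then show ?thesis using g by simp
    qed
  qed
  from tribe_rel_least[OF wf_matrixD(1)[OF wf] base be this] show ?thesis using xy by blast
qed

lemma tribe_rel_iso:
  assumes iso: "matrix_iso \<theta> T T'" and wf: "wf_matrix T"
    and xy: "x \<in> elems T" "y \<in> elems T"
  shows "(\<theta> x, \<theta> y) \<in> tribe_rel T' \<longleftrightarrow> (x, y) \<in> tribe_rel T"
proof
  assume "(\<theta> x, \<theta> y) \<in> tribe_rel T'"
  from tribe_rel_iso_mono[OF matrix_iso_inv[OF iso wf_matrixD(2)[OF wf]] wf_matrix_iso[OF iso wf] this]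
  show "(x, y) \<in> tribe_rel T" using xy iso by (simp add: matrix_iso_def bij_betw_def)
qed (rule tribe_rel_iso_mono[OF iso wf])

text \<open>The zero tribe without an adjoined element: an annihilating element has row 0, so being
  equivalent to it, with either sign, says that the row of \<open>h\<close> itself is
  proportional.\<close>

definition zero_elems :: "('g, 'h::comm_ring_1) based_matrix \<Rightarrow> 'g set" where
  "zero_elems T = {h \<in> proper_elems T. proportional T (tribe_rel T) (form T h)}"

lemma zero_elems_iso:
  assumes iso: "matrix_iso \<theta> T T'" and wf: "wf_matrix T" and x: "x \<in> zero_elems T"
  shows "\<theta> x \<in> zero_elems T'"
proof -
  note wf' = wf_matrix_iso[OF iso wf]
  note base = wf_matrixD(2)[OF wf]
  have x': "x \<in> elems T" "x \<in> proper_elems T" "proportional T (tribe_rel T) (form T x)"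
    using x by (auto simp: zero_elems_def)
  have "tribe_rel T = {(x, y). x \<in> elems T \<and> y \<in> elems T
    \<and> (\<theta> x, \<theta> y) \<in> tribe_rel T'}"
    using tribe_rel_iso[OF iso wf] tribe_rel_equiv[OF wf] by (auto simp: equiv_def)
  from proportional_pullback[OF iso base tribe_rel_equiv[OF wf'] this _ x'(3), of
    "form T' (\<theta> x)"]
  have "proportional T' (tribe_rel T') (form T' (\<theta> x))"
    using matrix_iso_form[OF iso x'(1)] by blast
  then show ?thesis using matrix_iso_proper[OF iso base x'(1)] x'(2) by (simp add: zero_elems_def)
qed

text \<open>If the row of g and its difference from or sum with the row of h are proportional, so is
  the row of h. Hence the zero elements are empty or exactly one tribe.\<close>

lemma zero_elems_rel:
  assumes wf: "wf_matrix T" and g: "g \<in> zero_elems T"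
  shows "(g, h) \<in> tribe_rel T \<longleftrightarrow> h \<in> zero_elems T"
proof -
  have g': "g \<in> proper_elems T" "proportional T (tribe_rel T) (form T g)"
    using g by (auto simp: zero_elems_def)
  show ?thesis
  proof
    assume h: "h \<in> zero_elems T"
    then have "proportional T (tribe_rel T) (\<lambda>x. form T g x - form T h x)"
      using g' by (intro proportional_diff) (auto simp: zero_elems_def)
    then show "(g, h) \<in> tribe_rel T" using tribe_rel_iff[OF wf g'(1)] h
      by (auto simp: zero_elems_def)
  next
    assume gh: "(g, h) \<in> tribe_rel T"
    then have "h \<noteq> base T" using tribe_rel_base[OF wf] g' by blast
    then have h: "h \<in> proper_elems T" using gh tribe_rel_equiv[OF wf] by (auto simp: equiv_def)
    from gh tribe_rel_iff[OF wf g'(1) h]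
    have "proportional T (tribe_rel T) (\<lambda>x. form T g x - form T h x) \<or>
      proportional T (tribe_rel T) (\<lambda>x. form T g x + form T h x)" by blast
    then have "proportional T (tribe_rel T) (form T h)"
      using proportional_diff[OF g'(2)] proportional_minus[OF proportional_diff[OF g'(2)]] by force
    then show "h \<in> zero_elems T" using h by (simp add: zero_elems_def)
  qed
qed

section \<open>Adjoining elements\<close>

text \<open>Treats the three operations at once: X is the adjoined set, and its rows add up to the
  row of s if \<epsilon> holds and to 0 otherwise. A single element may be of either kind (core or
  annihilating); a pair has to be complementary.\<close>

definition cancels ::
  "('g, 'h::comm_ring_1) based_matrix \<Rightarrow> 'g set \<Rightarrow> bool \<Rightarrow> bool" where
  "cancels T X \<epsilon> \<longleftrightarrow> X \<subseteq> proper_elems T \<and>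
     ((\<exists>g. X = {g}) \<or> (\<exists>g g'. g \<noteq> g' \<and> X = {g, g'} \<and> \<epsilon>)) \<and>
     (\<forall>h\<in>elems T. (\<Sum>g\<in>X. form T g h) = (if \<epsilon> then form T (base T) h else 0))"

lemma cancels_annihilating: "cancels T {g} False \<longleftrightarrow> annihilating T g"
  by (auto simp: cancels_def annihilating_def)

lemma cancels_core: "cancels T {g} True \<longleftrightarrow> core T g"
  by (auto simp: cancels_def core_def)

lemma cancels_complementary:
  "g \<noteq> g' \<Longrightarrow> cancels T {g, g'} \<epsilon> \<longleftrightarrow> \<epsilon>
    \<and> complementary T g g'"
  by (auto simp: cancels_def complementary_def doubleton_eq_iff)

lemma operation_iff_cancels:
  "operation T T' \<longleftrightarrow> (\<exists>X \<epsilon>. extends T X T'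
    \<and> cancels T' X \<epsilon>)"
proof
  assume "operation T T'"
  then consider g where "extends T {g} T'" "annihilating T' g"
    | g where "extends T {g} T'" "core T' g"
    | g g' where "extends T {g, g'} T'" "complementary T' g g'"
    by (auto simp: operation_def M1_def M2_def M3_def)
  then show "\<exists>X \<epsilon>. extends T X T' \<and> cancels T' X \<epsilon>"
  proof cases
    case (3 g g')
    then have "g \<noteq> g'" by (simp add: complementary_def)
    then have "cancels T' {g, g'} True" using 3 by (simp add: cancels_complementary)
    with 3 show ?thesis by blast
  next
    case (1 g)
    then have "cancels T' {g} False" by (simp add: cancels_annihilating)
    with 1 show ?thesis by blast
  next
    case (2 g)
    then have "cancels T' {g} True" by (simp add: cancels_core)
    with 2 show ?thesis by blast
  qed
next
  assume "\<exists>X \<epsilon>. extends T X T' \<and> cancels T' X \<epsilon>"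
  then obtain X \<epsilon> where e: "extends T X T'" "cancels T' X \<epsilon>" by blast
  then consider g where "X = {g}" | g g' where "g \<noteq> g'" "X = {g, g'}"
    by (auto simp: cancels_def)
  then show "operation T T'"
  proof cases
    case (1 g)
    then show ?thesis using e
      by (cases \<epsilon>) (auto simp: operation_def M1_def M2_def cancels_annihilating cancels_core)
  next
    case (2 g g')
    then have "M3 T g g' T'" using e cancels_complementary[OF 2(1), of T' \<epsilon>] 2(2)
      by (simp add: M3_def)
    then show ?thesis by (auto simp: operation_def)
  qed
qed

lemma extendsD:
  assumes "extends T X T'"
  shows "wf_matrix T" "wf_matrix T'" "base T' = base T" "X \<inter> elems T = {}"
    "elems T' = elems T \<union> X"
      "\<And>g h. g \<in> elems T \<Longrightarrow> h \<in> elems T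
      \<Longrightarrow> form T' g h = form T g h"
  using assms unfolding extends_def by blast+

text \<open>The row condition read in columns, by skew symmetry. It tells by how much a class sum
  grows when all of X joins the class.\<close>

lemma cancels_sum_right:
  assumes "wf_matrix T" "cancels T X \<epsilon>" "g \<in> elems T"
  shows "sum (form T g) X = (if \<epsilon> then form T g (base T) else 0)"
proof -
  have X: "X \<subseteq> elems T" using assms by (auto simp: cancels_def)
  have "sum (form T g) X = (\<Sum>x\<in>X. - form T x g)"
    by (rule sum.cong) (use wf_matrixD(4)[OF assms(1)] X assms(3) in blast)+
  also have "\<dots> = - (if \<epsilon> then form T (base T) g else 0)"
    using assms by (simp add: sum_negf cancels_def)
  also have "\<dots> = (if \<epsilon> then form T g (base T) else 0)"
    using wf_matrixD(4)[OF assms(1) wf_matrixD(2)[OF assms(1)] assms(3)] by simp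
  finally show ?thesis .
qed

text \<open>For a pair the sum of the rows is the row of s, which is proportional with factor 1. So
  X always falls into a single class.\<close>

lemma cancels_related:
  assumes wf: "wf_matrix T" and c: "cancels T X \<epsilon>" and E: "equiv (elems T) E"
    and x: "x \<in> X" and y: "y \<in> X"
  shows "(x, y) \<in> coarsening T E"
proof (cases "x = y")
  case True
  then show ?thesis using c x proportional_zero[of T E] by (auto simp: coarsening_def cancels_def)
next
  case False
  then have X: "X = {x, y}" "\<epsilon>" "X \<subseteq> proper_elems T" using c x y
    by (auto simp: cancels_def)
  then have "form T x h + form T y h = form T (base T) h" if "h \<in> elems T" for h
    using that c False by (simp add: cancels_def)
  then have "proportional T E (\<lambda>h. form T x h + form T y h)"
    by (intro proportional_base[OF E, of _ 1]) simp
  then show ?thesis using X by (auto simp: coarsening_def)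
qed

text \<open>A class contains X or misses it, so passing to its trace on \<open>T\<close> changes a
  class sum by 0 or by the value of the row at s. That value vanishes for a proportional row and for
  the row of s. This comparison is the source of all compatibility of tribes with
  operations.\<close>

lemma proportional_restrict:
  assumes ext: "extends T X T'" and c: "cancels T' X \<epsilon>" and be: "based_equiv T' E"
    and X: "X \<times> X \<subseteq> E" and row: "sum r X = (if \<epsilon> then r (base T) else 0)"
  shows "proportional T' E r \<longleftrightarrow> proportional T (E \<inter> elems T \<times> elems T) r"
proof -
  note e = extendsD[OF ext]
  let ?F = "E \<inter> elems T \<times> elems T"
  have E: "equiv (elems T') E" and Eb: "E `` {base T} = {base T}"
    using be e(3) by (auto simp: based_equiv_def)
  have baseq: "{base T} \<in> elems T' // E" "{base T} \<in> elems T // ?F"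
  proof -
    have "base T \<in> elems T" using wf_matrixD(2)[OF e(1)] .
    then have "?F `` {base T} = {base T}" "base T \<in> elems T'" using Eb e(5) by auto
    then show "{base T} \<in> elems T' // E" "{base T} \<in> elems T // ?F"
      using Eb \<open>base T \<in> elems T\<close> by (metis quotientI)+
  qed
  have sum_split: "sum q C = sum q (C \<inter> elems T)"
    if C: "C \<in> elems T' // E"
      and q: "sum q X = (if \<epsilon> then q (base T) else 0)" "q (base T) = 0" for C q
  proof -
    have sub: "C \<subseteq> elems T'" using E C by (simp add: in_quotient_imp_subset)
    then have fin: "finite C" using wf_matrixD(1)[OF e(2)] finite_subset by blast
    have dec: "C = (C \<inter> elems T) \<union> (C \<inter> X)"
      "(C \<inter> elems T) \<inter> (C \<inter> X) = {}"
      using sub e(4,5) by blast+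
    have "sum q C = sum q ((C \<inter> elems T) \<union> (C \<inter> X))" using dec(1) by simp
    also have "\<dots> = sum q (C \<inter> elems T) + sum q (C \<inter> X)"
      by (rule sum.union_disjoint) (use fin dec(2) in auto)
    also have "sum q (C \<inter> X) = 0"
    proof (cases "C \<inter> X = {}")
      case False
      then obtain x where "x \<in> C" "x \<in> X" by blast
      then have "X \<subseteq> C" using X in_quotient_imp_closed[OF E C] by blast
      then show ?thesis using q by (simp add: Int_absorb1)
    qed simp
    finally show ?thesis by simp
  qed
  have bs: "sum (form T' (base T')) X = (if \<epsilon> then form T' (base T') (base T) else 0)"
    using cancels_sum_right[OF e(2) c wf_matrixD(2)[OF e(2)]] e(3) by simp
  have b0: "form T' (base T') (base T) = 0" using wf_matrixD(3)[OF e(2)] e(3) by simp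
  have bsum: "sum (form T' (base T')) C = sum (form T (base T)) (C \<inter> elems T)"
    if C: "C \<in> elems T' // E" for C
  proof -
    have "sum (form T' (base T')) (C \<inter> elems T) = sum (form T (base T)) (C \<inter> elems T)"
      by (rule sum.cong) (use e(3,6) wf_matrixD(2)[OF e(1)] in auto)
    then show ?thesis using sum_split[OF C bs b0] by simp
  qed
  have quo: "C \<inter> elems T \<in> elems T // ?F"
    if C: "C \<in> elems T' // E" "C \<inter> elems T \<noteq> {}" for C
  proof -
    obtain x where x: "x \<in> C" "x \<in> elems T" using C by blast
    have "C = E `` {x}"
      using in_quotient_imp_closed[OF E C(1) x(1)] in_quotient_imp_in_rel[OF E C(1)] x(1) by blast
    then have "C \<inter> elems T = ?F `` {x}" using x by blast
    then show ?thesis using x by (metis quotientI)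
  qed
  have quo': "\<exists>C\<in>elems T' // E. D = C \<inter> elems T" if D: "D \<in> elems T // ?F"
    for D
  proof -
    obtain x where x: "x \<in> elems T" "D = ?F `` {x}" using D by (auto elim: quotientE)
    have "x \<in> elems T'" using x(1) e(5) by simp
    from quotientI[OF this, of E] show ?thesis using x by (intro bexI[of _ "E `` {x}"]) auto
  qed
  show ?thesis
  proof
    assume "proportional T' E r"
    then obtain k
      where k: "\<And>C. C \<in> elems T' // E \<Longrightarrow> sum r C
      = of_int k * sum (form T' (base T')) C"
      by (auto simp: proportional_def)
    \<comment> \<open>At the class \<open>{s}\<close> proportionality reads r(s) = k b(s,s) =
      0.\<close>
    have r0: "r (base T) = 0" using k[OF baseq(1)] b0 by simp
    have "sum r D = of_int k * sum (form T (base T)) D" if "D \<in> elems T // ?F" for D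
    proof -
      obtain C where C: "C \<in> elems T' // E" "D = C \<inter> elems T"
        using quo'[OF \<open>D \<in> elems T // ?F\<close>] by blast
      then show ?thesis using k[OF C(1)] sum_split[OF C(1) row r0] bsum[OF C(1)] by simp
    qed
    then show "proportional T ?F r" by (auto simp: proportional_def)
  next
    assume "proportional T ?F r"
    then obtain k
      where k: "\<And>C. C \<in> elems T // ?F \<Longrightarrow> sum r C
      = of_int k * sum (form T (base T)) C"
      by (auto simp: proportional_def)
    have r0: "r (base T) = 0" using k[OF baseq(2)] wf_matrixD(3)[OF e(1)] by simp
    \<comment> \<open>A class contained in X has empty trace; then both sides are 0.\<close>
    have "sum r C = of_int k * sum (form T' (base T')) C" if C: "C \<in> elems T' // E" for C
      unfolding sum_split[OF C row r0] bsum[OF C] using quo[OF C] k by fastforce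
    then show "proportional T' E r" by (auto simp: proportional_def)
  qed
qed

text \<open>Supplies the hypothesis \<open>row\<close> of \<open>proportional_restrict\<close> for
  the three kinds of rows that occur: those of g, g - g' and g + g'.\<close>

lemma extends_row_sums:
  assumes ext: "extends T X T'" and c: "cancels T' X \<epsilon>"
    and g: "g \<in> elems T'" "g' \<in> elems T'"
  shows "(\<Sum>h\<in>X. form T' g h) = (if \<epsilon> then form T' g (base T) else 0)"
    "(\<Sum>h\<in>X. form T' g h - form T' g' h) =
       (if \<epsilon> then form T' g (base T) - form T' g' (base T) else 0)"
    "(\<Sum>h\<in>X. form T' g h + form T' g' h) =
       (if \<epsilon> then form T' g (base T) + form T' g' (base T) else 0)"
  using cancels_sum_right[OF extendsD(2)[OF ext] c] g extendsD(3)[OF ext]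
  by (auto simp: sum.distrib sum_subtractf)

lemma based_equiv_restrict:
  assumes ext: "extends T X T'" and be: "based_equiv T' E"
  shows "based_equiv T (E \<inter> elems T \<times> elems T)"
proof -
  note e = extendsD[OF ext]
  have "equiv (elems T') E" "E `` {base T} = {base T}" using be e(3) by (auto simp: based_equiv_def)
  then have "refl_on (elems T) (E \<inter> elems T \<times> elems T)"
    "sym (E \<inter> elems T \<times> elems T)"
    "trans (E \<inter> elems T \<times> elems T)"
    using e(5) by (auto simp: equiv_def refl_on_def sym_def intro: trans_Int transI)
  then show ?thesis using wf_matrixD(2)[OF e(1)] \<open>E `` {base T} = {base T}\<close>
    by (auto simp: based_equiv_def equiv_def)
qed

lemma coarsening_restrict:
  assumes ext: "extends T X T'" and c: "cancels T' X \<epsilon>" and be: "based_equiv T' E"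
    and X: "X \<times> X \<subseteq> E"
  shows "coarsening T' E \<inter> elems T \<times> elems T = coarsening T (E \<inter> elems T \<times> elems T)"
proof -
  note e = extendsD[OF ext]
  have F: "equiv (elems T) (E \<inter> elems T \<times> elems T)"
    using based_equiv_restrict[OF ext be] by (simp add: based_equiv_def)
  have *: "proportional T' E (\<lambda>h. form T' g h - form T' g' h) \<longleftrightarrow>
      proportional T (E \<inter> elems T \<times> elems T) (\<lambda>h. form T g h - form T g' h)"
    "proportional T' E (\<lambda>h. form T' g h + form T' g' h) \<longleftrightarrow>
      proportional T (E \<inter> elems T \<times> elems T) (\<lambda>h. form T g h + form T g' h)"
    if g: "g \<in> elems T" "g' \<in> elems T" for g g'
  proof -
    have g2: "g \<in> elems T'" "g' \<in> elems T'" using g e(5) by auto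
    show "proportional T' E (\<lambda>h. form T' g h - form T' g' h) \<longleftrightarrow>
      proportional T (E \<inter> elems T \<times> elems T) (\<lambda>h. form T g h - form T g' h)"
      unfolding proportional_restrict[OF ext c be X extends_row_sums(2)[OF ext c g2]]
      by (rule proportional_cong[OF F]) (use g e(6) in simp)
    show "proportional T' E (\<lambda>h. form T' g h + form T' g' h) \<longleftrightarrow>
      proportional T (E \<inter> elems T \<times> elems T) (\<lambda>h. form T g h + form T g' h)"
      unfolding proportional_restrict[OF ext c be X extends_row_sums(3)[OF ext c g2]]
      by (rule proportional_cong[OF F]) (use g e(6) in simp)
  qed
  have "base T \<in> elems T" using wf_matrixD(2)[OF e(1)] .
  then show ?thesis unfolding coarsening_def using e(3,5) * by auto
qed

lemma tribe_rel_cancels: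
  assumes "wf_matrix T" "cancels T X \<epsilon>"
  shows "X \<times> X \<subseteq> tribe_rel T"
  using cancels_related[OF assms tribe_rel_equiv[OF assms(1)]]
    coarsening_tribe_rel wf_matrixD(1,2)[OF assms(1)] by fastforce

text \<open>Minimality is used on both sides. The trace of the larger tribe relation is closed for
  \<open>T\<close>; conversely a closed relation for \<open>T'\<close> with the right trace has to
  be constructed.\<close>

lemma tribe_rel_extends:
  assumes ext: "extends T X T'" and c: "cancels T' X \<epsilon>"
  shows "tribe_rel T = tribe_rel T' \<inter> elems T \<times> elems T"
proof
  note e = extendsD[OF ext]
  note T = wf_matrixD(1,2)[OF e(1)] and T' = wf_matrixD(1,2)[OF e(2)]
  note be' = based_equiv_tribe_rel[OF T'] and be = based_equiv_tribe_rel[OF T]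
  show "tribe_rel T \<subseteq> tribe_rel T' \<inter> elems T \<times> elems T"
    using tribe_rel_least[OF T based_equiv_restrict[OF ext be']]
      coarsening_restrict[OF ext c be' tribe_rel_cancels[OF e(2) c]] coarsening_tribe_rel[OF T']
    by simp
  \<comment> \<open>In \<open>D\<close> the set X is a class of its own, although it may belong to a
    tribe that also meets \<open>T\<close>. One coarsening step attaches X correctly without
    changing the trace.\<close>
  define D where "D = tribe_rel T \<union> X \<times> X"
  define E where "E = coarsening T' D"
  have eT: "equiv (elems T) (tribe_rel T)" and bT: "tribe_rel T `` {base T} = {base T}"
    using be by (auto simp: based_equiv_def)
  have Xp: "X \<subseteq> proper_elems T'" using c by (simp add: cancels_def)
  have beD: "based_equiv T' D"
    unfolding based_equiv_def
  proof
    have TT: "tribe_rel T \<subseteq> elems T \<times> elems T" using eT by (simp add: equiv_def)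
    show "equiv (elems T') D"
    proof (rule equivI)
      show "D \<subseteq> elems T' \<times> elems T'" using TT e(5) by (auto simp: D_def)
      show "refl_on (elems T') D" using eT e(5) by (auto simp: D_def equiv_def refl_on_def)
      show "sym D" using eT by (auto simp: D_def equiv_def sym_def)
      show "trans D" using eT e(4) TT unfolding D_def equiv_def trans_def by blast
    qed
    show "D `` {base T'} = {base T'}" using bT e(3) Xp by (auto simp: D_def)
  qed
  then have eqD: "equiv (elems T') D" by (simp add: based_equiv_def)
  have beE: "based_equiv T' E" unfolding E_def by (rule based_equiv_coarsening[OF T'(2)])
  have XE: "X \<times> X \<subseteq> E" using cancels_related[OF e(2) c eqD] by (auto simp: E_def)
  have Dr: "D \<inter> elems T \<times> elems T = tribe_rel T" using eT e(4)
    by (auto simp: D_def equiv_def)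
  have Er: "E \<inter> elems T \<times> elems T = tribe_rel T"
    unfolding E_def using coarsening_restrict[OF ext c beD] Dr coarsening_tribe_rel[OF T]
    by (simp add: D_def)
  \<comment> \<open>Proportionality with respect to \<open>D\<close> and to \<open>E\<close> both
    reduce to the common trace, so coarsening does not tell them apart and \<open>E\<close> is
    already closed.\<close>
  have same: "proportional T' E r \<longleftrightarrow> proportional T' D r"
    if "sum r X = (if \<epsilon> then r (base T) else 0)" for r
    using proportional_restrict[OF ext c beE XE that] proportional_restrict[OF ext c beD _ that] Er Dr
    by (simp add: D_def)
  have "coarsening T' E = E"
  proof -
    have "proportional T' E (\<lambda>h. form T' g h - form T' g' h) \<longleftrightarrow>
        proportional T' D (\<lambda>h. form T' g h - form T' g' h)"
      "proportional T' E (\<lambda>h. form T' g h + form T' g' h) \<longleftrightarrow>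
        proportional T' D (\<lambda>h. form T' g h + form T' g' h)"
      if "g \<in> elems T'" "g' \<in> elems T'" for g g'
      using same[OF extends_row_sums(2)[OF ext c that]] same[OF extends_row_sums(3)[OF ext c that]] by auto
    then have "coarsening T' E = coarsening T' D" unfolding coarsening_def by auto
    then show ?thesis by (simp add: E_def)
  qed
  then have "tribe_rel T' \<subseteq> E" using tribe_rel_least[OF T' beE] by simp
  then show "tribe_rel T' \<inter> elems T \<times> elems T \<subseteq> tribe_rel T" using Er
    by blast
qed

lemma zero_elems_extends:
  assumes ext: "extends T X T'" and c: "cancels T' X \<epsilon>"
  shows "zero_elems T = zero_elems T' \<inter> elems T"
proof -
  note e = extendsD[OF ext]
  note T' = wf_matrixD(1,2)[OF e(2)]
  have "proportional T' (tribe_rel T') (form T' g) \<longleftrightarrow> proportional T (tribe_rel T) (form T g)"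
    if g: "g \<in> elems T" for g
  proof -
    have g2: "g \<in> elems T'" using g e(5) by auto
    have "proportional T' (tribe_rel T') (form T' g) \<longleftrightarrow> proportional T (tribe_rel T) (form T' g)"
      using proportional_restrict[OF ext c based_equiv_tribe_rel[OF T'] tribe_rel_cancels[OF e(2) c]
        extends_row_sums(1)[OF ext c g2 g2]] tribe_rel_extends[OF ext c] by simp
    also have "\<dots> \<longleftrightarrow> proportional T (tribe_rel T) (form T g)"
      by (rule proportional_cong[OF tribe_rel_equiv[OF e(1)]]) (use g e(6) in simp)
    finally show ?thesis .
  qed
  then show ?thesis unfolding zero_elems_def using e(3,5) by auto
qed

lemma zero_elems_single:
  assumes wf: "wf_matrix T" and c: "cancels T {g} \<epsilon>"
  shows "g \<in> zero_elems T"
proof -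
  have g: "g \<in> proper_elems T"
    "\<And>h. h \<in> elems T \<Longrightarrow> form T g h = of_int (if \<epsilon> then 1 else 0) * form T (base T) h"
    using c by (auto simp: cancels_def)
  then show ?thesis using proportional_base[OF tribe_rel_equiv[OF wf] g(2)]
    by (simp add: zero_elems_def)
qed

text \<open>The adjoined element is a zero element of \<open>T'\<close>, its tribe consists of all
  zero elements there, and these restrict to those of \<open>T\<close>. An infinite type guarantees
  that some element is left to adjoin.\<close>

lemma zero_tribe_eq:
  assumes inf: "infinite (UNIV :: 'g set)"
    and wf: "wf_matrix (T :: ('g, 'h::comm_ring_1) based_matrix)"
  shows "zero_tribe T = zero_elems T"
proof
  show "zero_tribe T \<subseteq> zero_elems T"
  proof
    fix h assume "h \<in> zero_tribe T"
    then obtain T' g C' where h: "h \<in> elems T" and M: "M1 T g T'"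
      and C': "C' \<in> tribes T'" "g \<in> C'" "h \<in> C'" by (auto simp: zero_tribe_def)
    have ext: "extends T {g} T'" and c: "cancels T' {g} False"
      using M by (auto simp: M1_def cancels_annihilating)
    have "(g, h) \<in> tribe_rel T'" using C' by (auto simp: tribe_rel_def)
    then show "h \<in> zero_elems T"
      using zero_elems_single[OF extendsD(2)[OF ext] c] zero_elems_rel[OF extendsD(2)[OF ext]]
        zero_elems_extends[OF ext c] h by blast
  qed
  show "zero_elems T \<subseteq> zero_tribe T"
  proof
    fix h assume h: "h \<in> zero_elems T"
    obtain g where g: "g \<notin> elems T" using inf wf_matrixD(1)[OF wf] ex_new_if_finite by blast
    \<comment> \<open>The extension by a zero row and column witnesses that some adjunction exists
      at all.\<close>
    define T' where "T' = \<lparr>elems = insert g (elems T), base = base T,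
      form = (\<lambda>x y. if x = g \<or> y = g then 0 else form T x y)\<rparr>"
    have wf': "wf_matrix T'"
      unfolding wf_matrix_def
    proof (intro conjI ballI)
      fix x y assume "x \<in> elems T'" "y \<in> elems T'"
      then show "form T' y x = - form T' x y"
        using wf_matrixD(4)[OF wf, of x y] by (auto simp: T'_def)
    qed (use wf_matrixD(1-3)[OF wf] in \<open>auto simp: T'_def\<close>)
    have ext: "extends T {g} T'"
      unfolding extends_def using wf wf' g by (auto simp: T'_def)
    have "annihilating T' g" using g wf_matrixD(2)[OF wf] by (auto simp: annihilating_def T'_def)
    then have M: "M1 T g T'" and c: "cancels T' {g} False"
      using ext by (simp_all add: M1_def cancels_annihilating)
    have h': "h \<in> elems T" "h \<in> zero_elems T'" using zero_elems_extends[OF ext c] h by auto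
    then have "(g, h) \<in> tribe_rel T'"
      using zero_elems_single[OF wf' c] zero_elems_rel[OF wf'] by blast
    then show "h \<in> zero_tribe T" using h' M by (auto simp: zero_tribe_def tribe_rel_def)
  qed
qed

section \<open>Primitive reducts\<close>

abbreviation reduces ::
  "('g, 'h::comm_ring_1) based_matrix \<Rightarrow> ('g, 'h) based_matrix \<Rightarrow> bool" where
  "reduces T P \<equiv> operation\<inverse>\<inverse>\<^sup>*\<^sup>* T P"

lemma operationE:
  assumes "operation T T'"
  obtains X \<epsilon> where "extends T X T'" "cancels T' X \<epsilon>"
  using assms unfolding operation_iff_cancels by blast

lemma operationI:
  "extends T X T' \<Longrightarrow> cancels T' X \<epsilon> \<Longrightarrow> operation T T'"
  unfolding operation_iff_cancels by blast

lemma cancels_finite: "cancels T X \<epsilon> \<Longrightarrow> finite X \<and> X \<noteq> {}"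
  by (auto simp: cancels_def)

lemma operation_card:
  assumes "operation T T'"
  shows "card (elems T) < card (elems T')"
proof -
  obtain X \<epsilon> where X: "extends T X T'" "cancels T' X \<epsilon>" using assms
    by (rule operationE)
  note e = extendsD[OF X(1)]
  have "elems T \<subset> elems T'" using e(4,5) cancels_finite[OF X(2)] by auto
  then show ?thesis using wf_matrixD(1)[OF e(2)] by (simp add: psubset_card_mono)
qed

lemma reduces_induct_facts:
  assumes "reduces T P" "wf_matrix T"
  shows "wf_matrix P \<and> elems P \<subseteq> elems T \<and> base P = base T \<and>
    (\<forall>g\<in>elems P. \<forall>h\<in>elems P. form P g h = form T g h) \<and>
    tribe_rel P = tribe_rel T \<inter> elems P \<times> elems P \<and> zero_elems P = zero_elems T \<inter> elems P"
  using assms(1)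
proof (induction rule: rtranclp_induct)
  case base
  have "tribe_rel T \<subseteq> elems T \<times> elems T" using tribe_rel_equiv[OF assms(2)]
    by (simp add: equiv_def)
  then show ?case using assms(2) by (auto simp: zero_elems_def)
next
  case (step P Q)
  then have "operation Q P" by simp
  then obtain X \<epsilon> where X: "extends Q X P" "cancels P X \<epsilon>" by (rule operationE)
  note e = extendsD[OF X(1)]
  have sub: "elems Q \<subseteq> elems P" using e(5) by simp
  then have "form Q g h = form T g h" if "g \<in> elems Q" "h \<in> elems Q" for g h
    using e(6)[OF that] step.IH that by (metis subsetD)
  then show ?case
    using sub step.IH e(1,3) tribe_rel_extends[OF X] zero_elems_extends[OF X] by auto
qed

lemma reducesD:
  assumes "reduces T P" "wf_matrix T"
  shows "wf_matrix P" "elems P \<subseteq> elems T" "base P = base T"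
    "\<And>g h. g \<in> elems P \<Longrightarrow> h \<in> elems P \<Longrightarrow> form P g h
      = form T g h"
    "tribe_rel P = tribe_rel T \<inter> elems P \<times> elems P"
      "zero_elems P = zero_elems T \<inter> elems P"
  using reduces_induct_facts[OF assms] by blast+

lemma reduces_step: "operation T T' \<Longrightarrow> reduces T P \<Longrightarrow> reduces T' P"
  by (rule converse_rtranclp_into_rtranclp) simp

lemma primitive_iff_cancels:
  "primitive T \<longleftrightarrow> wf_matrix T \<and> (\<nexists>X \<epsilon>. cancels T X \<epsilon>)"
proof -
  have "(\<exists>X \<epsilon>. cancels T X \<epsilon>) \<longleftrightarrow>
    (\<exists>g. annihilating T g) \<or> (\<exists>g. core T g) \<or> (\<exists>g g'. complementary T g g')" (is "?L \<longleftrightarrow> ?R")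
  proof
    assume ?L
    then obtain X \<epsilon> where c: "cancels T X \<epsilon>" by blast
    then consider g where "X = {g}" | g g' where "g \<noteq> g'" "X = {g, g'}"
      by (auto simp: cancels_def)
    then show ?R
    proof cases
      case (1 g)
      then show ?thesis using c by (cases \<epsilon>) (auto simp: cancels_annihilating cancels_core)
    next
      case (2 g g')
      then show ?thesis using c cancels_complementary[OF 2(1), of T \<epsilon>] by auto
    qed
  next
    assume ?R
    then consider g where "annihilating T g" | g where "core T g" | g g'
      where "complementary T g g'"
      by blast
    then show ?L
    proof cases
      case 1
      then show ?thesis using cancels_annihilating[of T] by blast
    next
      case 2
      then show ?thesis using cancels_core[of T] by blast
    next
      case (3 g g')
      then have "g \<noteq> g'" by (simp add: complementary_def)
      then show ?thesis using 3 cancels_complementary[of g g' T True] by auto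
    qed
  qed
  then show ?thesis by (simp add: primitive_def)
qed

lemma primitive_wf: "primitive T \<Longrightarrow> wf_matrix T"
  by (simp add: primitive_def)

lemma primitive_not_operation: "primitive T' \<Longrightarrow> \<not> operation T T'"
  by (meson operationE primitive_iff_cancels)

lemma primitive_reduces: "primitive T \<Longrightarrow> reduces T P \<Longrightarrow> P = T"
  by (metis conversepD converse_rtranclpE primitive_not_operation)

section \<open>Submatrices and the existence of primitive reducts\<close>

lemma wf_submatrix:
  assumes "wf_matrix T" "S \<subseteq> elems T" "base T \<in> S"
  shows "wf_matrix (T\<lparr>elems := S\<rparr>)"
  unfolding wf_matrix_def
proof (intro conjI ballI)
  fix g h assume "g \<in> elems (T\<lparr>elems := S\<rparr>)"
    "h \<in> elems (T\<lparr>elems := S\<rparr>)"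
  then show "form (T\<lparr>elems := S\<rparr>) h g = - form (T\<lparr>elems := S\<rparr>) g h"
    using wf_matrixD(4)[OF assms(1), of g h] assms(2) by auto
qed (use assms wf_matrixD(1-3)[OF assms(1)] finite_subset in auto)

lemma extends_submatrix:
  assumes wf: "wf_matrix T" and X: "X \<subseteq> proper_elems T"
  shows "extends (T\<lparr>elems := elems T - X\<rparr>) X T"
proof -
  have "wf_matrix (T\<lparr>elems := elems T - X\<rparr>)"
    by (rule wf_submatrix) (use wf wf_matrixD(2)[OF wf] X in auto)
  then show ?thesis unfolding extends_def using wf X by auto
qed

text \<open>After a deletion that spares X the row condition is tested in fewer columns, so X can
  still be deleted.\<close>

lemma cancels_mono:
  assumes c: "cancels U X \<epsilon>"
    and sub: "elems T \<subseteq> elems U" "base T = base U" "base T \<in> elems T"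
    and f: "\<And>g h. g \<in> elems T \<Longrightarrow> h \<in> elems T
      \<Longrightarrow> form T g h = form U g h" and X: "X \<subseteq> elems T"
  shows "cancels T X \<epsilon>"
  unfolding cancels_def
proof (intro conjI ballI)
  fix h assume h: "h \<in> elems T"
  have "(\<Sum>g\<in>X. form T g h) = (\<Sum>g\<in>X. form U g h)"
    by (rule sum.cong) (use f X h in auto)
  also have "\<dots> = (if \<epsilon> then form U (base U) h else 0)" using c sub h
    by (auto simp: cancels_def)
  also have "\<dots> = (if \<epsilon> then form T (base T) h else 0)" using f[OF sub(3) h] sub(2)
    by simp
  finally show "(\<Sum>g\<in>X. form T g h) = (if \<epsilon> then form T (base T) h else 0)" .
qed (use c sub X in \<open>auto simp: cancels_def\<close>)

lemma exists_primitive_reduct: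
  assumes "wf_matrix T"
  shows "\<exists>P. reduces T P \<and> primitive P"
  using assms
proof (induction "card (elems T)" arbitrary: T rule: less_induct)
  case (less T)
  show ?case
  proof (cases "primitive T")
    case False
    then obtain X \<epsilon> where c: "cancels T X \<epsilon>"
      using less.prems primitive_iff_cancels by blast
    then have ext: "extends (T\<lparr>elems := elems T - X\<rparr>) X T"
      using extends_submatrix[OF less.prems] by (auto simp: cancels_def)
    note op = operationI[OF ext c]
    from less.hyps[OF operation_card[OF op] extendsD(1)[OF ext]] reduces_step[OF op]
    show ?thesis by blast
  qed auto
qed

lemma cancels_iso:
  assumes iso: "matrix_iso \<theta> T T'" and wf: "wf_matrix T" and c: "cancels T X \<epsilon>"
  shows "cancels T' (\<theta> ` X) \<epsilon>"
  unfolding cancels_def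
proof (intro conjI ballI)
  note base = wf_matrixD(2)[OF wf]
  have X: "X \<subseteq> proper_elems T" "X \<subseteq> elems T" using c by (auto simp: cancels_def)
  show "\<theta> ` X \<subseteq> proper_elems T'"
  proof (rule image_subsetI)
    fix x assume "x \<in> X"
    then have "x \<in> elems T" "x \<in> proper_elems T" using X by auto
    then show "\<theta> x \<in> proper_elems T'" using matrix_iso_proper[OF iso base] by simp
  qed
  have ne: "\<theta> g \<noteq> \<theta> g'" if "X = {g, g'}" "g \<noteq> g'" for g g'
    using matrix_iso_inj[OF iso, of g g'] X(2) that by simp
  consider g where "X = {g}" | g g' where "g \<noteq> g'" "X = {g, g'}" \<epsilon>
    using c by (auto simp: cancels_def)
  then show
    "(\<exists>g. \<theta> ` X = {g}) \<or> (\<exists>g g'. g \<noteq> g' \<and> \<theta> ` X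
    = {g, g'} \<and> \<epsilon>)"
  proof cases
    case (2 g g')
    then have "\<theta> g \<noteq> \<theta> g'" "\<theta> ` X = {\<theta> g, \<theta> g'}"
      using ne by auto
    with 2 show ?thesis by blast
  qed auto
  fix h' assume "h' \<in> elems T'"
  then obtain h where h: "h \<in> elems T" "h' = \<theta> h" by (rule matrix_iso_surj[OF iso])
  have "(\<Sum>g\<in>\<theta> ` X. form T' g h') = (\<Sum>g\<in>X. form T g h)"
    unfolding matrix_iso_sum[OF iso X(2)]
    by (rule sum.cong) (use X(2) h matrix_iso_form[OF iso] in auto)
  also have "\<dots> = (if \<epsilon> then form T (base T) h else 0)" using c h(1)
    by (simp add: cancels_def)
  also have "form T (base T) h = form T' (base T') h'"
    using matrix_iso_form[OF iso base h(1)] iso h(2) by (simp add: matrix_iso_def)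
  finally show
    "(\<Sum>g\<in>\<theta> ` X. form T' g h') = (if \<epsilon> then form T' (base T') h' else 0)" .
qed

lemma primitive_iso:
  assumes iso: "matrix_iso \<theta> T T'" and p: "primitive T"
  shows "primitive T'"
proof -
  note wf = primitive_wf[OF p]
  note wf' = wf_matrix_iso[OF iso wf]
  have "\<not> cancels T' X \<epsilon>" for X \<epsilon>
    using cancels_iso[OF matrix_iso_inv[OF iso wf_matrixD(2)[OF wf]] wf'] p
    unfolding primitive_iff_cancels by metis
  then show ?thesis using wf' by (simp add: primitive_iff_cancels)
qed

text \<open>Each deletion is copied by deleting the image set, so the same map \<theta>, on smaller
  and smaller domains, remains an isomorphism all along.\<close>

lemma reduces_iso:
  assumes iso: "matrix_iso \<theta> T T'" and wf: "wf_matrix T" and red: "reduces T P"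
  shows "\<exists>P'. reduces T' P' \<and> matrix_iso \<theta> P P'"
  using red
proof (induction rule: rtranclp_induct)
  case base
  then show ?case using iso by blast
next
  case (step P Q)
  then obtain P' where P': "reduces T' P'" "matrix_iso \<theta> P P'" by blast
  obtain X \<epsilon> where ext: "extends Q X P" and c: "cancels P X \<epsilon>" using step(2)
    by (auto elim: operationE)
  note e = extendsD[OF ext]
  note c' = cancels_iso[OF P'(2) e(2) c]
  have inj: "inj_on \<theta> (elems P)" and sur: "\<theta> ` elems P = elems P'"
    using P'(2) by (auto simp: matrix_iso_def bij_betw_def)
  let ?Q = "P'\<lparr>elems := elems P' - \<theta> ` X\<rparr>"
  have ext': "extends ?Q (\<theta> ` X) P'"
    by (rule extends_submatrix[OF wf_matrix_iso[OF P'(2) e(2)]]) (use c' in \<open>simp add: cancels_def\<close>)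
  have "\<theta> ` elems Q = elems P' - \<theta> ` X"
  proof -
    have "elems Q = elems P - X" using e(4,5) by blast
    then show ?thesis using inj_on_image_set_diff[OF inj, of "elems P" X] e(5) sur by auto
  qed
  moreover have "inj_on \<theta> (elems Q)" using inj e(5) by (auto intro: inj_on_subset)
  ultimately have "bij_betw \<theta> (elems Q) (elems ?Q)" by (simp add: bij_betw_def)
  then have "matrix_iso \<theta> Q ?Q"
    using P'(2) e(3,5,6) by (auto simp: matrix_iso_def)
  moreover have "reduces T' ?Q"
    using P'(1) operationI[OF ext' c'] by (auto intro: rtranclp.rtrancl_into_rtrancl)
  ultimately show ?case by blast
qed

lemma matrix_iso_id:
  assumes "elems T = elems T'" "base T = base T'"
    "\<And>g h. g \<in> elems T \<Longrightarrow> h \<in> elems T \<Longrightarrow> form T g h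
      = form T' g h"
  shows "matrix_iso id T T'"
  using assms by (simp add: matrix_iso_def)

text \<open>Once g is gone, h is left with the row of s minus the row of g. If g was annihilating
  then h is core, and conversely; hence the negated flag.\<close>

lemma nested_deletions:
  assumes e1: "extends T1 {g} U" and c1: "cancels U {g} \<epsilon>"
    and e2: "extends T2 {g, h} U" and c2: "cancels U {g, h} \<delta>" and gh: "g \<noteq> h"
  shows "operation T2 T1"
proof (rule operationI)
  note a = extendsD[OF e1] and b = extendsD[OF e2]
  have h: "h \<in> elems T1" "h \<notin> elems T2" using a(4,5) b(4,5) gh by auto
  have el: "elems T1 = elems T2 \<union> {h}" using a(4,5) b(4,5) gh by blast
  show "extends T2 {h} T1"
    unfolding extends_def
  proof (intro conjI ballI)
    fix x y assume xy: "x \<in> elems T2" "y \<in> elems T2"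
    then have "x \<in> elems T1" "y \<in> elems T1" using el by auto
    then show "form T1 x y = form T2 x y" using a(6) b(6) xy by metis
  qed (use a b h el in auto)
  have d: \<delta> using c2 gh by (auto simp: cancels_def)
  have "form T1 h x = (if \<not> \<epsilon> then form T1 (base T1) x else 0)"
    if x: "x \<in> elems T1" for x
  proof -
    have xU: "x \<in> elems U" using x a(5) by simp
    have "form U g x = (if \<epsilon> then form U (base U) x else 0)" using c1 xU
      by (simp add: cancels_def)
    moreover have "form U g x + form U h x = form U (base U) x" using c2 xU d gh
      by (simp add: cancels_def)
    moreover have "form U h x = form T1 h x" "form U (base U) x = form T1 (base T1) x"
      using a(3) a(6)[OF h(1) x] a(6)[OF wf_matrixD(2)[OF a(1)] x] by simp_all
    ultimately show ?thesis by auto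
  qed
  then show "cancels T1 {h} (\<not> \<epsilon>)"
    using h c2 a(3) by (auto simp: cancels_def)
qed

text \<open>Two partners h and k of the same g have equal rows. It is immaterial which of them
  survives, up to renaming k to h, and they lie in one tribe. This is the case in which reducts may
  differ by more than equality.\<close>

lemma overlapping_deletions:
  assumes e1: "extends T1 {g, h} U" and c1: "cancels U {g, h} \<epsilon>"
    and e2: "extends T2 {g, k} U" and c2: "cancels U {g, k} \<delta>"
    and ne: "g \<noteq> h" "g \<noteq> k" "h \<noteq> k"
  shows "matrix_iso (\<lambda>x. if x = k then h else x) T1 T2 \<and> (k, h) \<in> tribe_rel U"
proof
  note a = extendsD[OF e1] and b = extendsD[OF e2]
  note skew = wf_matrixD(4)[OF a(2)]
  have gU: "g \<in> proper_elems U" "h \<in> proper_elems U" "k \<in> proper_elems U"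
    using c1 c2 by (auto simp: cancels_def)
  have el1: "elems T1 = elems U - {g, h}" using a(4,5) by blast
  have el2: "elems T2 = elems U - {g, k}" using b(4,5) by blast
  have ed: \<epsilon> \<delta> using c1 c2 ne by (auto simp: cancels_def)
  have row: "form U h x = form U k x" if "x \<in> elems U" for x
  proof -
    have "form U g x + form U h x = form U (base U) x" "form U g x + form U k x = form U (base U) x"
      using c1 c2 that ne ed by (auto simp: cancels_def)
    then show ?thesis by (metis add_left_cancel)
  qed
  have col: "form U x h = form U x k" if x: "x \<in> elems U" for x
    using row[OF x] skew[of h x] skew[of k x] x gU by simp
  let ?\<theta> = "\<lambda>x. if x = k then h else x"
  have mem: "x \<in> elems U" "?\<theta> x \<in> elems U" "x \<noteq> h" if "x \<in> elems T1" for x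
    using that gU el1 by auto
  have "bij_betw ?\<theta> (elems T1) (elems T2)"
    unfolding el1 el2
      by (rule bij_betwI[where g = "\<lambda>x. if x = h then k else x"]) (use ne gU in auto)
  moreover have "form T2 (?\<theta> x) (?\<theta> y) = form T1 x y"
    if xy: "x \<in> elems T1" "y \<in> elems T1" for x y
  proof -
    have "?\<theta> x \<in> elems T2" "?\<theta> y \<in> elems T2" using xy ne gU el1 el2 by auto
    then have "form T2 (?\<theta> x) (?\<theta> y) = form U (?\<theta> x) (?\<theta> y)"
      using b(6) by simp
    also have "\<dots> = form U x y" using row col mem(1)[OF xy(1)] mem(1)[OF xy(2)] gU by simp
    also have "\<dots> = form T1 x y" using a(6) xy by simp
    finally show ?thesis .
  qed
  moreover have "?\<theta> (base T1) = base T2" using gU(3) a(3) b(3) by auto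
  ultimately show "matrix_iso ?\<theta> T1 T2" by (simp only: matrix_iso_def) blast
  have "proportional U (tribe_rel U) (\<lambda>x. form U k x - form U h x)"
    by (rule proportional_base[OF tribe_rel_equiv[OF a(2)], of _ 0]) (simp add: row)
  then show "(k, h) \<in> tribe_rel U" using tribe_rel_iff[OF a(2) gU(3,2)] by blast
qed

text \<open>A diamond argument by induction on the size, with isomorphisms in place of equality. The
  clause that every element stays in its tribe is carried along because it lets classes be compared
  through different reducts.\<close>

lemma primitive_reducts_isomorphic:
  assumes "wf_matrix U" "reduces U P1" "primitive P1" "reduces U P2" "primitive P2"
  shows "\<exists>\<psi>. matrix_iso \<psi> P1 P2 \<and> (\<forall>g\<in>elems P1. (g, \<psi> g) \<in> tribe_rel U)"
  using assms
proof (induction "card (elems U)" arbitrary: U P1 P2 rule: less_induct)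
  case (less U)
  note wf = less.prems(1)
  have eqU: "equiv (elems U) (tribe_rel U)" using tribe_rel_equiv[OF wf] .
  have trans: "(x, z) \<in> tribe_rel U" if "(x, y) \<in> tribe_rel U" "(y, z) \<in> tribe_rel U"
    for x y z
    using that eqU unfolding equiv_def trans_def by blast
  have refl: "(x, x) \<in> tribe_rel U" if "x \<in> elems U" for x
    using that eqU by (auto simp: equiv_def refl_on_def)
  show ?case
  proof (cases "primitive U")
    case True
    then have "P1 = U" "P2 = U" using primitive_reduces less.prems by blast+
    moreover have "matrix_iso id U U" by (rule matrix_iso_id) simp_all
    ultimately show ?thesis using refl by (intro exI[of _ id]) simp
  next
    case False
    then have "U \<noteq> P1" "U \<noteq> P2" using less.prems by auto
    then obtain T1 T2 where op: "operation T1 U" "operation T2 U"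
      and red: "reduces T1 P1" "reduces T2 P2"
      using less.prems(2,4) by (metis conversepD converse_rtranclpE)
    obtain X1 \<epsilon> where e1: "extends T1 X1 U" and c1: "cancels U X1 \<epsilon>" using op(1)
      by (rule operationE)
    obtain X2 \<delta> where e2: "extends T2 X2 U" and c2: "cancels U X2 \<delta>" using op(2)
      by (rule operationE)
    note a = extendsD[OF e1] and b = extendsD[OF e2]
    have X12: "X1 \<subseteq> proper_elems U" "X2 \<subseteq> proper_elems U" using c1 c2
      by (auto simp: cancels_def)
    have sub: "tribe_rel T1 \<subseteq> tribe_rel U" "tribe_rel T2 \<subseteq> tribe_rel U"
      using tribe_rel_extends[OF e1 c1] tribe_rel_extends[OF e2 c2] by auto
    note IH1 = less.hyps[OF operation_card[OF op(1)] a(1)]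
    note IH2 = less.hyps[OF operation_card[OF op(2)] b(1)]
    \<comment> \<open>An isomorphism after the first deletions carries the reduction to P1 over to
      T2, where the induction hypothesis compares it with P2.\<close>
    have via_iso: ?thesis
      if \<theta>: "matrix_iso \<theta> T1 T2"
      "\<And>x. x \<in> elems T1 \<Longrightarrow> (x, \<theta> x) \<in> tribe_rel U" for \<theta>
    proof -
      obtain P where P: "reduces T2 P" "matrix_iso \<theta> P1 P"
        using reduces_iso[OF \<theta>(1) a(1) red(1)] by blast
      obtain \<psi>
        where \<psi>: "matrix_iso \<psi> P P2"
        "\<And>g. g \<in> elems P \<Longrightarrow> (g, \<psi> g) \<in> tribe_rel T2"
        using IH2[OF P(1) primitive_iso[OF P(2) less.prems(3)] red(2) less.prems(5)] by blast
      have "(g, \<psi> (\<theta> g)) \<in> tribe_rel U" if g: "g \<in> elems P1" for g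
      proof -
        have "g \<in> elems T1" using reducesD(2)[OF red(1) a(1)] g by blast
        moreover have "(\<theta> g, \<psi> (\<theta> g)) \<in> tribe_rel U"
          using \<psi>(2) matrix_iso_mem[OF P(2) g] sub by blast
        ultimately show ?thesis using \<theta>(2) trans by blast
      qed
      then show ?thesis using matrix_iso_comp[OF P(2) \<psi>(1)]
        by (intro exI[of _ "\<psi> \<circ> \<theta>"]) simp
    qed
    have one: ?thesis if "reduces T1 P2"
      using IH1[OF red(1) less.prems(3) that less.prems(5)] sub by blast
    have two: ?thesis if "reduces T2 P1"
      using IH2[OF that less.prems(3) red(2) less.prems(5)] sub by blast
    \<comment> \<open>Sets of at most two elements are equal, disjoint, nested, or pairs with
      exactly one common element.\<close>
    consider "X1 = X2" | "X1 \<inter> X2 = {}"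
      | g h where "X1 = {g}" "X2 = {g, h}" "g \<noteq> h"
      | g h where "X1 = {g, h}" "X2 = {g}" "g \<noteq> h"
      | g h k where "X1 = {g, h}" "X2 = {g, k}" "g \<noteq> h" "g \<noteq> k" "h \<noteq> k"
    proof (cases "X1 \<inter> X2 = {}")
      case False
      then obtain g where g: "g \<in> X1" "g \<in> X2" by blast
      have "X1 = {g} \<or> (\<exists>h. h \<noteq> g \<and> X1 = {g, h})"
        "X2 = {g} \<or> (\<exists>h. h \<noteq> g \<and> X2 = {g, h})"
        using c1 c2 g unfolding cancels_def by (auto simp: doubleton_eq_iff)
      then show thesis using that by metis
    qed
    then show ?thesis
    proof cases
      case 1
      \<comment> \<open>T1 and T2 need not be equal as records, since their forms may differ outside
        the element set; thus an identity isomorphism.\<close>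
      have "elems T1 = elems T2" using a(4,5) b(4,5) 1 by blast
      moreover have "form T1 g h = form T2 g h" if "g \<in> elems T1" "h \<in> elems T1" for g h
        using a(6)[OF that] b(6)[of g h] that calculation by simp
      ultimately have "matrix_iso id T1 T2" using a(3) b(3) by (intro matrix_iso_id) auto
      then show ?thesis by (rule via_iso) (use refl a(5) in auto)
    next
      case 2
      \<comment> \<open>Disjoint deletions commute, so both sides reach this matrix, and any
        primitive reduct of it links P1 to P2.\<close>
      let ?T3 = "U\<lparr>elems := elems U - X1 - X2\<rparr>"
      have wf3: "wf_matrix ?T3" by (rule wf_submatrix) (use wf X12 wf_matrixD(2)[OF wf] in auto)
      have el: "elems T1 = elems U - X1" "elems T2 = elems U - X2" using a(4,5) b(4,5) by blast+
      have "extends ?T3 X2 T1" unfolding extends_def using wf3 a(1,3,6) el 2 X12 by auto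
      moreover have "cancels T1 X2 \<delta>"
        by (rule cancels_mono[OF c2]) (use el a(3,6) X12 2 wf_matrixD(2)[OF a(1)] in auto)
      ultimately have op1: "operation ?T3 T1" by (rule operationI)
      have "extends ?T3 X1 T2" unfolding extends_def using wf3 b(1,3,6) el 2 X12 by auto
      moreover have "cancels T2 X1 \<epsilon>"
        by (rule cancels_mono[OF c1]) (use el b(3,6) X12 2 wf_matrixD(2)[OF b(1)] in auto)
      ultimately have op2: "operation ?T3 T2" by (rule operationI)
      obtain P3 where P3: "reduces ?T3 P3" "primitive P3" using exists_primitive_reduct[OF wf3]
        by blast
      obtain \<psi>
        where \<psi>: "matrix_iso \<psi> P1 P3"
        "\<And>g. g \<in> elems P1 \<Longrightarrow> (g, \<psi> g) \<in> tribe_rel T1"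
        using IH1[OF red(1) less.prems(3) reduces_step[OF op1 P3(1)] P3(2)] by blast
      obtain \<eta>
        where \<eta>: "matrix_iso \<eta> P3 P2"
        "\<And>g. g \<in> elems P3 \<Longrightarrow> (g, \<eta> g) \<in> tribe_rel T2"
        using IH2[OF reduces_step[OF op2 P3(1)] P3(2) red(2) less.prems(5)] by blast
      have "(g, \<eta> (\<psi> g)) \<in> tribe_rel U" if g: "g \<in> elems P1" for g
        by (rule trans) (use \<psi>(2)[OF g] \<eta>(2)[OF matrix_iso_mem[OF \<psi>(1) g]] sub in auto)
      then show ?thesis using matrix_iso_comp[OF \<psi>(1) \<eta>(1)]
        by (intro exI[of _ "\<eta> \<circ> \<psi>"]) simp
    next
      case (3 g h)
      have "operation T2 T1"
        by (rule nested_deletions[of T1 g U \<epsilon> T2 h \<delta>]) (use 3 e1 c1 e2 c2 in simp_all)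
      then show ?thesis using one reduces_step red(2) by blast
    next
      case (4 g h)
      have "operation T1 T2"
        by (rule nested_deletions[of T2 g U \<delta> T1 h \<epsilon>]) (use 4 e1 c1 e2 c2 in simp_all)
      then show ?thesis using two reduces_step red(1) by blast
    next
      case (5 g h k)
      have "matrix_iso (\<lambda>x. if x = k then h else x) T1 T2 \<and> (k, h) \<in> tribe_rel U"
        by (rule overlapping_deletions[of T1 g h U \<epsilon> T2 k \<delta>]) (use 5 e1 c1 e2 c2 in simp_all)
      then show ?thesis using via_iso[of "\<lambda>x. if x = k then h else x"] refl a(5) by auto
    qed
  qed
qed

section \<open>Chains of operations\<close>

lemma chain_Cons:
  "chain (T # T1 # f) T0 Tp \<longleftrightarrow> T0 = T \<and> (operation T T1
    \<or> operation T1 T) \<and> chain (T1 # f) T1 Tp"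
  by (auto simp: chain_def symclp_def)

lemma chain_single: "chain [T] T0 Tp \<longleftrightarrow> T0 = T \<and> Tp = T"
  by (auto simp: chain_def)

text \<open>Two neighbours in a chain share the reducts of the smaller one. Going to the larger one,
  its other reducts are covered by the uniqueness of primitive reducts. The recursion scheme of
  \<open>prim_classes\<close> provides the induction over two consecutive matrices.\<close>

lemma chain_to_primitive:
  assumes "chain f T Tp" "primitive Tp"
  shows "wf_matrix T \<and> (\<forall>P. reduces T P \<longrightarrow> primitive P
    \<longrightarrow> (\<exists>\<psi>. matrix_iso \<psi> P Tp))"
  using assms
proof (induction f arbitrary: T rule: prim_classes.induct)
  case (2 T')
  then have "T = Tp" by (simp add: chain_single)
  moreover have "matrix_iso id Tp Tp" by (rule matrix_iso_id) simp_all
  ultimately show ?case using 2 primitive_wf primitive_reduces by blast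
next
  case (3 T0 T1 f)
  then have T: "T0 = T" and op: "operation T T1 \<or> operation T1 T" and ch: "chain (T1 # f) T1 Tp"
    by (auto simp: chain_Cons)
  note IH = "3.IH"[OF ch \<open>primitive Tp\<close>]
  show ?case
    using op
  proof
    assume op: "operation T T1"
    then obtain X where "extends T X T1" by (auto elim: operationE)
    then show ?thesis using IH reduces_step[OF op] extendsD(1) by blast
  next
    assume op: "operation T1 T"
    then obtain X where "extends T1 X T" by (auto elim: operationE)
    then have wf: "wf_matrix T" "wf_matrix T1" using extendsD(1,2) by blast+
    obtain P1 where P1: "reduces T1 P1" "primitive P1" using exists_primitive_reduct[OF wf(2)]
      by blast
    obtain \<eta> where \<eta>: "matrix_iso \<eta> P1 Tp" using IH P1 by blast
    have "\<exists>\<psi>. matrix_iso \<psi> P Tp" if "reduces T P" "primitive P" for P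
      using primitive_reducts_isomorphic[OF wf(1) that reduces_step[OF op P1(1)] P1(2)]
        matrix_iso_comp[OF _ \<eta>] by blast
    then show ?thesis using wf by blast
  qed
qed (simp add: chain_def)

section \<open>Classes of tribes under operations\<close>

lemma Aut_iff: "\<phi> \<in> Aut T \<longleftrightarrow> matrix_iso \<phi> T T"
  by (simp add: Aut_def matrix_iso_def)

lemma tribe_eq_class:
  assumes "wf_matrix T" "X \<in> tribes T" "x \<in> X"
  shows "X = tribe_rel T `` {x}"
proof -
  have X: "X \<in> elems T // tribe_rel T"
    using assms tribes_eq_quotient wf_matrixD(1,2)[OF assms(1)] by blast
  show ?thesis
    using in_quotient_imp_closed[OF tribe_rel_equiv[OF assms(1)] X assms(3)]
      in_quotient_imp_in_rel[OF tribe_rel_equiv[OF assms(1)] X] assms(3) by blast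
qed

lemma class_in_tribes:
  assumes "wf_matrix T" "x \<in> elems T"
  shows "tribe_rel T `` {x} \<in> tribes T" "x \<in> tribe_rel T `` {x}"
  using tribes_eq_quotient[OF wf_matrixD(1,2)[OF assms(1)]] quotientI[OF assms(2), of "tribe_rel T"]
    equiv_class_self[OF tribe_rel_equiv[OF assms(1)] assms(2)] by auto

lemma tribe_rel_sym:
  "wf_matrix T \<Longrightarrow> (x, y) \<in> tribe_rel T \<Longrightarrow> (y, x) \<in> tribe_rel T"
  using tribe_rel_equiv by (auto simp: equiv_def sym_def)

lemma tribe_rel_trans:
  "wf_matrix T \<Longrightarrow> (x, y) \<in> tribe_rel T \<Longrightarrow> (y, z) \<in> tribe_rel T \<Longrightarrow> (x, z) \<in> tribe_rel T"
  using tribe_rel_equiv[of T] unfolding equiv_def trans_def by blast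

lemma tribe_rel_mem:
  "wf_matrix T \<Longrightarrow> (x, y) \<in> tribe_rel T \<Longrightarrow> x \<in> elems T
    \<and> y \<in> elems T"
  using tribe_rel_equiv by (auto simp: equiv_def)

lemma tribe_rel_refl:
  "wf_matrix T \<Longrightarrow> x \<in> elems T \<Longrightarrow> (x, x) \<in> tribe_rel T"
  using tribe_rel_equiv by (auto simp: equiv_def refl_on_def)

section \<open>The finest invariant partition\<close>

lemma refines_antisym:
  assumes "refines A P Q" "refines A Q P"
  shows "P = Q"
proof -
  have "R \<subseteq> S" if RS: "refines A R S" "refines A S R" for R S
  proof
    fix X assume X: "X \<in> R"
    then obtain Y X' where Y: "Y \<in> S" "X \<subseteq> Y" "X' \<in> R" "Y \<subseteq> X'"
      using RS unfolding refines_def by metis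
    have "partition_on A R" using RS by (simp add: refines_def)
    then have "X \<noteq> {}" "X = X' \<or> X \<inter> X' = {}"
      using X Y(3) by (auto simp: partition_on_def disjoint_def)
    then have "X = Y" using Y by auto
    then show "X \<in> S" using Y by simp
  qed
  then show ?thesis using assms by auto
qed

text \<open>Justifies the \<open>THE\<close>. The classes of \<open>W\<close>, which relates points
  that no admissible partition separates, form an admissible partition themselves, and it refines
  all others.\<close>

lemma reduced_partition_admissible:
  assumes wf: "wf_matrix T"
  shows "admissible_partition T (reduced_partition T)"
proof -
  define W where "W = {(x, y). x \<in> elems T \<and> y \<in> elems T \<and>
    (\<forall>Q. admissible_partition T Q \<longrightarrow> (\<exists>C\<in>Q. x \<in> C \<and> y \<in> C))}"
  have part: "partition_on (elems T) Q" if "admissible_partition T Q" for Q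
    using that by (simp add: admissible_partition_def)
  have cover: "\<exists>C\<in>Q. x \<in> C" if "admissible_partition T Q" "x \<in> elems T" for Q x
    using partition_onD1[OF part[OF that(1)]] that(2) by auto
  have uniq: "C = D" if "admissible_partition T Q" "C \<in> Q" "D \<in> Q" "x \<in> C" "x \<in> D"
    for Q x C D
    using partition_onD2[OF part[OF that(1)]] that(2-) by (auto simp: disjoint_def)
  have W: "equiv (elems T) W"
  proof (rule equivI)
    show "W \<subseteq> elems T \<times> elems T" by (auto simp: W_def)
    show "refl_on (elems T) W" using cover unfolding refl_on_def W_def by blast
    show "sym W" unfolding sym_def W_def by blast
    show "trans W"
    proof (rule transI)
      fix x y z assume xy: "(x, y) \<in> W" and yz: "(y, z) \<in> W"
      have "\<exists>C\<in>Q. x \<in> C \<and> z \<in> C" if Q: "admissible_partition T Q" for Q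
      proof -
        obtain C D where "C \<in> Q" "x \<in> C" "y \<in> C" "D \<in> Q" "y \<in> D" "z \<in> D"
          using xy yz Q unfolding W_def by blast
        then show ?thesis using uniq[OF Q] by blast
      qed
      then show "(x, z) \<in> W" using xy yz by (simp add: W_def)
    qed
  qed
  let ?Q = "elems T // W"
  have adm: "admissible_partition T ?Q"
    unfolding admissible_partition_def
  proof (intro conjI ballI)
    show "partition_on (elems T) ?Q" by (rule partition_on_quotient[OF W])
  next
    fix C assume C: "C \<in> ?Q"
    have "tribe_rel T `` {x} \<subseteq> C" if x: "x \<in> C" for x
    proof
      fix y assume y: "y \<in> tribe_rel T `` {x}"
      then have xy: "(x, y) \<in> tribe_rel T" by simp
      have "\<exists>D\<in>Q. x \<in> D \<and> y \<in> D" if Q: "admissible_partition T Q" for Q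
      proof -
        obtain D where D: "D \<in> Q" "x \<in> D" using cover[OF Q] tribe_rel_mem[OF wf xy] by blast
        then obtain \<T> where "\<T> \<subseteq> tribes T" "D = \<Union> \<T>"
          using Q unfolding admissible_partition_def by blast
        then obtain X where X: "X \<in> tribes T" "X \<subseteq> D" "x \<in> X" using D by blast
        then have "y \<in> X" using tribe_eq_class[OF wf X(1,3)] y by simp
        then show ?thesis using D X by blast
      qed
      then have "(x, y) \<in> W" using tribe_rel_mem[OF wf xy] by (simp add: W_def)
      then show "y \<in> C" using in_quotient_imp_closed[OF W C x] by blast
    qed
    moreover have "C \<subseteq> elems T" using in_quotient_imp_subset[OF W C] .
    ultimately show "\<exists>\<T>\<subseteq>tribes T. C = \<Union> \<T>"
      using class_in_tribes[OF wf]
        by (intro exI[of _ "(\<lambda>x. tribe_rel T `` {x}) ` C"]) fastforce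
  next
    fix C \<phi> assume C: "C \<in> ?Q" and \<phi>: "\<phi> \<in> Aut T"
    have sub: "C \<subseteq> elems T" using in_quotient_imp_subset[OF W C] .
    have "\<phi> x \<in> C" if x: "x \<in> C" for x
    proof -
      have xT: "x \<in> elems T" "\<phi> x \<in> elems T" using sub x \<phi>
        by (auto simp: Aut_iff intro: matrix_iso_mem)
      have "\<exists>D\<in>Q. x \<in> D \<and> \<phi> x \<in> D" if Q: "admissible_partition T Q"
        for Q
      proof -
        obtain D where D: "D \<in> Q" "x \<in> D" using cover[OF Q xT(1)] by blast
        then have "\<phi> ` D = D" using Q \<phi> unfolding admissible_partition_def by blast
        then show ?thesis using D by blast
      qed
      then have "(x, \<phi> x) \<in> W" using xT by (simp add: W_def)
      then show ?thesis using in_quotient_imp_closed[OF W C x] by blast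
    qed
    \<comment> \<open>An injective self-map of a finite set is onto, so the inclusion
      suffices.\<close>
    then have "\<phi> ` C \<subseteq> C" by blast
    moreover have "inj_on \<phi> C"
      using \<phi> sub by (auto simp: Aut_def bij_betw_def intro: inj_on_subset)
    ultimately show "\<phi> ` C = C"
      using endo_inj_surj finite_subset[OF sub wf_matrixD(1)[OF wf]] by blast
  qed
  have fine: "refines (elems T) ?Q Q'" if Q': "admissible_partition T Q'" for Q'
    unfolding refines_def
  proof (intro conjI ballI)
    show "partition_on (elems T) ?Q" by (rule partition_on_quotient[OF W])
    show "partition_on (elems T) Q'" using Q' by (simp add: admissible_partition_def)
    fix X assume X: "X \<in> ?Q"
    then obtain x where x: "x \<in> elems T" "X = W `` {x}" by (auto elim: quotientE)
    obtain D where D: "D \<in> Q'" "x \<in> D" using cover[OF Q' x(1)] by blast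
    have "y \<in> D" if y: "y \<in> X" for y
    proof -
      obtain E where "E \<in> Q'" "x \<in> E" "y \<in> E" using y x Q' unfolding W_def by blast
      then show ?thesis using uniq[OF Q'] D by blast
    qed
    then show "\<exists>Y\<in>Q'. X \<subseteq> Y" using D by blast
  qed
  have "reduced_partition T = ?Q"
    unfolding reduced_partition_def
  proof (rule the_equality)
    show "admissible_partition T ?Q \<and> (\<forall>Q'. admissible_partition T Q'
      \<longrightarrow> refines (elems T) ?Q Q')"
      using adm fine by blast
  next
    fix Q assume Q:
      "admissible_partition T Q \<and> (\<forall>Q'. admissible_partition T Q'
      \<longrightarrow> refines (elems T) Q Q')"
    then have "refines (elems T) Q ?Q" "refines (elems T) ?Q Q" using fine adm by auto
    then show "Q = ?Q" by (rule refines_antisym)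
  qed
  then show ?thesis using adm by simp
qed

lemma reduced_classD:
  assumes wf: "wf_matrix T" and C: "C \<in> reduced_partition T"
  shows "C \<subseteq> elems T" "C \<noteq> {}"
    "\<And>D x. D \<in> reduced_partition T \<Longrightarrow> x \<in> C
      \<Longrightarrow> x \<in> D \<Longrightarrow> C = D"
    "\<And>x y. x \<in> C \<Longrightarrow> (x, y) \<in> tribe_rel T \<Longrightarrow> y \<in> C"
    "\<And>\<phi> x. matrix_iso \<phi> T T \<Longrightarrow> x \<in> C
      \<Longrightarrow> \<phi> x \<in> C"
proof -
  have adm: "partition_on (elems T) (reduced_partition T)"
    "\<exists>\<T>\<subseteq>tribes T. C = \<Union> \<T>"
      "\<And>\<phi>. \<phi> \<in> Aut T \<Longrightarrow> \<phi> ` C = C"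
    using reduced_partition_admissible[OF wf] C unfolding admissible_partition_def by blast+
  show "C \<subseteq> elems T" "C \<noteq> {}" using adm(1) C unfolding partition_on_def by blast+
  show "C = D" if "D \<in> reduced_partition T" "x \<in> C" "x \<in> D" for D x
    using adm(1) C that unfolding partition_on_def disjoint_def by blast
  show "y \<in> C" if xy: "x \<in> C" "(x, y) \<in> tribe_rel T" for x y
  proof -
    obtain \<T> where "\<T> \<subseteq> tribes T" "C = \<Union> \<T>" using adm(2) by blast
    then obtain X where X: "X \<in> tribes T" "x \<in> X" "X \<subseteq> C" using xy by blast
    then show ?thesis using tribe_eq_class[OF wf X(1,2)] xy by blast
  qed
  show "\<phi> x \<in> C" if "matrix_iso \<phi> T T" "x \<in> C" for \<phi> x
    using adm(3)[of \<phi>] that by (auto simp: Aut_iff)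
qed

text \<open>One reduct suffices to find the primitive tribes: any other is isomorphic to it by a map
  that stays within tribes, so it meets the same ones.\<close>

lemma primitive_tribes_eq:
  assumes wf: "wf_matrix T" and red: "reduces T P" and prim: "primitive P"
  shows "primitive_tribes T = (\<lambda>h. tribe_rel T `` {h}) ` elems P"
proof
  show "(\<lambda>h. tribe_rel T `` {h}) ` elems P \<subseteq> primitive_tribes T"
  proof (rule image_subsetI)
    fix h assume h: "h \<in> elems P"
    then have "h \<in> elems T" using reducesD(2)[OF red wf] by blast
    from class_in_tribes[OF wf this] show "tribe_rel T `` {h} \<in> primitive_tribes T"
      using red prim h unfolding primitive_tribes_def by blast
  qed
  show "primitive_tribes T \<subseteq> (\<lambda>h. tribe_rel T `` {h}) ` elems P"
  proof
    fix X assume "X \<in> primitive_tribes T"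
    then obtain Q x
      where X: "X \<in> tribes T" "reduces T Q" "primitive Q" "x \<in> X" "x \<in> elems Q"
      unfolding primitive_tribes_def by blast
    obtain \<psi>
      where \<psi>: "matrix_iso \<psi> Q P"
      "\<And>g. g \<in> elems Q \<Longrightarrow> (g, \<psi> g) \<in> tribe_rel T"
      using primitive_reducts_isomorphic[OF wf X(2,3) red prim] by blast
    have "\<psi> x \<in> X" using tribe_eq_class[OF wf X(1,4)] \<psi>(2)[OF X(5)] by blast
    then have "X = tribe_rel T `` {\<psi> x}" by (rule tribe_eq_class[OF wf X(1)])
    then show "X \<in> (\<lambda>h. tribe_rel T `` {h}) ` elems P"
      using matrix_iso_mem[OF \<psi>(1) X(5)] by blast
  qed
qed

text \<open>The class of \<open>T\<close> which corresponds to the class \<open>C\<close> of the primitive matrix \<open>T\<^sub>\<bullet>\<close>.\<close>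

definition pulled_class ::
  "('g, 'h::comm_ring_1) based_matrix \<Rightarrow> ('g, 'h) based_matrix \<Rightarrow> 'g set \<Rightarrow> 'g set" where
  "pulled_class Tp T C = {g. \<exists>P \<psi> h. reduces T P \<and> primitive P
    \<and> matrix_iso \<psi> P Tp \<and>
     h \<in> elems P \<and> \<psi> h \<in> C \<and> (h, g) \<in> tribe_rel T}"

text \<open>A certificate for the link between \<open>T\<close> and \<open>Tp\<close> in which no
  chain occurs.\<close>

definition reduct_iso ::
  "('g, 'h::comm_ring_1) based_matrix \<Rightarrow> ('g, 'h) based_matrix \<Rightarrow> ('g, 'h) based_matrix \<Rightarrow>
    ('g \<Rightarrow> 'g) \<Rightarrow> bool" where
  "reduct_iso Tp T P \<psi> \<longleftrightarrow>
     wf_matrix T \<and> reduces T P \<and> primitive P \<and> matrix_iso \<psi> P Tp"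

lemma homologous_reduct_iso:
  assumes "homologous T Tp" "primitive Tp"
  shows "\<exists>P \<psi>. reduct_iso Tp T P \<psi>"
proof -
  obtain f where "chain f T Tp" using assms by (auto simp: homologous_def)
  from chain_to_primitive[OF this assms(2)] show ?thesis
    using exists_primitive_reduct[of T] unfolding reduct_iso_def by blast
qed

lemma reduct_iso_wf:
  assumes "reduct_iso Tp T P \<psi>"
  shows "wf_matrix T" "wf_matrix P" "wf_matrix Tp" "primitive Tp" "elems P \<subseteq> elems T"
proof -
  show wf: "wf_matrix T" using assms by (simp add: reduct_iso_def)
  show "wf_matrix P" "elems P \<subseteq> elems T" using reducesD[OF _ wf] assms
    by (auto simp: reduct_iso_def)
  then show "wf_matrix Tp" "primitive Tp"
    using wf_matrix_iso primitive_iso assms by (auto simp: reduct_iso_def)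
qed

lemma reduct_iso_refl: "primitive Tp \<Longrightarrow> reduct_iso Tp Tp Tp id"
  by (auto simp: reduct_iso_def primitive_wf intro: matrix_iso_id)

text \<open>A reduct of the smaller matrix is one of the larger matrix, so neighbours in a chain can
  be compared through the same \<open>P\<close> and \<psi>.\<close>

lemma reduct_iso_operation:
  assumes "operation T T'" "reduct_iso Tp T P \<psi>"
  shows "reduct_iso Tp T' P \<psi>"
proof -
  have "wf_matrix T'" using assms(1) by (auto elim: operationE dest: extendsD(2))
  then show ?thesis using assms reduces_step[OF assms(1)] by (simp add: reduct_iso_def)
qed

text \<open>Replaces the quantification over all reducts by one given reduct, which makes pulled
  classes computable.\<close>

lemma pulled_class_eq:
  assumes ri: "reduct_iso Tp T P \<psi>" and C: "C \<in> reduced_partition Tp"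
  shows "pulled_class Tp T C = {g. \<exists>h\<in>elems P. \<psi> h \<in> C
    \<and> (h, g) \<in> tribe_rel T}"
proof
  note wf = reduct_iso_wf[OF ri]
  have ri': "reduces T P" "primitive P" "matrix_iso \<psi> P Tp" using ri
    by (auto simp: reduct_iso_def)
  show "{g. \<exists>h\<in>elems P. \<psi> h \<in> C \<and> (h, g) \<in> tribe_rel T} \<subseteq> pulled_class Tp T C"
    unfolding pulled_class_def using ri' by blast
  show "pulled_class Tp T C \<subseteq> {g. \<exists>h\<in>elems P. \<psi> h \<in> C
    \<and> (h, g) \<in> tribe_rel T}"
  proof
    fix g assume "g \<in> pulled_class Tp T C"
    then obtain Q \<eta> h where Q: "reduces T Q" "primitive Q" "matrix_iso \<eta> Q Tp"
      and h: "h \<in> elems Q" "\<eta> h \<in> C" "(h, g) \<in> tribe_rel T"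
      unfolding pulled_class_def by blast
    obtain \<theta>
      where \<theta>: "matrix_iso \<theta> Q P"
      "\<And>g. g \<in> elems Q \<Longrightarrow> (g, \<theta> g) \<in> tribe_rel T"
      using primitive_reducts_isomorphic[OF wf(1) Q(1,2) ri'(1,2)] by blast
    have bQ: "base Q \<in> elems Q" using wf_matrixD(2)[OF primitive_wf[OF Q(2)]] .
    \<comment> \<open>Two ways of identifying reducts with \<open>Tp\<close> differ by this
      automorphism of \<open>Tp\<close>, under which \<open>C\<close> is invariant.\<close>
    let ?\<phi> = "\<psi> \<circ> \<theta> \<circ> inv_into (elems Q) \<eta>"
    have "matrix_iso ?\<phi> Tp Tp"
      by (rule matrix_iso_comp[OF matrix_iso_inv[OF Q(3) bQ] matrix_iso_comp[OF \<theta>(1) ri'(3)]])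
    then have "?\<phi> (\<eta> h) \<in> C" using reduced_classD(5)[OF wf(3) C] h(2) by blast
    moreover have "inv_into (elems Q) \<eta> (\<eta> h) = h"
      using Q(3) h(1) by (simp add: matrix_iso_def bij_betw_def)
    ultimately have "\<psi> (\<theta> h) \<in> C" by simp
    moreover have "(\<theta> h, g) \<in> tribe_rel T"
      using tribe_rel_trans[OF wf(1) tribe_rel_sym[OF wf(1) \<theta>(2)[OF h(1)]] h(3)] .
    ultimately show
      "g \<in> {g. \<exists>h\<in>elems P. \<psi> h \<in> C \<and> (h, g) \<in> tribe_rel T}"
      using matrix_iso_mem[OF \<theta>(1) h(1)] by blast
  qed
qed

lemma pulled_class_subset:
  "reduct_iso Tp T P \<psi> \<Longrightarrow> pulled_class Tp T C \<subseteq> elems T"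
  unfolding pulled_class_def by (auto dest: reduct_iso_wf(1) tribe_rel_mem)

lemma pulled_class_closed:
  assumes "reduct_iso Tp T P \<psi>" "g \<in> pulled_class Tp T C" "(g, g') \<in> tribe_rel T"
  shows "g' \<in> pulled_class Tp T C"
  using assms(2,3) tribe_rel_trans[OF reduct_iso_wf(1)[OF assms(1)]] unfolding pulled_class_def
    by blast

lemma reduct_tribe_rel:
  assumes ri: "reduct_iso Tp T P \<psi>" and g: "g \<in> elems P" "h \<in> elems P"
  shows "(g, h) \<in> tribe_rel T \<longleftrightarrow> (\<psi> g, \<psi> h) \<in> tribe_rel Tp"
proof -
  have "(g, h) \<in> tribe_rel T \<longleftrightarrow> (g, h) \<in> tribe_rel P"
    using reducesD(5) ri g by (auto simp: reduct_iso_def)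
  then show ?thesis using tribe_rel_iso[OF _ reduct_iso_wf(2)[OF ri] g] ri
    by (auto simp: reduct_iso_def)
qed

text \<open>Saturation by tribes adds nothing inside the reduct, because \<open>C\<close> is a union
  of tribes of \<open>Tp\<close> and the tribes of \<open>T\<close> restrict to those of
  \<open>P\<close>.\<close>

lemma mem_pulled_class:
  assumes ri: "reduct_iso Tp T P \<psi>" and C: "C \<in> reduced_partition Tp"
    and h: "h \<in> elems P"
  shows "h \<in> pulled_class Tp T C \<longleftrightarrow> \<psi> h \<in> C"
proof
  note wf = reduct_iso_wf[OF ri]
  assume "h \<in> pulled_class Tp T C"
  then obtain h' where h': "h' \<in> elems P" "\<psi> h' \<in> C" "(h', h) \<in> tribe_rel T"
    unfolding pulled_class_eq[OF ri C] by blast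
  then show "\<psi> h \<in> C"
    using reduct_tribe_rel[OF ri h'(1) h] reduced_classD(4)[OF wf(3) C h'(2)] by blast
next
  assume "\<psi> h \<in> C"
  then show "h \<in> pulled_class Tp T C"
    unfolding pulled_class_eq[OF ri C]
    using h tribe_rel_refl[OF reduct_iso_wf(1)[OF ri]] reduct_iso_wf(5)[OF ri] by blast
qed

lemma pulled_class_self:
  assumes "primitive Tp" "C \<in> reduced_partition Tp"
  shows "pulled_class Tp Tp C = C"
proof -
  note ri = reduct_iso_refl[OF assms(1)]
  have "C \<subseteq> elems Tp" using reduced_classD(1) primitive_wf assms by blast
  then show ?thesis
    using mem_pulled_class[OF ri assms(2)] pulled_class_subset[OF ri, of C] by auto
qed

lemma pulled_class_inj:
  assumes ri: "reduct_iso Tp T P \<psi>"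
  shows "inj_on (pulled_class Tp T) (reduced_partition Tp)"
proof (rule inj_onI)
  fix C D assume C: "C \<in> reduced_partition Tp" and D: "D \<in> reduced_partition Tp"
    and eq: "pulled_class Tp T C = pulled_class Tp T D"
  note wf = reduct_iso_wf[OF ri]
  obtain x where x: "x \<in> C" "x \<in> elems Tp" using reduced_classD(1,2)[OF wf(3) C] by blast
  have "matrix_iso \<psi> P Tp" using ri by (simp add: reduct_iso_def)
  from matrix_iso_surj[OF this x(2)] obtain h where "h \<in> elems P" "x = \<psi> h" by blast
  then have "x \<in> D" using mem_pulled_class[OF ri] C D eq x(1) by blast
  then show "C = D" using reduced_classD(3)[OF wf(3) C D x(1)] by blast
qed

lemma pulled_class_operation:
  assumes op: "operation T T'" and ri: "reduct_iso Tp T P \<psi>"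
    and C: "C \<in> reduced_partition Tp"
  shows "pulled_class Tp T C = pulled_class Tp T' C \<inter> elems T"
proof -
  obtain X \<epsilon> where X: "extends T X T'" "cancels T' X \<epsilon>" using op
    by (rule operationE)
  have "(h, g) \<in> tribe_rel T \<longleftrightarrow> (h, g) \<in> tribe_rel T'
    \<and> g \<in> elems T" if "h \<in> elems P" for h g
    unfolding tribe_rel_extends[OF X] using that reduct_iso_wf(5)[OF ri] by auto
  then show ?thesis
    unfolding pulled_class_eq[OF ri C] pulled_class_eq[OF reduct_iso_operation[OF op ri] C] by blast
qed

text \<open>Matrices related by an isomorphism need not be neighbours in a chain, so the transport
  is done on reducts: \<open>P\<close> is copied to its image, and the same \<psi> is used through
  the inverse.\<close>

lemma pulled_class_iso:
  assumes iso: "matrix_iso \<theta> T T'" and ri: "reduct_iso Tp T P \<psi>"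
    and C: "C \<in> reduced_partition Tp"
  shows "pulled_class Tp T' C = \<theta> ` pulled_class Tp T C"
proof -
  note wf = reduct_iso_wf[OF ri]
  have red: "reduces T P" "primitive P" "matrix_iso \<psi> P Tp" using ri
    by (auto simp: reduct_iso_def)
  obtain P' where P': "reduces T' P'" "matrix_iso \<theta> P P'"
    using reduces_iso[OF iso wf(1) red(1)] by blast
  let ?i = "inv_into (elems P) \<theta>"
  have wf': "wf_matrix T'" using wf_matrix_iso[OF iso wf(1)] .
  have "matrix_iso (\<psi> \<circ> ?i) P' Tp"
    by (rule matrix_iso_comp[OF matrix_iso_inv[OF P'(2) wf_matrixD(2)[OF wf(2)]] red(3)])
  then have ri': "reduct_iso Tp T' P' (\<psi> \<circ> ?i)"
    using P' primitive_iso[OF P'(2) red(2)] wf' by (simp add: reduct_iso_def)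
  have i: "?i (\<theta> h) = h" if "h \<in> elems P" for h
    using P'(2) that by (simp add: matrix_iso_def bij_betw_def)
  have el: "elems P' = \<theta> ` elems P" using P'(2) by (simp add: matrix_iso_def bij_betw_def)
  have rel:
    "(\<theta> h, \<theta> g) \<in> tribe_rel T' \<longleftrightarrow> (h, g) \<in> tribe_rel T"
    if "h \<in> elems P" "g \<in> elems T" for h g
    using tribe_rel_iso[OF iso wf(1)] that wf(5) by blast
  show ?thesis
  proof (rule Set.set_eqI)
    fix x
    have "x \<in> pulled_class Tp T' C \<longleftrightarrow> (\<exists>h\<in>elems P. \<psi> h \<in> C \<and> (\<theta> h, x) \<in> tribe_rel T')"
      unfolding pulled_class_eq[OF ri' C] el using i by auto
    also have
      "\<dots> \<longleftrightarrow> (\<exists>g\<in>elems T. x = \<theta> g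
      \<and> (\<exists>h\<in>elems P. \<psi> h \<in> C \<and> (h, g) \<in> tribe_rel T))"
    proof
      assume "\<exists>h\<in>elems P. \<psi> h \<in> C \<and> (\<theta> h, x) \<in> tribe_rel T'"
      then obtain h
        where h: "h \<in> elems P" "\<psi> h \<in> C" "(\<theta> h, x) \<in> tribe_rel T'" by blast
      then have "x \<in> elems T'" using tribe_rel_mem[OF wf'] by blast
      then obtain g where "g \<in> elems T" "x = \<theta> g" using matrix_iso_surj[OF iso] by blast
      then show
        "\<exists>g\<in>elems T. x = \<theta> g \<and> (\<exists>h\<in>elems P. \<psi> h \<in> C
        \<and> (h, g) \<in> tribe_rel T)"
        using h rel by blast
    next
      assume "\<exists>g\<in>elems T. x = \<theta> g \<and> (\<exists>h\<in>elems P. \<psi> h \<in> C \<and> (h, g) \<in> tribe_rel T)"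
      then show
        "\<exists>h\<in>elems P. \<psi> h \<in> C \<and> (\<theta> h, x) \<in> tribe_rel T'"
        using rel by blast
    qed
    also have "\<dots> \<longleftrightarrow> x \<in> \<theta> ` pulled_class Tp T C"
      unfolding pulled_class_eq[OF ri C] using tribe_rel_mem[OF wf(1)] by blast
    finally show
      "x \<in> pulled_class Tp T' C \<longleftrightarrow> x \<in> \<theta> ` pulled_class Tp T C" .
  qed
qed

text \<open>Names, at \<open>Tp\<close>, the classes kept in the coefficient group. A class is a
  union of tribes, so meeting the zero tribe and containing it are the same unless that tribe is
  empty, in which case nothing is dropped.\<close>

definition nonzero_classes :: "('g, 'h::comm_ring_1) based_matrix \<Rightarrow> 'g set set" where
  "nonzero_classes T = {C \<in> reduced_partition T. C \<inter> zero_elems T = {}}"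

lemma reduct_zero_elems:
  assumes ri: "reduct_iso Tp T P \<psi>" and h: "h \<in> elems P"
  shows "h \<in> zero_elems T \<longleftrightarrow> \<psi> h \<in> zero_elems Tp"
proof -
  note wf = reduct_iso_wf[OF ri]
  have red: "reduces T P" "matrix_iso \<psi> P Tp" using ri by (auto simp: reduct_iso_def)
  note base = wf_matrixD(2)[OF wf(2)]
  have "h \<in> zero_elems T \<longleftrightarrow> h \<in> zero_elems P"
    using reducesD(6)[OF red(1) wf(1)] h by blast
  also have "\<dots> \<longleftrightarrow> \<psi> h \<in> zero_elems Tp"
  proof
    assume "\<psi> h \<in> zero_elems Tp"
    from zero_elems_iso[OF matrix_iso_inv[OF red(2) base] wf(3) this]
    show "h \<in> zero_elems P" using red(2) h by (simp add: matrix_iso_def bij_betw_def)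
  qed (rule zero_elems_iso[OF red(2) wf(2)])
  finally show ?thesis .
qed

text \<open>Keeps annihilating and core elements out of all classes that carry a coefficient, also
  when the zero tribe of \<open>T\<close> meets no reduct.\<close>

lemma pulled_nonzero_class:
  assumes ri: "reduct_iso Tp T P \<psi>" and C: "C \<in> nonzero_classes Tp"
  shows "pulled_class Tp T C \<inter> zero_elems T = {}"
proof -
  note wf = reduct_iso_wf[OF ri]
  have C': "C \<in> reduced_partition Tp" "C \<inter> zero_elems Tp = {}" using C
    by (auto simp: nonzero_classes_def)
  have False if g: "g \<in> pulled_class Tp T C" "g \<in> zero_elems T" for g
  proof -
    obtain h where h: "h \<in> elems P" "\<psi> h \<in> C" "(h, g) \<in> tribe_rel T"
      using g(1) unfolding pulled_class_eq[OF ri C'(1)] by blast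
    then have "h \<in> zero_elems T"
      using zero_elems_rel[OF wf(1) g(2)] tribe_rel_sym[OF wf(1)] by blast
    then show False using reduct_zero_elems[OF ri h(1)] h(2) C'(2) by blast
  qed
  then show ?thesis by blast
qed

text \<open>The zero elements are at most one tribe, which is primitive precisely when the reduct
  contains a zero element, and those correspond to the zero elements of \<open>Tp\<close>. So the
  same classes are removed at every matrix of a chain.\<close>

lemma zero_tribe_primitive_iff:
  assumes inf: "infinite (UNIV :: 'g set)"
    and ri: "reduct_iso (Tp :: ('g, 'h::comm_ring_1) based_matrix) T P \<psi>"
    and C: "C \<in> reduced_partition Tp"
  shows "zero_tribe T \<in> primitive_tribes T \<and> zero_tribe T \<subseteq> pulled_class Tp T C \<longleftrightarrow>
    C \<inter> zero_elems Tp \<noteq> {}"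
proof -
  note wf = reduct_iso_wf[OF ri]
  have red: "reduces T P" "primitive P" "matrix_iso \<psi> P Tp" using ri
    by (auto simp: reduct_iso_def)
  note z = zero_tribe_eq[OF inf wf(1)] and pt = primitive_tribes_eq[OF wf(1) red(1,2)]
  show ?thesis
  proof
    assume L:
      "zero_tribe T \<in> primitive_tribes T \<and> zero_tribe T \<subseteq> pulled_class Tp T C"
    then obtain h where h: "h \<in> elems P" "zero_elems T = tribe_rel T `` {h}" unfolding z pt
      by blast
    then have "h \<in> zero_elems T" using class_in_tribes(2)[OF wf(1)] wf(5) by blast
    then show "C \<inter> zero_elems Tp \<noteq> {}"
      using L mem_pulled_class[OF ri C h(1)] reduct_zero_elems[OF ri h(1)] unfolding z by blast
  next
    assume "C \<inter> zero_elems Tp \<noteq> {}"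
    then obtain x where x: "x \<in> C" "x \<in> zero_elems Tp" by blast
    then have "x \<in> elems Tp" using reduced_classD(1)[OF wf(3) C] by blast
    then obtain h where h: "h \<in> elems P" "x = \<psi> h" using matrix_iso_surj[OF red(3)]
      by blast
    then have hz: "h \<in> zero_elems T" "h \<in> pulled_class Tp T C"
      using reduct_zero_elems[OF ri h(1)] mem_pulled_class[OF ri C h(1)] x by blast+
    have "zero_elems T = tribe_rel T `` {h}" using zero_elems_rel[OF wf(1) hz(1)] by blast
    then show
      "zero_tribe T \<in> primitive_tribes T \<and> zero_tribe T \<subseteq> pulled_class Tp T C"
      unfolding z pt using h(1) pulled_class_closed[OF ri hz(2)] by blast
  qed
qed

section \<open>Transport of classes along a chain\<close>

lemma tribe_map_step:
  assumes op: "operation T T1 \<or> operation T1 T"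
    and ri: "reduct_iso Tp T P \<psi>" "reduct_iso Tp T1 P \<psi>"
    and h: "h \<in> elems P"
  shows "tribe_map T1 T (tribe_rel T1 `` {h}) = tribe_rel T `` {h}"
proof (cases "operation T T1")
  case True
  obtain X \<epsilon> where X: "extends T X T1" "cancels T1 X \<epsilon>" using True
    by (rule operationE)
  have "tribe_rel T1 `` {h} \<inter> elems T = tribe_rel T `` {h}"
    unfolding tribe_rel_extends[OF X] using reduct_iso_wf(5)[OF ri(1)] h by blast
  then show ?thesis using True by (simp add: tribe_map_def)
next
  case False
  then have "operation T1 T" using op by blast
  then obtain X \<epsilon> where X: "extends T1 X T" "cancels T X \<epsilon>" by (rule operationE)
  note wf = reduct_iso_wf[OF ri(1)]
  have red: "reduces T P" "primitive P" using ri by (auto simp: reduct_iso_def)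
  note pt = primitive_tribes_eq[OF wf(1) red]
  have h1: "h \<in> elems T1" "h \<in> elems T" using reduct_iso_wf(5)[OF ri(2)] wf(5) h by blast+
  have res: "tribe_rel T `` {h} \<inter> elems T1 = tribe_rel T1 `` {h}"
    unfolding tribe_rel_extends[OF X] using h1 by blast
  \<comment> \<open>A tribe with this trace contains h, and a tribe is determined by any of its
    elements.\<close>
  have "(THE C'. C' \<in> primitive_tribes T \<and> C' \<inter> elems T1 = tribe_rel T1 `` {h})
    = tribe_rel T `` {h}"
  proof (rule the_equality)
    show "tribe_rel T `` {h} \<in> primitive_tribes T \<and> tribe_rel T `` {h} \<inter> elems T1 = tribe_rel T1 `` {h}"
      using res pt h by blast
    fix C' assume C':
      "C' \<in> primitive_tribes T \<and> C' \<inter> elems T1 = tribe_rel T1 `` {h}"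
    then have "C' \<in> tribes T" by (simp add: primitive_tribes_def)
    moreover have "h \<in> C'" using C' res h1 class_in_tribes(2)[OF wf(1) h1(2)] by blast
    ultimately show "C' = tribe_rel T `` {h}" by (rule tribe_eq_class[OF wf(1)])
  qed
  then show ?thesis using False by (simp add: tribe_map_def)
qed

text \<open>The primitive tribes inside a pulled class are those of the points of \<open>P\<close>
  that \<psi> sends into \<open>C\<close>, a description common to both matrices.\<close>

lemma pulled_class_step:
  assumes op: "operation T T1 \<or> operation T1 T"
    and ri: "reduct_iso Tp T P \<psi>" "reduct_iso Tp T1 P \<psi>"
    and C: "C \<in> reduced_partition Tp"
  shows "\<Union> (tribe_map T1 T ` {X \<in> primitive_tribes T1. X \<subseteq> pulled_class Tp T1 C}) = pulled_class Tp T C"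
proof -
  note wf1 = reduct_iso_wf[OF ri(2)]
  have red1: "reduces T1 P" "primitive P" using ri(2) by (auto simp: reduct_iso_def)
  have "tribe_rel T1 `` {h} \<subseteq> pulled_class Tp T1 C \<longleftrightarrow> \<psi> h \<in> C" if h: "h \<in> elems P" for h
  proof -
    have "h \<in> tribe_rel T1 `` {h}" using class_in_tribes(2)[OF wf1(1)] wf1(5) h by blast
    then show ?thesis
      using mem_pulled_class[OF ri(2) C h] pulled_class_closed[OF ri(2), of h C] by blast
  qed
  then have "{X \<in> primitive_tribes T1. X \<subseteq> pulled_class Tp T1 C} =
      (\<lambda>h. tribe_rel T1 `` {h}) ` {h \<in> elems P. \<psi> h \<in> C}"
    unfolding primitive_tribes_eq[OF wf1(1) red1] by blast
  then have
    "\<Union> (tribe_map T1 T ` {X \<in> primitive_tribes T1. X \<subseteq> pulled_class Tp T1 C}) =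
      (\<Union>h\<in>{h \<in> elems P. \<psi> h \<in> C}. tribe_map T1 T (tribe_rel T1 `` {h}))"
    by (simp add: image_image)
  also have "\<dots> = (\<Union>h\<in>{h \<in> elems P. \<psi> h \<in> C}. tribe_rel T `` {h})"
    by (rule SUP_cong) (use tribe_map_step[OF op ri] in auto)
  also have "\<dots> = pulled_class Tp T C"
    unfolding pulled_class_eq[OF ri(1) C] by blast
  finally show ?thesis .
qed

text \<open>Whichever of the two matrices is the smaller one supplies a reduct for both.\<close>

lemma adjacent_reduct_iso:
  assumes op: "operation T T1 \<or> operation T1 T"
    and T: "homologous T Tp" and T1: "homologous T1 Tp" and prim: "primitive Tp"
  shows "\<exists>P \<psi>. reduct_iso Tp T P \<psi> \<and> reduct_iso Tp T1 P \<psi>"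
  using op homologous_reduct_iso[OF T prim] homologous_reduct_iso[OF T1 prim] reduct_iso_operation
  by blast

lemma prim_classes_eq:
  assumes "chain f T Tp" "primitive Tp"
  shows "prim_classes f = pulled_class Tp T ` reduced_partition Tp"
  using assms
proof (induction f arbitrary: T rule: prim_classes.induct)
  case (2 T')
  then have "T = Tp" "T' = Tp" by (simp_all add: chain_single)
  then show ?case using pulled_class_self[OF 2(2)] by (simp add: image_def)
next
  case (3 T0 T1 f)
  then have T: "T0 = T" and op: "operation T T1 \<or> operation T1 T" and ch: "chain (T1 # f) T1 Tp"
    by (auto simp: chain_Cons)
  obtain P \<psi> where ri: "reduct_iso Tp T P \<psi>" "reduct_iso Tp T1 P \<psi>"
    using adjacent_reduct_iso[OF op _ _ 3(3)] 3(2) ch unfolding homologous_def by blast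
  have "prim_classes (T0 # T1 # f) = (\<lambda>C. \<Union> (tribe_map T1 T ` {X \<in> primitive_tribes T1. X \<subseteq> C})) `
      pulled_class Tp T1 ` reduced_partition Tp"
    using "3.IH"[OF ch 3(3)] T by simp
  also have "\<dots> = pulled_class Tp T ` reduced_partition Tp"
    unfolding image_image by (rule image_cong) (use pulled_class_step[OF op ri] in auto)
  finally show ?case .
qed (simp add: chain_def)

lemma star_classes_eq:
  assumes inf: "infinite (UNIV :: 'g set)"
    and f: "chain f (T :: ('g, 'h::comm_ring_1) based_matrix) Tp" and prim: "primitive Tp"
  shows "star_classes f = pulled_class Tp T ` nonzero_classes Tp"
proof -
  obtain P \<psi> where ri: "reduct_iso Tp T P \<psi>"
    using homologous_reduct_iso[OF _ prim] f unfolding homologous_def by blast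
  have "hd f = T" using f by (simp add: chain_def)
  moreover have "{D \<in> pulled_class Tp T ` reduced_partition Tp.
      \<not> (zero_tribe T \<in> primitive_tribes T \<and> zero_tribe T \<subseteq> D)} =
    pulled_class Tp T ` {C \<in> reduced_partition Tp.
      \<not> (zero_tribe T \<in> primitive_tribes T \<and> zero_tribe T \<subseteq> pulled_class Tp T C)}"
    by blast
  moreover have "\<dots> = pulled_class Tp T ` nonzero_classes Tp"
    unfolding nonzero_classes_def using zero_tribe_primitive_iff[OF inf ri]
    by (intro image_cong) auto
  ultimately show ?thesis by (simp add: star_classes_def prim_classes_eq[OF f prim])
qed

lemma class_map_step:
  assumes inf: "infinite (UNIV :: 'g set)"
    and op: "operation (T :: ('g, 'h::comm_ring_1) based_matrix) T1 \<or> operation T1 T"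
    and T: "homologous T Tp" and f: "chain (T1 # f) T1 Tp" and prim: "primitive Tp"
    and C: "C \<in> nonzero_classes Tp"
  shows "class_map T T1 (star_classes (T1 # f)) (pulled_class Tp T C) = pulled_class Tp T1 C"
proof -
  have T1: "homologous T1 Tp" using f by (auto simp: homologous_def)
  obtain P \<psi> where ri: "reduct_iso Tp T P \<psi>" "reduct_iso Tp T1 P \<psi>"
    using adjacent_reduct_iso[OF op T T1 prim] by blast
  have C': "C \<in> reduced_partition Tp" using C by (simp add: nonzero_classes_def)
  show ?thesis
  proof (cases "operation T1 T")
    case True
    then show ?thesis using pulled_class_operation[OF True ri(2) C'] by (simp add: class_map_def)
  next
    case False
    then have op: "operation T T1" using op by blast
    have "(THE C'. C' \<in> star_classes (T1 # f) \<and> C' \<inter> elems T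
      = pulled_class Tp T C) = pulled_class Tp T1 C"
    proof (rule the_equality)
      show "pulled_class Tp T1 C \<in> star_classes (T1 # f) \<and>
          pulled_class Tp T1 C \<inter> elems T = pulled_class Tp T C"
        unfolding star_classes_eq[OF inf f prim] using pulled_class_operation[OF op ri(1) C'] C
          by blast
      fix E assume E:
        "E \<in> star_classes (T1 # f) \<and> E \<inter> elems T = pulled_class Tp T C"
      then obtain D where D: "D \<in> nonzero_classes Tp" "E = pulled_class Tp T1 D"
        unfolding star_classes_eq[OF inf f prim] by blast
      then have D': "D \<in> reduced_partition Tp" by (simp add: nonzero_classes_def)
      \<comment> \<open>Two candidates have equal traces on \<open>T\<close>, and a class of
        \<open>Tp\<close> is determined by its pullback to \<open>T\<close>; so the
        \<open>THE\<close> in \<open>class_map\<close> has a unique solution.\<close>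
      have "pulled_class Tp T D = pulled_class Tp T C"
        using pulled_class_operation[OF op ri(1) D'] E D(2) by simp
      then have "D = C" using pulled_class_inj[OF ri(1)] C' D' by (auto dest: inj_onD)
      then show "E = pulled_class Tp T1 C" using D by simp
    qed
    then show ?thesis using False by (simp add: class_map_def)
  qed
qed

text \<open>The coefficient at a class in the defining formula of the parity, indexed by the class
  of \<open>Tp\<close> so that it can be compared between different matrices.\<close>

definition weight ::
  "('g, 'h::comm_ring_1) based_matrix \<Rightarrow> ('g, 'h) based_matrix \<Rightarrow> 'g \<Rightarrow> 'g set \<Rightarrow> 'h" where
  "weight Tp T g C = sum (form T g) (pulled_class Tp T C) -
     of_nat (card (pulled_class Tp T C) div 2) * form T g (base T)"

text \<open>A new pair of complementary elements that falls into the class \<open>C\<close> adds \<open>b(g,s)\<close> to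
  \<open>b(g,\<chi>\<^sub>C)\<close>, which is compensated by the increase of \<open>|C| / 2\<close>.\<close>

lemma weight_operation:
  assumes op: "operation T T'" and ri: "reduct_iso Tp T P \<psi>"
    and C: "C \<in> nonzero_classes Tp"
    and g: "g \<in> elems T"
  shows "weight Tp T' g C = weight Tp T g C"
    "sum (form T' (base T')) (pulled_class Tp T' C) = sum (form T (base T)) (pulled_class Tp T C)"
proof -
  note ri' = reduct_iso_operation[OF op ri]
  have C': "C \<in> reduced_partition Tp" using C by (simp add: nonzero_classes_def)
  obtain X \<epsilon> where ext: "extends T X T'" and c: "cancels T' X \<epsilon>" using op
    by (rule operationE)
  note e = extendsD[OF ext]
  let ?D = "pulled_class Tp T C" and ?D' = "pulled_class Tp T' C"
  note D = pulled_class_operation[OF op ri C']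
  have D'sub: "?D' \<subseteq> elems T'" using pulled_class_subset[OF ri'] .
  have fin: "finite ?D" "finite X" using D'sub D wf_matrixD(1)[OF e(1)] cancels_finite[OF c] by auto
  have base: "base T \<in> elems T" using wf_matrixD(2)[OF e(1)] .
  have row: "sum (form T' x) ?D = sum (form T x) ?D" if "x \<in> elems T" for x
    by (rule sum.cong) (use D e(6) that in auto)
  consider (out) "?D' = ?D" | (pair) a b
    where "X = {a, b}" "a \<noteq> b" \<epsilon> "?D' = ?D \<union> X"
  proof (cases "X \<inter> ?D' = {}")
    case True
    then have "?D' = ?D" using D D'sub e(5) by blast
    then show thesis using out by blast
  next
    case False
    then have sub: "X \<subseteq> ?D'"
      using tribe_rel_cancels[OF e(2) c] pulled_class_closed[OF ri'] by blast
    then have "?D' = ?D \<union> X" using D D'sub e(5) by blast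
    \<comment> \<open>A single adjoined element lies in the zero tribe, which a nonzero class
      avoids; so only complementary pairs can enter.\<close>
    moreover have False if x: "X = {x}" for x
      using zero_elems_single[OF e(2)] c x sub pulled_nonzero_class[OF ri' C] by blast
    ultimately show thesis using pair c unfolding cancels_def by blast
  qed
  then have "weight Tp T' g C = weight Tp T g C \<and>
    sum (form T' (base T')) ?D' = sum (form T (base T)) ?D"
  proof cases
    case out
    then show ?thesis using row[OF g] row[OF base] e(3) e(6)[OF g base] by (simp add: weight_def)
  next
    case (pair a b)
    have dis: "?D \<inter> X = {}" using D e(4) by blast
    have sumX: "sum (form T' x) X = form T x (base T)" if "x \<in> elems T" for x
      using cancels_sum_right[OF e(2) c, of x] that e(3,5) e(6)[OF that base] pair by simp
    have tot: "sum (form T' x) ?D' = sum (form T x) ?D + form T x (base T)" if "x \<in> elems T"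
      for x
      using sum.union_disjoint[OF fin dis, of "form T' x"] row[OF that] sumX[OF that] pair by simp
    have "card ?D' = card ?D + 2"
      using card_Un_disjoint[OF fin dis] pair by simp
    then have "weight Tp T' g C = weight Tp T g C"
      using tot[OF g] e(3) e(6)[OF g base] by (simp add: weight_def algebra_simps)
    \<comment> \<open>For the row of s the surplus of the pair is b(s,s) = 0.\<close>
    moreover have "sum (form T' (base T')) ?D' = sum (form T (base T)) ?D"
      using tot[OF base] e(3) wf_matrixD(3)[OF e(1)] by simp
    ultimately show ?thesis by blast
  qed
  then show "weight Tp T' g C = weight Tp T g C"
    "sum (form T' (base T')) (pulled_class Tp T' C) = sum (form T (base T)) (pulled_class Tp T C)"
    by auto
qed

lemma weight_iso:
  assumes iso: "matrix_iso \<theta> T T'" and ri: "reduct_iso Tp T P \<psi>"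
    and C: "C \<in> reduced_partition Tp"
    and g: "g \<in> elems T"
  shows "weight Tp T' (\<theta> g) C = weight Tp T g C"
proof -
  let ?D = "pulled_class Tp T C"
  note sub = pulled_class_subset[OF ri, of C]
  have "inj_on \<theta> ?D" using iso sub
    by (auto simp: matrix_iso_def bij_betw_def intro: inj_on_subset)
  then have "card (\<theta> ` ?D) = card ?D" by (rule card_image)
  moreover have "form T' (\<theta> g) (base T') = form T g (base T)"
    using matrix_iso_form[OF iso g wf_matrixD(2)[OF reduct_iso_wf(1)[OF ri]]] iso
      by (simp add: matrix_iso_def)
  ultimately show ?thesis
    unfolding weight_def pulled_class_iso[OF iso ri C] using matrix_iso_sum_form[OF iso sub g]
      by simp
qed

text \<open>The coefficients of the relation are the same at every matrix of a chain, so the cyclic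
  subgroups to be divided out correspond.\<close>

lemma base_sum_invariant:
  assumes "chain f T Tp" "primitive Tp" "C \<in> nonzero_classes Tp"
  shows "sum (form T (base T)) (pulled_class Tp T C) = sum (form Tp (base Tp)) C"
  using assms
proof (induction f arbitrary: T rule: prim_classes.induct)
  case (2 T')
  then have "T = Tp" by (simp add: chain_single)
  moreover have "C \<in> reduced_partition Tp" using 2 by (simp add: nonzero_classes_def)
  ultimately show ?case using pulled_class_self[OF 2(2)] by simp
next
  case (3 T0 T1 f)
  then have T: "T0 = T" and op: "operation T T1 \<or> operation T1 T" and ch: "chain (T1 # f) T1 Tp"
    by (auto simp: chain_Cons)
  obtain P \<psi> where ri: "reduct_iso Tp T P \<psi>" "reduct_iso Tp T1 P \<psi>"
    using adjacent_reduct_iso[OF op _ _ 3(3)] 3(2) ch unfolding homologous_def by blast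
  have "sum (form T (base T)) (pulled_class Tp T C) = sum (form T1 (base T1)) (pulled_class Tp T1 C)"
    using op
  proof
    assume "operation T T1"
    from weight_operation(2)[OF this ri(1) 3(4) wf_matrixD(2)[OF reduct_iso_wf(1)[OF ri(1)]]]
    show ?thesis by simp
  next
    assume "operation T1 T"
    from weight_operation(2)[OF this ri(2) 3(4) wf_matrixD(2)[OF reduct_iso_wf(1)[OF ri(2)]]]
    show ?thesis by simp
  qed
  then show ?case using "3.IH"[OF ch 3(3,4)] by simp
qed (simp add: chain_def)

section \<open>The coefficient group\<close>

lemma comm_group_formal_sums:
  "comm_group (formal_sums (X :: 'x set) :: ('x \<Rightarrow>\<^sub>0 'h::comm_ring_1) monoid)"
proof (rule comm_groupI)
  fix x y :: "'x \<Rightarrow>\<^sub>0 'h"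
  assume "x \<in> carrier (formal_sums X)" "y \<in> carrier (formal_sums X)"
  then show "x \<otimes>\<^bsub>formal_sums X\<^esub> y \<in> carrier (formal_sums X)"
    using Poly_Mapping.keys_add[of x y] by (auto simp: formal_sums_def)
next
  fix x :: "'x \<Rightarrow>\<^sub>0 'h"
  assume "x \<in> carrier (formal_sums X)"
  then show
    "\<exists>y\<in>carrier (formal_sums X). y \<otimes>\<^bsub>formal_sums X\<^esub> x
    = \<one>\<^bsub>formal_sums X\<^esub>"
    by (intro bexI[of _ "- x"]) (auto simp: formal_sums_def keys_minus)
qed (auto simp: formal_sums_def algebra_simps)

section \<open>Pushing formal sums forward\<close>

lemma push_sum_superset:
  assumes "finite S" "Poly_Mapping.keys a \<subseteq> S"
  shows "push_sum m a = (\<Sum>C\<in>S. Poly_Mapping.single (m C) (Poly_Mapping.lookup a C))"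
  unfolding push_sum_def
  by (rule sum.mono_neutral_left) (use assms in \<open>auto simp: in_keys_iff\<close>)

lemma push_sum_add: "push_sum m (a + b) = push_sum m a + push_sum m b"
proof -
  let ?S = "Poly_Mapping.keys a \<union> Poly_Mapping.keys b"
  have "push_sum m (a + b) = (\<Sum>C\<in>?S. Poly_Mapping.single (m C) (Poly_Mapping.lookup (a
    + b) C))"
    by (rule push_sum_superset) (use Poly_Mapping.keys_add[of a b] in auto)
  also have "\<dots> = (\<Sum>C\<in>?S. Poly_Mapping.single (m C) (Poly_Mapping.lookup a C)) +
      (\<Sum>C\<in>?S. Poly_Mapping.single (m C) (Poly_Mapping.lookup b C))"
    by (simp only: lookup_add single_add sum.distrib)
  also have "\<dots> = push_sum m a + push_sum m b"
    by (intro arg_cong2[where f="(+)"] push_sum_superset[symmetric]) auto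
  finally show ?thesis .
qed

lemma push_sum_single: "push_sum m (Poly_Mapping.single C x) = Poly_Mapping.single (m C) x"
  using push_sum_superset[of "{C}" "Poly_Mapping.single C x" m] by simp

lemma push_sum_sum:
  "push_sum m (\<Sum>C\<in>X. Poly_Mapping.single (n C) (a C))
    = (\<Sum>C\<in>X. Poly_Mapping.single (m (n C)) (a C))"
proof -
  have 0: "push_sum m 0 = 0" by (simp add: push_sum_def)
  show ?thesis
    by (induction X rule: infinite_finite_induct) (simp_all add: 0 push_sum_add push_sum_single)
qed

lemma single_sum_carrier:
  "(\<Sum>C\<in>X. Poly_Mapping.single (n C) (a C)) \<in> carrier (formal_sums (n ` X))"
proof -
  have "Poly_Mapping.keys (\<Sum>C\<in>X. Poly_Mapping.single (n C) (a C)) \<subseteq> n ` X"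
  proof (induction X rule: infinite_finite_induct)
    case (insert x F)
    have "Poly_Mapping.keys (Poly_Mapping.single (n x) (a x)) \<subseteq> {n x}" by simp
    with insert show ?case
      using Poly_Mapping.keys_add[of "Poly_Mapping.single (n x) (a x)"
          "\<Sum>C\<in>F. Poly_Mapping.single (n C) (a C)"] by fastforce
  qed auto
  then show ?thesis by (simp add: formal_sums_def)
qed

lemma push_sum_carrier:
  assumes "a \<in> carrier (formal_sums X)" "m ` X \<subseteq> Y"
  shows "push_sum m a \<in> carrier (formal_sums Y)"
proof -
  have "Poly_Mapping.keys a \<subseteq> X" using assms by (simp add: formal_sums_def)
  then have "m ` Poly_Mapping.keys a \<subseteq> Y" using assms by blast
  then show ?thesis
    using single_sum_carrier[of m "Poly_Mapping.lookup a" "Poly_Mapping.keys a"]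
    by (auto simp: push_sum_def formal_sums_def)
qed

lemma push_sum_hom:
  assumes "m ` X \<subseteq> Y"
  shows "group_hom (formal_sums X) (formal_sums Y) (push_sum m)"
proof -
  have "push_sum m \<in> hom (formal_sums X) (formal_sums Y)"
    using push_sum_carrier[OF _ assms] by (auto simp: hom_def formal_sums_def push_sum_add)
  then show ?thesis
    using comm_group.axioms(2)[OF comm_group_formal_sums[of X]]
      comm_group.axioms(2)[OF comm_group_formal_sums[of Y]]
    by (simp add: group_hom_def group_hom_axioms_def)
qed

lemma formal_sums_coset:
  "N #>\<^bsub>formal_sums X\<^esub> v = (\<lambda>r. r + v) ` N"
  by (auto simp: r_coset_def formal_sums_def)

section \<open>The parity in closed form, for a fixed primitive matrix\<close>

context
  fixes Tp :: "('g, 'h::comm_ring_1) based_matrix"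
  assumes inf: "infinite (UNIV :: 'g set)" and prim: "primitive Tp"
begin

text \<open>Coefficients are indexed by classes of \<open>Tp\<close> and only the labels depend on
  \<open>T\<close>. A step of a chain then changes the labels and leaves the coefficient function
  alone.\<close>

definition combination ::
  "('g, 'h) based_matrix \<Rightarrow> ('g set \<Rightarrow> 'h) \<Rightarrow> 'g set \<Rightarrow>\<^sub>0 'h" where
  "combination T a = (\<Sum>C\<in>nonzero_classes Tp. Poly_Mapping.single (pulled_class Tp T C) (a C))"

definition base_weight :: "'g set \<Rightarrow> 'h" where
  "base_weight C = sum (form Tp (base Tp)) C"

lemma chain_self: "chain [Tp] Tp Tp"
  by (simp add: chain_single)

lemma nonzero_class_in: "C \<in> nonzero_classes Tp \<Longrightarrow> C \<in> reduced_partition Tp"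
  by (simp add: nonzero_classes_def)

lemma pulled_inj_nonzero:
  assumes "chain f T Tp"
  shows "inj_on (pulled_class Tp T) (nonzero_classes Tp)"
proof -
  have "homologous T Tp" using assms by (auto simp: homologous_def)
  then obtain P \<psi> where "reduct_iso Tp T P \<psi>" using homologous_reduct_iso prim by blast
  from inj_on_subset[OF pulled_class_inj[OF this]] show ?thesis by (auto simp: nonzero_classes_def)
qed

lemma pulled_finite:
  assumes "chain f T Tp"
  shows "finite (pulled_class Tp T C)"
proof -
  have "homologous T Tp" using assms by (auto simp: homologous_def)
  then obtain P \<psi> where "reduct_iso Tp T P \<psi>" using homologous_reduct_iso prim by blast
  from pulled_class_subset[OF this] wf_matrixD(1)[OF reduct_iso_wf(1)[OF this]]
  show ?thesis by (rule finite_subset)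
qed

lemma relations_eq:
  assumes f: "chain f T Tp"
  shows "relations f = generate (formal_sums (star_classes f)) {combination T base_weight}"
proof -
  have hd: "hd f = T" using f by (simp add: chain_def)
  have "(\<Sum>C\<in>star_classes f. Poly_Mapping.single C (bform (hd f) (frag_of (base (hd f))) (chi C))) =
    (\<Sum>C\<in>nonzero_classes Tp. Poly_Mapping.single (pulled_class Tp T C)
      (bform T (frag_of (base T)) (chi (pulled_class Tp T C))))"
    unfolding hd star_classes_eq[OF inf f prim]
    by (simp add: sum.reindex[OF pulled_inj_nonzero[OF f]])
  also have "\<dots> = combination T base_weight"
    unfolding combination_def base_weight_def
    by (rule sum.cong) (simp_all add: bform_frag_chi[OF pulled_finite[OF f]] base_sum_invariant[OF f prim])
  finally show ?thesis by (simp add: relations_def)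
qed

lemma stable_value_eq:
  assumes f: "chain f T Tp"
  shows "stable_value f g = (\<lambda>r. r + combination T (weight Tp T g)) ` relations f"
proof -
  have hd: "hd f = T" using f by (simp add: chain_def)
  have "(\<Sum>C\<in>star_classes f. Poly_Mapping.single C
        (bform (hd f) (frag_of g) (chi C) - of_nat (card C div 2) * form (hd f) g (base (hd f)))) =
    (\<Sum>C\<in>nonzero_classes Tp. Poly_Mapping.single (pulled_class Tp T C)
        (bform T (frag_of g) (chi (pulled_class Tp T C)) -
          of_nat (card (pulled_class Tp T C) div 2) * form T g (base T)))"
    unfolding hd star_classes_eq[OF inf f prim]
    by (simp add: sum.reindex[OF pulled_inj_nonzero[OF f]])
  also have "\<dots> = combination T (weight Tp T g)"
    unfolding combination_def weight_def
    by (rule sum.cong) (simp_all add: bform_frag_chi[OF pulled_finite[OF f]])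
  finally show ?thesis by (simp add: stable_value_def formal_sums_coset)
qed

lemma combination_carrier:
  assumes f: "chain f T Tp"
  shows "combination T a \<in> carrier (formal_sums (star_classes f))"
  unfolding combination_def star_classes_eq[OF inf f prim] by (rule single_sum_carrier)

text \<open>At each step the relabelling takes generator to generator, hence the relation subgroup
  onto the next one, and the representative to the sum with the same coefficients.\<close>

lemma induced_map_coset:
  assumes "chain f T Tp"
  shows "induced_map f ((\<lambda>r. r + combination T a) ` relations f) =
    (\<lambda>r. r + combination Tp a) ` relations [Tp]"
  using assms
proof (induction f arbitrary: T rule: prim_classes.induct)
  case (2 T')
  then have "T = Tp" "T' = Tp" by (simp_all add: chain_single)
  then show ?case by simp
next
  case (3 T0 T1 f)
  then have T: "T0 = T" and op: "operation T T1 \<or> operation T1 T" and ch: "chain (T1 # f) T1 Tp"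
    by (auto simp: chain_Cons)
  have ch0: "chain (T # T1 # f) T Tp" using 3(2) T by simp
  then have hom: "homologous T Tp" by (auto simp: homologous_def)
  let ?m = "class_map T T1 (star_classes (T1 # f))"
  note step = class_map_step[OF inf op hom ch prim]
  have push: "push_sum ?m (combination T c) = combination T1 c" for c
    unfolding combination_def push_sum_sum by (rule sum.cong) (simp_all add: step)
  have "?m ` star_classes (T # T1 # f) \<subseteq> star_classes (T1 # f)"
    unfolding star_classes_eq[OF inf ch0 prim] star_classes_eq[OF inf ch prim]
    using step by (auto simp: star_classes_eq[OF inf ch prim])
  then have hm:
    "group_hom (formal_sums (star_classes (T # T1 # f))) (formal_sums (star_classes (T1 # f)))
      (push_sum ?m :: ('g set \<Rightarrow>\<^sub>0 'h) \<Rightarrow> _)"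
    by (rule push_sum_hom)
  \<comment> \<open>The image of a generated subgroup is generated by the image of the generator,
    which is again the sum with coefficients \<open>base_weight\<close>.\<close>
  have rel: "push_sum ?m ` relations (T # T1 # f) = relations (T1 # f)"
    unfolding relations_eq[OF ch0] relations_eq[OF ch]
    using group_hom.generate_img[OF hm, of
      "{combination T base_weight}"] combination_carrier[OF ch0]
    by (simp add: push)
  have "push_sum ?m ` (\<lambda>r. r + combination T a) ` relations (T # T1 # f) =
      (\<lambda>r. r + combination T1 a) ` push_sum ?m ` relations (T # T1 # f)"
    by (simp add: image_image push_sum_add push)
  then show ?case using "3.IH"[OF ch] by (simp add: rel T)
qed (simp add: chain_def)

text \<open>The chosen chain has disappeared: \<open>T\<close> enters through its weights alone, so
  invariance of weights is invariance of the parity.\<close>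

lemma reduced_stable_parity_eq:
  assumes "homologous T Tp"
  shows "reduced_stable_parity Tp T g =
    relations [Tp] #>\<^bsub>formal_sums (star_classes [Tp])\<^esub> combination Tp (weight Tp T g)"
proof -
  have "chain (SOME f. chain f T Tp) T Tp"
    using assms someI_ex[of "\<lambda>f. chain f T Tp"] by (simp add: homologous_def)
  then show ?thesis
    using stable_value_eq induced_map_coset
      by (simp add: reduced_stable_parity_def Let_def formal_sums_coset)
qed

lemma relations_normal: "relations [Tp] \<lhd> formal_sums (star_classes [Tp])"
proof -
  let ?G = "formal_sums (star_classes [Tp]) :: ('g set \<Rightarrow>\<^sub>0 'h) monoid"
  interpret comm_group ?G by (rule comm_group_formal_sums)
  have "subgroup (relations [Tp]) ?G"
    unfolding relations_eq[OF chain_self]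
    by (rule generate_is_subgroup) (use combination_carrier[OF chain_self] in simp)
  then show ?thesis by (rule subgroup_imp_normal)
qed

lemma comm_group_stable_coeffs: "comm_group (stable_coeffs Tp)"
  unfolding stable_coeffs_def stable_group_def
  by (rule comm_group.abelian_FactGroup[OF comm_group_formal_sums])
    (rule normal_imp_subgroup[OF relations_normal])

lemma parity_carrier:
  assumes "homologous T Tp"
  shows "reduced_stable_parity Tp T g \<in> carrier (stable_coeffs Tp)"
  unfolding reduced_stable_parity_eq[OF assms] stable_coeffs_def stable_group_def carrier_FactGroup
  using combination_carrier[OF chain_self] by blast

lemma combination_cong:
  "(\<And>C. C \<in> nonzero_classes Tp \<Longrightarrow> a C = b C)
    \<Longrightarrow> combination T a = combination T b"
  unfolding combination_def by (rule sum.cong) simp_all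

lemma combination_add: "combination T a + combination T b = combination T (\<lambda>C. a C + b C)"
  by (simp add: combination_def single_add sum.distrib)

lemma parity_operation:
  assumes op: "operation T T'" and hom: "homologous T Tp" "homologous T' Tp"
    and g: "g \<in> elems T"
  shows "reduced_stable_parity Tp T' g = reduced_stable_parity Tp T g"
proof -
  obtain P \<psi> where ri: "reduct_iso Tp T P \<psi>" using homologous_reduct_iso[OF hom(1) prim]
    by blast
  have "combination Tp (weight Tp T' g) = combination Tp (weight Tp T g)"
    by (rule combination_cong) (rule weight_operation(1)[OF op ri _ g])
  then show ?thesis by (simp add: reduced_stable_parity_eq hom)
qed

lemma parity_iso:
  assumes iso: "matrix_iso \<theta> T T'" and hom: "homologous T Tp" "homologous T' Tp"
    and g: "g \<in> elems T"
  shows "reduced_stable_parity Tp T' (\<theta> g) = reduced_stable_parity Tp T g"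
proof -
  obtain P \<psi> where ri: "reduct_iso Tp T P \<psi>" using homologous_reduct_iso[OF hom(1) prim]
    by blast
  have "combination Tp (weight Tp T' (\<theta> g)) = combination Tp (weight Tp T g)"
    by (rule combination_cong) (rule weight_iso[OF iso ri nonzero_class_in g])
  then show ?thesis by (simp add: reduced_stable_parity_eq hom)
qed

lemma coset_mult:
  assumes "v \<in> carrier (formal_sums (star_classes [Tp]))"
    "w \<in> carrier (formal_sums (star_classes [Tp]))"
  shows "(relations [Tp] #>\<^bsub>formal_sums (star_classes [Tp])\<^esub> v) \<otimes>\<^bsub>stable_coeffs Tp\<^esub>
      (relations [Tp] #>\<^bsub>formal_sums (star_classes [Tp])\<^esub> w) =
    relations [Tp] #>\<^bsub>formal_sums (star_classes [Tp])\<^esub> (v + w)"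
  using normal.rcos_sum[OF relations_normal assms]
  by (simp add: stable_coeffs_def stable_group_def FactGroup_def formal_sums_def)

text \<open>The subgroup is cyclic, so only integer multiples of the generator are available. This
  fits the integer factors in all conditions on rows, which arise from intersection numbers.\<close>

lemma coset_one:
  "relations [Tp] #>\<^bsub>formal_sums (star_classes [Tp])\<^esub> combination Tp (\<lambda>C. of_int k * base_weight C) =
    \<one>\<^bsub>stable_coeffs Tp\<^esub>"
proof -
  let ?G = "formal_sums (star_classes [Tp]) :: ('g set \<Rightarrow>\<^sub>0 'h) monoid"
  let ?N = "relations [Tp]"
  interpret comm_group ?G by (rule comm_group_formal_sums)
  have sub: "subgroup ?N ?G" by (rule normal_imp_subgroup[OF relations_normal])
  have base: "combination Tp base_weight \<in> ?N"
    unfolding relations_eq[OF chain_self] by (rule generate.incl) simp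
  \<comment> \<open>Natural multiples are iterated sums of the generator; negative ones are inverses
    of these.\<close>
  have nat: "combination Tp (\<lambda>C. of_nat n * base_weight C) \<in> ?N" for n
  proof (induction n)
    case 0
    have "combination Tp (\<lambda>C. of_nat 0 * base_weight C) = \<one>\<^bsub>?G\<^esub>"
      by (simp add: combination_def formal_sums_def)
    then show ?case using subgroup.one_closed[OF sub] by simp
  next
    case (Suc n)
    have "combination Tp (\<lambda>C. of_nat (Suc n) * base_weight C) =
        combination Tp base_weight \<otimes>\<^bsub>?G\<^esub> combination Tp (\<lambda>C. of_nat n * base_weight C)"
      by (simp add: formal_sums_def combination_add distrib_right)
    then show ?case using subgroup.m_closed[OF sub base Suc] by simp
  qed
  have "combination Tp (\<lambda>C. of_int k * base_weight C) \<in> ?N"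
  proof (cases "k \<ge> 0")
    case True
    then show ?thesis using nat[of "nat k"] by simp
  next
    case False
    let ?v = "combination Tp (\<lambda>C. of_nat (nat (- k)) * base_weight C)"
    have "combination Tp (\<lambda>C. of_int k * base_weight C) \<otimes>\<^bsub>?G\<^esub> ?v
      = \<one>\<^bsub>?G\<^esub>"
      using False by (simp add: formal_sums_def combination_add flip: distrib_right)
        (simp add: combination_def)
    then have "inv\<^bsub>?G\<^esub> ?v = combination Tp (\<lambda>C. of_int k * base_weight C)"
      by (rule inv_equality) (rule combination_carrier[OF chain_self])+
    then show ?thesis using subgroup.m_inv_closed[OF sub nat] by metis
  qed
  then have "?N #>\<^bsub>?G\<^esub> combination Tp (\<lambda>C. of_int k * base_weight C) = ?N"
    using coset_join2[OF combination_carrier[OF chain_self] sub] by blast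
  then show ?thesis by (simp add: stable_coeffs_def stable_group_def FactGroup_def)
qed

text \<open>Weights are additive in the row. For a total row k b(s,-) the correction term
  disappears, since its value at s is k b(s,s) = 0, and what remains is k times the coefficient of
  the relation.\<close>

lemma weight_linear:
  assumes hom: "homologous T Tp" and gs: "finite S" "S \<subseteq> elems T"
    and row: "\<And>h. h \<in> elems T \<Longrightarrow> (\<Sum>g\<in>S. form T g h)
      = of_int k * form T (base T) h"
    and C: "C \<in> nonzero_classes Tp"
  shows "(\<Sum>g\<in>S. weight Tp T g C) = of_int k * base_weight C"
proof -
  obtain P \<psi> where ri: "reduct_iso Tp T P \<psi>" using homologous_reduct_iso[OF hom prim]
    by blast
  obtain f where f: "chain f T Tp" using hom by (auto simp: homologous_def)
  let ?D = "pulled_class Tp T C"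
  note wf = reduct_iso_wf(1)[OF ri]
  have "(\<Sum>g\<in>S. sum (form T g) ?D) = (\<Sum>h\<in>?D. \<Sum>g\<in>S. form T g h)"
    by (rule sum.swap)
  also have "\<dots> = (\<Sum>h\<in>?D. of_int k * form T (base T) h)"
    by (rule sum.cong) (use row pulled_class_subset[OF ri] in auto)
  also have "\<dots> = of_int k * base_weight C"
    by (simp add: base_weight_def base_sum_invariant[OF f prim C] flip: sum_distrib_left)
  finally have "(\<Sum>g\<in>S. sum (form T g) ?D) = of_int k * base_weight C" .
  moreover have "(\<Sum>g\<in>S. form T g (base T)) = 0"
    using row[OF wf_matrixD(2)[OF wf]] wf_matrixD(3)[OF wf] by simp
  ultimately show ?thesis
    unfolding weight_def sum_subtractf by (simp flip: sum_distrib_left)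
qed

text \<open>All three parity axioms are instances, with S the set of crossings that take part in the
  move.\<close>

lemma combination_one:
  assumes "homologous T Tp" "finite S" "S \<subseteq> elems T"
    and "\<And>h. h \<in> elems T \<Longrightarrow> (\<Sum>g\<in>S. form T g h)
      = of_int k * form T (base T) h"
  shows "relations [Tp] #>\<^bsub>formal_sums (star_classes [Tp])\<^esub> combination Tp (\<lambda>C. \<Sum>g\<in>S. weight Tp T g C) =
    \<one>\<^bsub>stable_coeffs Tp\<^esub>"
proof -
  have "combination Tp (\<lambda>C. \<Sum>g\<in>S. weight Tp T g C)
    = combination Tp (\<lambda>C. of_int k * base_weight C)"
    by (rule combination_cong) (rule weight_linear[OF assms])
  then show ?thesis by (simp add: coset_one)
qed

lemma parity_one:
  assumes "homologous T Tp" "g \<in> elems T"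
    and "\<And>h. h \<in> elems T \<Longrightarrow> form T g h = of_int k * form T (base T) h"
  shows "reduced_stable_parity Tp T g = \<one>\<^bsub>stable_coeffs Tp\<^esub>"
  using combination_one[OF assms(1), of "{g}" k] assms by (simp add: reduced_stable_parity_eq)

lemma parity_two:
  assumes "homologous T Tp" "g1 \<in> elems T" "g2 \<in> elems T" "g1 \<noteq> g2"
    and "\<And>h. h \<in> elems T \<Longrightarrow> form T g1 h + form T g2 h
      = of_int k * form T (base T) h"
  shows "reduced_stable_parity Tp T g1 \<otimes>\<^bsub>stable_coeffs Tp\<^esub> reduced_stable_parity Tp T g2 =
    \<one>\<^bsub>stable_coeffs Tp\<^esub>"
  using combination_one[OF assms(1), of "{g1, g2}" k] assms
  by (simp add: reduced_stable_parity_eq coset_mult[OF combination_carrier combination_carrier, OF chain_self chain_self]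
      combination_add)

lemma parity_three:
  assumes "homologous T Tp" "g1 \<in> elems T" "g2 \<in> elems T" "g3 \<in> elems T"
    "distinct [g1, g2, g3]"
    and "\<And>h. h \<in> elems T \<Longrightarrow> form T g1 h + form T g2 h + form T g3 h
      = of_int k * form T (base T) h"
  shows "reduced_stable_parity Tp T g1 \<otimes>\<^bsub>stable_coeffs Tp\<^esub> reduced_stable_parity Tp T g2
      \<otimes>\<^bsub>stable_coeffs Tp\<^esub> reduced_stable_parity Tp T g3 = \<one>\<^bsub>stable_coeffs Tp\<^esub>"
  using combination_one[OF assms(1), of "{g1, g2, g3}" k] assms
  by (simp add: reduced_stable_parity_eq coset_mult[OF combination_carrier combination_carrier, OF chain_self chain_self]
      combination_add add.assoc)

end

section \<open>Intersection numbers in Gauss codes\<close>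

text \<open>Computes the \<open>THE\<close> in \<open>position\<close>. An absent passage gets the
  length of the list as its index, so \<open>idx_append\<close> holds for every passage.\<close>

primrec idx :: "'a list \<Rightarrow> 'a \<Rightarrow> nat" where
  "idx [] l = 0"
| "idx (x # xs) l = (if x = l then 0 else Suc (idx xs l))"

lemma idx_append: "idx (u @ v) l = (if l \<in> set u then idx u l else length u + idx v l)"
  by (induction u) auto

lemma idx_less: "l \<in> set u \<Longrightarrow> idx u l < length u"
  by (induction u) auto

lemma nth_idx: "l \<in> set u \<Longrightarrow> u ! idx u l = l"
  by (induction u) auto

lemma idx_inj:
  "l \<in> set u \<Longrightarrow> m \<in> set u \<Longrightarrow> idx u l = idx u m
  \<longleftrightarrow> l = m"
  by (metis nth_idx)

lemma position_eq_idx: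
  assumes "wf_diagram D" "l \<in> set (word D)"
  shows "position D l = idx (word D) l"
  unfolding position_def
proof (rule the_equality)
  show "idx (word D) l < length (word D) \<and> word D ! idx (word D) l = l"
    using assms by (simp add: idx_less nth_idx)
  show "i = idx (word D) l" if "i < length (word D) \<and> word D ! i = l" for i
    using that assms idx_less nth_idx nth_eq_iff_index_eq[of "word D"]
    by (metis wf_diagram_def)
qed

lemma wf_diagram_passage:
  "wf_diagram D \<Longrightarrow> l \<in> set (word D) \<longleftrightarrow> fst l \<in> crossings D"
  by (cases l) (simp add: wf_diagram_def)

lemma finite_crossings: "finite (crossings D)"
  by (simp add: crossings_def)

lemma position_less:
  "wf_diagram D \<Longrightarrow> fst l \<in> crossings D \<Longrightarrow> position D l < length (word D)"
  by (simp add: position_eq_idx idx_less wf_diagram_passage)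

lemma position_inj:
  "wf_diagram D \<Longrightarrow> fst l \<in> crossings D \<Longrightarrow> fst m \<in> crossings D \<Longrightarrow>
    position D l = position D m \<longleftrightarrow> l = m"
  by (simp add: position_eq_idx idx_inj wf_diagram_passage)

text \<open>The cyclic order of three positions: running forward round the code from p, one meets l
  strictly before q.\<close>

definition between :: "nat \<Rightarrow> nat \<Rightarrow> nat \<Rightarrow> bool" where
  "between p l q \<longleftrightarrow> p < l \<and> l < q \<or> l < q \<and> q < p \<or> q < p
    \<and> p < l"

text \<open>\<open>arcs D g l\<close> is the multiplicity of the cycle of \<open>g\<close> along the strand through the
  passage \<open>l\<close>, if \<open>l\<close> is not one of the two passages of the crossing \<open>g\<close>.\<close>

fun arcs :: "diagram \<Rightarrow> nat option \<Rightarrow> passage \<Rightarrow> int" where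
  "arcs D None l = 1"
| "arcs D (Some c) l =
    of_bool (between (position D (c, Leftward)) (position D l) (position D (c, Rightward)))"

text \<open>The left half of \<open>c\<close> turns from one strand to the other at \<open>c\<close>. This is what the crossing \<open>c\<close>
  itself contributes to twice its intersection number with the cycle of \<open>h\<close>.\<close>

fun corner :: "diagram \<Rightarrow> nat option \<Rightarrow> nat option \<Rightarrow> int" where
  "corner D h None = 0"
| "corner D h (Some c) = arcs D h (c, Leftward) - arcs D h (c, Rightward)"

text \<open>Intersection number of two cycles that run straight through the crossing with these
  multiplicities.\<close>

definition local_term ::
  "diagram \<Rightarrow> nat option \<Rightarrow> nat option \<Rightarrow> nat \<Rightarrow> int" where
  "local_term D g h e =
     arcs D g (e, Rightward) * arcs D h (e, Leftward) - arcs D g (e, Leftward) * arcs D h (e, Rightward)"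

definition cycle_product ::
  "diagram \<Rightarrow> nat option \<Rightarrow> nat option \<Rightarrow> int" where
  "cycle_product D g h = intersection_number D (cycle_of D g) (cycle_of D h)"

lemma diagram_matrix_simps:
  "elems (diagram_matrix D) = insert None (Some ` crossings D)"
  "base (diagram_matrix D) = None"
  "form (diagram_matrix D) g h = of_int (cycle_product D g h)"
  by (simp_all add: diagram_matrix_def cycle_product_def)

text \<open>Offsets measured from a describe a half-open interval of edges: a itself together with
  the open cyclic interval from a to b.\<close>

lemma cyclic_offset_less:
  assumes "i < n" "a < n" "b < n" "a \<noteq> b"
  shows "(i + n - a) mod n < (b + n - a) mod n \<longleftrightarrow> i = a \<or> between a i b"
proof -
  have *: "(j + n - a) mod n = (if a \<le> j then j - a else j + n - a)" if "j < n" for j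
  proof (cases "a \<le> j")
    case True
    then have eq: "j + n - a = (j - a) + n" and less: "j - a < n" using that by simp_all
    show ?thesis unfolding eq mod_add_self2 mod_less[OF less] using True by simp
  next
    case False
    then show ?thesis using that assms by simp
  qed
  show ?thesis unfolding *[OF assms(1)] *[OF assms(3)] between_def using assms by auto
qed

text \<open>Edges are replaced by passages. A half runs straight through every foreign crossing; at
  its own crossing \<open>arcs\<close> is 0, and the correction records the edge by which it
  departs. The companion for incoming edges records the one by which it returns.\<close>

lemma left_half_out:
  assumes "wf_diagram D" "c \<in> crossings D" "fst l \<in> crossings D"
  shows "left_half D c (out_edge D l) = of_bool (l = (c, Leftward)) + arcs D (Some c) l"
proof -
  have pos: "position D l < length (word D)" "position D (c, Leftward) < length (word D)"
    "position D (c, Rightward) < length (word D)"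
    "position D (c, Leftward) \<noteq> position D (c, Rightward)"
    "position D l = position D (c, Leftward) \<longleftrightarrow> l = (c, Leftward)"
    using assms by (simp_all add: position_less position_inj)
  show ?thesis
    using pos cyclic_offset_less[OF pos(1-4)]
    by (auto simp: left_half_def out_edge_def Let_def between_def)
qed

lemma left_half_in:
  assumes "wf_diagram D" "c \<in> crossings D" "fst l \<in> crossings D"
  shows "left_half D c (in_edge D l) = of_bool (l = (c, Rightward)) + arcs D (Some c) l"
proof -
  let ?n = "length (word D)" and ?p = "position D l"
  let ?a = "position D (c, Leftward)" and ?b = "position D (c, Rightward)"
  have pos: "?p < ?n" "?a < ?n" "?b < ?n" "?a \<noteq> ?b"
    "?p = ?b \<longleftrightarrow> l = (c, Rightward)"
    using assms by (simp_all add: position_less position_inj)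
  \<comment> \<open>The edge into the first passage is the last edge of the code.\<close>
  have j: "in_edge D l = (if ?p = 0 then ?n - 1 else ?p - 1)"
    using pos(1) by (auto simp: in_edge_def mod_if)
  have jn: "in_edge D l < ?n" using pos(1) by (auto simp: j)
  have "in_edge D l = ?a \<or> between ?a (in_edge D l) ?b \<longleftrightarrow> ?p = ?b
    \<or> between ?a ?p ?b"
    unfolding j between_def using pos(1-4) by auto
  then show ?thesis
    using pos jn cyclic_offset_less[OF jn pos(2-4)]
    by (auto simp: left_half_def Let_def between_def)
qed

lemma sum_pairs_4:
  "(\<Sum>j<4. \<Sum>i<j. f i j) = f 0 1 + f 0 2 + f 1 2 + f 0 3 + f 1 3 + f 2 (3::nat)"
    for f :: "nat \<Rightarrow> nat \<Rightarrow> int"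
  by (simp add: numeral_eq_Suc lessThan_Suc)

lemma out_edge_less:
  "wf_diagram D \<Longrightarrow> fst l \<in> crossings D \<Longrightarrow> out_edge D l < length (word D)"
  by (simp add: out_edge_def position_less)

lemma in_edge_less:
  "wf_diagram D \<Longrightarrow> fst l \<in> crossings D \<Longrightarrow> in_edge D l < length (word D)"
  using position_less[of D l] unfolding in_edge_def by (metis mod_less_divisor not_less0 gr0I)

lemma flux_cycle:
  assumes "wf_diagram D" "g \<in> insert None (Some ` crossings D)" "e \<in> crossings D"
  shows "flux D (cycle_of D g) e =
    [arcs D g (e, Rightward), of_bool (g = Some e) + arcs D g (e, Leftward),
     - (of_bool (g = Some e) + arcs D g (e, Rightward)), - arcs D g (e, Leftward)]"
proof (cases g)
  case None
  then show ?thesis using assms by (simp add: flux_def whole_curve_def out_edge_less in_edge_less)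
next
  case (Some c)
  then have "c \<in> crossings D" using assms by auto
  then show ?thesis using assms Some by (auto simp: flux_def left_half_out left_half_in)
qed

lemma arcs_self: "arcs D (Some c) (c, \<sigma>) = 0"
  by (cases \<sigma>) (simp_all add: between_def)

text \<open>Linking of two chords on a circle is symmetric: the corner term is odd exactly when the
  passages of the two crossings alternate, and then both corner terms are odd. This makes the
  division by two in \<open>intersection_number\<close> exact.\<close>

lemma even_corner:
  assumes wf: "wf_diagram D"
    and g: "g \<in> insert None (Some ` crossings D)" "h \<in> insert None (Some ` crossings D)"
  shows "even (corner D h g - corner D g h)"
proof (cases "g = None \<or> h = None \<or> g = h")
  case True
  then show ?thesis by (cases g; cases h) auto
next
  case False
  then obtain c d
    where cd: "g = Some c" "h = Some d" "c \<noteq> d" "c \<in> crossings D" "d \<in> crossings D"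
    using g by auto
  let ?p = "position D (c, Leftward)" and ?q = "position D (c, Rightward)"
  let ?r = "position D (d, Leftward)" and ?s = "position D (d, Rightward)"
  have "?p \<noteq> ?q" "?p \<noteq> ?r" "?p \<noteq> ?s" "?q \<noteq> ?r" "?q \<noteq> ?s"
    "?r \<noteq> ?s"
    using wf cd by (simp_all add: position_inj)
  then show ?thesis
    unfolding cd(1,2) corner.simps arcs.simps of_bool_def between_def by (auto; linarith)
qed

text \<open>Each crossing contributes twice its determinant, plus a corner term where one of the two
  cycles turns. All later computations compare these doubled numbers, so the division does not
  appear again.\<close>

lemma twice_cycle_product:
  assumes wf: "wf_diagram D"
    and g: "g \<in> insert None (Some ` crossings D)" "h \<in> insert None (Some ` crossings D)"
  shows "2 * cycle_product D g h = 2 * (\<Sum>e\<in>crossings D. local_term D g h e)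
    + corner D h g - corner D g h"
proof -
  let ?d = "\<lambda>g h e. of_bool (g = Some e) * (arcs D h (e, Leftward) - arcs D h (e, Rightward))"
  have loc: "(\<Sum>j<4. \<Sum>i<j. flux D (cycle_of D g) e ! i * flux D (cycle_of D h) e ! j -
      flux D (cycle_of D g) e ! j * flux D (cycle_of D h) e ! i) =
    2 * local_term D g h e + ?d g h e - ?d h g e" if e: "e \<in> crossings D" for e
  proof -
    have "arcs D (Some e) (e, \<sigma>) = 0" for \<sigma> by (rule arcs_self)
    then show ?thesis
      unfolding sum_pairs_4 flux_cycle[OF wf g(1) e] flux_cycle[OF wf g(2) e]
      by (cases "g = Some e"; cases "h = Some e") (simp_all add: local_term_def algebra_simps)
  qed
  have "(\<Sum>e\<in>crossings D. ?d g h e) = corner D h g"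
    if "g \<in> insert None (Some ` crossings D)" for g h
  proof (cases g)
    case (Some c)
    then have "c \<in> crossings D" using that by auto
    then have "(\<Sum>e\<in>crossings D. ?d g h e) = (\<Sum>e\<in>{c}. ?d g h e)"
      using Some by (intro sum.mono_neutral_right) (auto simp: finite_crossings)
    then show ?thesis using Some by simp
  qed simp
  then have corners: "(\<Sum>e\<in>crossings D. ?d g h e) = corner D h g"
    "(\<Sum>e\<in>crossings D. ?d h g e) = corner D g h"
    using g by blast+
  have "(\<Sum>e\<in>crossings D. 2 * local_term D g h e + ?d g h e - ?d h g e) =
    2 * (\<Sum>e\<in>crossings D. local_term D g h e) + corner D h g - corner D g h"
    by (simp only: corners sum.distrib sum_subtractf sum_distrib_left)
  then have tot:
    "(\<Sum>e\<in>crossings D. \<Sum>j<4. \<Sum>i<j. flux D (cycle_of D g) e ! i * flux D (cycle_of D h) e ! j -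
      flux D (cycle_of D g) e ! j * flux D (cycle_of D h) e ! i) =
    2 * (\<Sum>e\<in>crossings D. local_term D g h e) + corner D h g - corner D g h"
    using sum.cong[OF refl loc, of "crossings D"] by simp
  have "even (2 * (\<Sum>e\<in>crossings D. local_term D g h e) + corner D h g - corner D g h)"
    using even_corner[OF wf g] by presburger
  then show ?thesis unfolding cycle_product_def intersection_number_def tot by presburger
qed

lemma cycle_product_skew:
  assumes "wf_diagram D" "g \<in> insert None (Some ` crossings D)"
    "h \<in> insert None (Some ` crossings D)"
  shows "cycle_product D h g = - cycle_product D g h"
proof -
  have "local_term D h g e = - local_term D g h e" for e by (simp add: local_term_def)
  then have "2 * cycle_product D h g = - (2 * cycle_product D g h)"
    unfolding twice_cycle_product[OF assms] twice_cycle_product[OF assms(1,3,2)]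
      by (simp add: sum_negf)
  then show ?thesis by simp
qed

lemma cycle_product_eqI:
  assumes "wf_diagram D" "g \<in> insert None (Some ` crossings D)"
    "h \<in> insert None (Some ` crossings D)"
    and "wf_diagram D'" "g' \<in> insert None (Some ` crossings D')"
      "h' \<in> insert None (Some ` crossings D')"
    and "2 * (\<Sum>e\<in>crossings D'. local_term D' g' h' e) + corner D' h' g' - corner D' g' h' =
      2 * (\<Sum>e\<in>crossings D. local_term D g h e) + corner D h g - corner D g h"
  shows "cycle_product D' g' h' = cycle_product D g h"
  using assms(7) twice_cycle_product[OF assms(1-3)] twice_cycle_product[OF assms(4-6)] by simp

section \<open>First and second moves\<close>

lemma opposite_neq [simp]: "opposite \<sigma> \<noteq> \<sigma>"
  "\<sigma> \<noteq> opposite \<sigma>"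
  by (cases \<sigma>; simp)+

lemma strand_cases: "\<tau> = \<sigma> \<or> \<tau> = opposite \<sigma>"
  by (cases \<sigma>; cases \<tau>) simp_all

declare arcs.simps(2) [simp del]

lemma between_strict_mono:
  "strict_mono s \<Longrightarrow> between (s p) (s l) (s q) \<longleftrightarrow> between p l q"
  by (simp add: between_def strict_mono_less)

text \<open>No end of the arc lies at the two neighbouring positions, so the arc covers both or
  neither. Geometrically, a foreign half follows the short edge between two passages.\<close>

lemma between_adjacent:
  "p \<noteq> i \<Longrightarrow> p \<noteq> Suc i \<Longrightarrow> q \<noteq> i
    \<Longrightarrow> q \<noteq> Suc i \<Longrightarrow> between p (Suc i) q \<longleftrightarrow> between p i q"
  by (auto simp: between_def)

text \<open>The crossings of a bigon have their passages at i, j' and at i + 1, j''. The first two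
  facts say that their halves are complementary outside the bigon, for the two choices of the strand
  at i. The other four say that each half has at the other crossing the multiplicity found with the
  roles exchanged.\<close>

lemma between_bigon:
  assumes "Suc i < j" "j' = j \<and> j'' = Suc j \<or> j'' = j \<and> j' = Suc j"
  shows "l \<noteq> i \<Longrightarrow> l \<noteq> Suc i \<Longrightarrow> l \<noteq> j
    \<Longrightarrow> l \<noteq> Suc j \<Longrightarrow> between j'' l (Suc i) \<longleftrightarrow> \<not> between i l j'"
    "l \<noteq> i \<Longrightarrow> l \<noteq> Suc i \<Longrightarrow> l \<noteq> j
      \<Longrightarrow> l \<noteq> Suc j \<Longrightarrow> between (Suc i) l j'' \<longleftrightarrow> \<not> between j' l i"
    "between i (Suc i) j' \<longleftrightarrow> between j'' i (Suc i)"
    "between i j'' j' \<longleftrightarrow> between j'' j' (Suc i)"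
    "between j' j'' i \<longleftrightarrow> between (Suc i) j' j''"
    "between j' (Suc i) i \<longleftrightarrow> between (Suc i) i j''"
  using assms unfolding between_def by arith+

text \<open>Inserting letters shifts positions by a strictly increasing map, which preserves the
  cyclic order.\<close>

lemma arcs_inserted:
  assumes "\<And>l. fst l \<in> crossings D \<Longrightarrow> position D' l = s (position D l)"
    "strict_mono s"
    and "g \<in> insert None (Some ` crossings D)" "fst l \<in> crossings D"
  shows "arcs D' g l = arcs D g l"
proof (cases g)
  case (Some c)
  then have "c \<in> crossings D" using assms(3) by auto
  then show ?thesis using Some assms between_strict_mono[OF assms(2)] by (simp add: arcs.simps(2))
qed simp

lemma corner_cong:
  assumes "\<And>c \<sigma>. g = Some c \<Longrightarrow> arcs D' h (c, \<sigma>)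
    = arcs D h (c, \<sigma>)"
  shows "corner D' h g = corner D h g"
  using assms by (cases g) (simp_all del: arcs.simps)

text \<open>Old crossings keep their local and corner terms, so only the local terms at the new
  crossings have to cancel.\<close>

lemma cycle_product_inserted:
  assumes wf: "wf_diagram D" "wf_diagram D'"
    and pos: "\<And>l. fst l \<in> crossings D \<Longrightarrow> position D' l = s (position D l)"
      "strict_mono s"
    and N: "crossings D' = N \<union> crossings D" "N \<inter> crossings D = {}"
    and g: "g \<in> insert None (Some ` crossings D)" "h \<in> insert None (Some ` crossings D)"
    and new: "(\<Sum>e\<in>N. local_term D' g h e) = 0"
  shows "cycle_product D' g h = cycle_product D g h"
proof (rule cycle_product_eqI)
  have g': "g \<in> insert None (Some ` crossings D')" "h \<in> insert None (Some ` crossings D')"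
    using g N(1) by auto
  then show "g \<in> insert None (Some ` crossings D')"
    "h \<in> insert None (Some ` crossings D')" .
  note arcs = arcs_inserted[OF pos]
  have "(\<Sum>e\<in>crossings D'. local_term D' g h e) = (\<Sum>e\<in>crossings D. local_term D' g h e)"
    unfolding N(1) using new N(2) finite_crossings[of D'] N(1)
    by (subst sum.union_disjoint) (auto simp: finite_crossings)
  also have "\<dots> = (\<Sum>e\<in>crossings D. local_term D g h e)"
    by (rule sum.cong) (use g arcs in \<open>simp_all add: local_term_def\<close>)
  finally have
    "(\<Sum>e\<in>crossings D'. local_term D' g h e) = (\<Sum>e\<in>crossings D. local_term D g h e)" .
  moreover have "corner D' h g = corner D h g" "corner D' g h = corner D g h"
    using g by (auto intro!: corner_cong arcs)
  ultimately show
    "2 * (\<Sum>e\<in>crossings D'. local_term D' g h e) + corner D' h g - corner D' g h =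
      2 * (\<Sum>e\<in>crossings D. local_term D g h e) + corner D h g - corner D g h" by simp
qed (use wf g in auto)

section \<open>First moves\<close>

lemma move1_positions:
  assumes "move1 D D' c"
  obtains \<sigma> i
    where "wf_diagram D" "wf_diagram D'" "c \<notin> crossings D"
    "crossings D' = insert c (crossings D)"
    "position D' (c, \<sigma>) = i" "position D' (c, opposite \<sigma>) = Suc i"
    "\<forall>l. fst l \<in> crossings D \<longrightarrow>
      position D' l = (if position D l < i then position D l else position D l + 2)"
proof -
  obtain \<sigma> u v where wf: "wf_diagram D" "wf_diagram D'" and w: "word D = u @ v"
    and w': "word D' = u @ [(c, \<sigma>), (c, opposite \<sigma>)] @ v"
    using assms unfolding move1_def by blast
  have dist: "(c, \<sigma>) \<notin> set u" "(c, \<sigma>) \<notin> set v"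
    "(c, opposite \<sigma>) \<notin> set u" "(c, opposite \<sigma>) \<notin> set v"
    using wf(2) w' by (auto simp: wf_diagram_def)
  have c: "c \<notin> crossings D"
  proof
    assume "c \<in> crossings D"
    then obtain \<tau> where "(c, \<tau>) \<in> set (word D)" by (auto simp: crossings_def)
    then show False using dist w strand_cases[of \<tau> \<sigma>] by auto
  qed
  have cr: "crossings D' = insert c (crossings D)" by (auto simp: crossings_def w w')
  have in': "(c, \<tau>) \<in> set (word D')" for \<tau> using wf(2) cr
    by (simp add: wf_diagram_passage)
  have 1: "position D' (c, \<sigma>) = length u"
    "position D' (c, opposite \<sigma>) = Suc (length u)"
    unfolding position_eq_idx[OF wf(2) in'] unfolding w' using dist by (simp_all add: idx_append)
  have 2: "position D' l = (if position D l < length u then position D l else position D l + 2)"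
    if l: "fst l \<in> crossings D" for l
  proof -
    have lw: "l \<in> set (word D)" "l \<in> set (word D')" using l wf cr
      by (simp_all add: wf_diagram_passage)
    have ne: "l \<noteq> (c, \<sigma>)" "l \<noteq> (c, opposite \<sigma>)" using l c by auto
    show ?thesis
      unfolding position_eq_idx[OF wf(1) lw(1)] position_eq_idx[OF wf(2) lw(2)] unfolding w w'
      using ne idx_less[of l u] by (auto simp: idx_append)
  qed
  show thesis by (rule that[OF wf c cr 1]) (use 2 in blast)
qed

lemma strict_mono_insert_2: "strict_mono (\<lambda>i. if i < k then i else i + (2::nat))"
  by (auto simp: strict_mono_def)

text \<open>The left half at the kink is either the kink alone or the whole curve without it,
  according to which strand comes first.\<close>

lemma move1_cycle_product:
  assumes "move1 D D' c"
  shows "c \<notin> crossings D" "crossings D' = insert c (crossings D)"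
    "\<And>g h. g \<in> insert None (Some ` crossings D) \<Longrightarrow> h \<in> insert None (Some ` crossings D) \<Longrightarrow>
      cycle_product D' g h = cycle_product D g h"
    "(\<forall>h\<in>insert None (Some ` crossings D'). cycle_product D' (Some c) h = 0) \<or>
     (\<forall>h\<in>insert None (Some ` crossings D'). cycle_product D' (Some c) h = cycle_product D' None h)"
proof -
  obtain \<sigma> i where wf: "wf_diagram D" "wf_diagram D'" and c: "c \<notin> crossings D"
    and cr: "crossings D' = insert c (crossings D)"
    and p: "position D' (c, \<sigma>) = i" "position D' (c, opposite \<sigma>) = Suc i"
    and pos': "\<forall>l. fst l \<in> crossings D \<longrightarrow>
      position D' l = (if position D l < i then position D l else position D l + 2)"
    by (rule move1_positions[OF assms]) (rule that)
  note pos = pos'[rule_format]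
  show "c \<notin> crossings D" "crossings D' = insert c (crossings D)" by (fact c cr)+
  have ne: "position D' l \<noteq> i" "position D' l \<noteq> Suc i" if "fst l \<in> crossings D"
    for l
    using pos[OF that] by auto
  \<comment> \<open>Both passages of the kink look the same to an old cycle, so the determinant at
    \<open>c\<close> vanishes.\<close>
  have adj: "arcs D' g (c, \<tau>) = arcs D' g (c, \<tau>')"
    if g: "g \<in> insert None (Some ` crossings D)" for g \<tau> \<tau>'
  proof (cases g)
    case (Some d)
    then have "d \<in> crossings D" using g by auto
    then have "arcs D' g (c, opposite \<sigma>) = arcs D' g (c, \<sigma>)"
      using Some p ne between_adjacent by (simp add: arcs.simps(2))
    then show ?thesis using strand_cases[of \<tau> \<sigma>] strand_cases[of \<tau>' \<sigma>]
      by auto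
  qed simp
  show old: "cycle_product D' g h = cycle_product D g h"
    if g: "g \<in> insert None (Some ` crossings D)" "h \<in> insert None (Some ` crossings D)"
      for g h
    by (rule cycle_product_inserted[OF wf pos strict_mono_insert_2, of "{c}"])
      (use cr c g adj[OF g(1), of Rightward Leftward] adj[OF g(2), of Rightward Leftward] in
        \<open>simp_all add: local_term_def\<close>)
  have self: "arcs D' (Some c) (c, \<tau>) = 0" for \<tau> by (rule arcs_self)
  have cself: "corner D' g (Some c) = 0" if "g \<in> insert None (Some ` crossings D')" for g
  proof (cases "g = Some c")
    case False
    then have "g \<in> insert None (Some ` crossings D)" using that cr by auto
    then show ?thesis using adj[of g Leftward Rightward] by simp
  qed (simp add: self)
  have cc: "Some c \<in> insert None (Some ` crossings D')" using cr by simp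
  have fin: "finite (crossings D)" by (rule finite_crossings)
  \<comment> \<open>The factor k is 0 or 1; both cases are handled together.\<close>
  have new: "cycle_product D' (Some c) h = k * cycle_product D' None h"
    if k: "\<And>l. fst l \<in> crossings D \<Longrightarrow> arcs D' (Some c) l = k"
      and h: "h \<in> insert None (Some ` crossings D')" for k h
  proof (cases "h = Some c")
    case True
    have "cycle_product D' (Some c) (Some c) = 0"
      using cycle_product_skew[OF wf(2) cc cc] by simp
    moreover have "2 * cycle_product D' None (Some c) = 0"
      unfolding twice_cycle_product[OF wf(2) insertI1 cc] cr
      using c fin k self by (simp add: local_term_def)
    ultimately show ?thesis using True by simp
  next
    case False
    then have h': "h \<in> insert None (Some ` crossings D)" using h cr by auto
    have ch: "corner D' (Some c) h = 0"
      using h' k by (cases h) auto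
    have "(\<Sum>e\<in>crossings D. local_term D' (Some c) h e)
      = k * (\<Sum>e\<in>crossings D. local_term D' None h e)"
      unfolding sum_distrib_left
      by (rule sum.cong) (simp_all add: local_term_def k algebra_simps)
    moreover have "local_term D' (Some c) h c = 0" "local_term D' None h c = 0"
      using adj[OF h', of Rightward Leftward] self by (simp_all add: local_term_def)
    moreover have "corner D' None h = 0" by (cases h) simp_all
    ultimately have "2 * cycle_product D' (Some c) h = k * (2 * cycle_product D' None h)"
      unfolding twice_cycle_product[OF wf(2) cc h] twice_cycle_product[OF wf(2) insertI1 h] cr
      using c fin cself[OF h] ch by simp
    then show ?thesis by simp
  qed
  show "(\<forall>h\<in>insert None (Some ` crossings D'). cycle_product D' (Some c) h = 0) \<or>
     (\<forall>h\<in>insert None (Some ` crossings D'). cycle_product D' (Some c) h = cycle_product D' None h)"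
  \<comment> \<open>The half starts at the \<open>Leftward\<close> passage. If that is the second of
    the two it runs round the whole code (factor 1), otherwise it ends at once (factor 0).\<close>
  proof (cases \<sigma>)
    case Rightward
    then have "arcs D' (Some c) l = 1" if "fst l \<in> crossings D" for l
      using p ne[OF that] by (auto simp: between_def arcs.simps(2))
    from new[OF this] show ?thesis by simp
  next
    case Leftward
    then have "arcs D' (Some c) l = 0" if "fst l \<in> crossings D" for l
      using p ne[OF that] by (auto simp: between_def arcs.simps(2))
    from new[OF this] show ?thesis by simp
  qed
qed

section \<open>Second moves\<close>

lemma move2_positions:
  assumes "move2 D D' c d"
  obtains \<sigma> i j
    where "wf_diagram D" "wf_diagram D'" "c \<noteq> d" "c \<notin> crossings D"
    "d \<notin> crossings D"
    "crossings D' = insert c (insert d (crossings D))" "Suc i < j"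
    "position D' (c, \<sigma>) = i" "position D' (d, opposite \<sigma>) = Suc i"
    "position D' (c, opposite \<sigma>) = j \<and> position D' (d, \<sigma>) = Suc j \<or>
     position D' (d, \<sigma>) = j \<and> position D' (c, opposite \<sigma>) = Suc j"
    "\<forall>l. fst l \<in> crossings D \<longrightarrow> position D' l
      = (if position D l < i then position D l
      else if position D l + 2 < j then position D l + 2 else position D l + 4)"
proof -
  obtain \<sigma> u v w s where wf: "wf_diagram D" "wf_diagram D'" and w: "word D = u @ v @ w"
    and w': "word D' = u @ [(c, \<sigma>), (d, opposite \<sigma>)] @ v @ s @ w"
    and s: "s = [(c, opposite \<sigma>), (d, \<sigma>)] \<or> s
      = [(d, \<sigma>), (c, opposite \<sigma>)]"
    using assms unfolding move2_def by blast
  have dist: "distinct (word D')" using wf(2) by (simp add: wf_diagram_def)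
  then have cd: "c \<noteq> d" using s unfolding w' by auto
  have old: "(c, \<tau>) \<notin> set u \<union> set v \<union> set w"
    "(d, \<tau>) \<notin> set u \<union> set v \<union> set w" for \<tau>
    using dist s strand_cases[of \<tau> \<sigma>] unfolding w' by auto
  have c: "c \<notin> crossings D" "d \<notin> crossings D"
    using old by (auto simp: crossings_def w)
  have cr: "crossings D' = insert c (insert d (crossings D))"
    using s by (auto simp: crossings_def w w')
  have in': "(c, \<tau>) \<in> set (word D')" "(d, \<tau>) \<in> set (word D')" for \<tau>
    using wf(2) cr by (simp_all add: wf_diagram_passage)
  \<comment> \<open>Both are positions in the longer code. In the old one the second insertion point
    is \<open>?j - 2\<close>, hence the test on \<open>position D l + 2\<close> below.\<close>
  let ?i = "length u" and ?j = "length u + 2 + length v"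
  have 1: "position D' (c, \<sigma>) = ?i" "position D' (d, opposite \<sigma>) = Suc ?i"
    unfolding position_eq_idx[OF wf(2) in'(1)] position_eq_idx[OF wf(2) in'(2)] unfolding w'
    using old cd by (simp_all add: idx_append)
  have 2: "position D' (c, opposite \<sigma>) = ?j \<and> position D' (d, \<sigma>) = Suc ?j \<or>
     position D' (d, \<sigma>) = ?j \<and> position D' (c, opposite \<sigma>) = Suc ?j"
    unfolding position_eq_idx[OF wf(2) in'(1)] position_eq_idx[OF wf(2) in'(2)] unfolding w'
    using s old cd by (auto simp: idx_append)
  have 3: "position D' l = (if position D l < ?i then position D l
      else if position D l + 2 < ?j then position D l + 2 else position D l + 4)"
    if l: "fst l \<in> crossings D" for l
  proof -
    have lw: "l \<in> set (word D)" "l \<in> set (word D')" using l wf cr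
      by (simp_all add: wf_diagram_passage)
    have ne: "l \<noteq> (c, \<tau>)" "l \<noteq> (d, \<tau>)" for \<tau> using l c by auto
    then have "l \<notin> set s" using s by auto
    moreover have "length s = 2" using s by auto
    ultimately show ?thesis
      unfolding position_eq_idx[OF wf(1) lw(1)] position_eq_idx[OF wf(2) lw(2)] unfolding w w'
      using ne idx_less[of l u] idx_less[of l v] by (auto simp: idx_append)
  qed
  show thesis by (rule that[OF wf cd c cr _ 1 2]) (use 3 in simp_all)
qed

lemma strict_mono_insert_2_2:
  "strict_mono (\<lambda>l. if l < i then l else if l + 2 < j then l + 2 else l + (4::nat))"
  by (auto simp: strict_mono_def)

text \<open>Outside the bigon the two left halves make up the whole curve; what happens at
  \<open>c\<close> and \<open>d\<close> themselves cancels.\<close>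

lemma move2_cycle_product:
  assumes "move2 D D' c d"
  shows "c \<noteq> d" "c \<notin> crossings D" "d \<notin> crossings D"
    "crossings D' = insert c (insert d (crossings D))"
    "\<And>g h. g \<in> insert None (Some ` crossings D) \<Longrightarrow> h \<in> insert None (Some ` crossings D) \<Longrightarrow>
      cycle_product D' g h = cycle_product D g h"
    "\<And>h. h \<in> insert None (Some ` crossings D') \<Longrightarrow>
      cycle_product D' (Some c) h + cycle_product D' (Some d) h = cycle_product D' None h"
proof -
  obtain \<sigma> i j where wf: "wf_diagram D" "wf_diagram D'" and cd: "c \<noteq> d"
    and c: "c \<notin> crossings D" "d \<notin> crossings D"
    and cr: "crossings D' = insert c (insert d (crossings D))" and ij: "Suc i < j"
    and p: "position D' (c, \<sigma>) = i" "position D' (d, opposite \<sigma>) = Suc i"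
    and q: "position D' (c, opposite \<sigma>) = j \<and> position D' (d, \<sigma>) = Suc j \<or>
     position D' (d, \<sigma>) = j \<and> position D' (c, opposite \<sigma>) = Suc j"
    and pos':
      "\<forall>l. fst l \<in> crossings D \<longrightarrow> position D' l
      = (if position D l < i then position D l
      else if position D l + 2 < j then position D l + 2 else position D l + 4)"
    by (rule move2_positions[OF assms]) (rule that)
  note pos = pos'[rule_format]
  show "c \<noteq> d" "c \<notin> crossings D" "d \<notin> crossings D"
    "crossings D' = insert c (insert d (crossings D))" by (fact cd c cr)+
  have ne: "position D' l \<noteq> i" "position D' l \<noteq> Suc i" "position D' l \<noteq> j"
    "position D' l \<noteq> Suc j"
    if "fst l \<in> crossings D" for l
    using pos[OF that] ij by auto
  \<comment> \<open>Neighbouring passages of \<open>c\<close> and \<open>d\<close> on one side of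
    the bigon carry opposite strand labels. So left and right are exchanged between the crossings,
    and for old cycles the two determinants cancel.\<close>
  have adj: "arcs D' g (d, opposite \<tau>) = arcs D' g (c, \<tau>)"
    if g: "g \<in> insert None (Some ` crossings D)" for g \<tau>
  proof (cases g)
    case (Some k)
    then have "k \<in> crossings D" using g by auto
    then have n: "position D' (k, \<tau>) \<noteq> i" "position D' (k, \<tau>) \<noteq> Suc i"
      "position D' (k, \<tau>) \<noteq> j" "position D' (k, \<tau>) \<noteq> Suc j" for \<tau>
      using ne by simp_all
    have "arcs D' g (d, opposite \<sigma>) = arcs D' g (c, \<sigma>)"
      using Some p between_adjacent[OF n(1,2) n(1,2)] by (simp add: arcs.simps(2))
    moreover have "arcs D' g (d, \<sigma>) = arcs D' g (c, opposite \<sigma>)"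
      using q
    proof
      assume "position D' (c, opposite \<sigma>) = j \<and> position D' (d, \<sigma>) = Suc j"
      then show ?thesis using Some between_adjacent[OF n(3,4) n(3,4)] by (simp add: arcs.simps(2))
    next
      assume "position D' (d, \<sigma>) = j \<and> position D' (c, opposite \<sigma>) = Suc j"
      then show ?thesis using Some between_adjacent[OF n(3,4) n(3,4)] by (simp add: arcs.simps(2))
    qed
    moreover have "opposite (opposite \<sigma>) = \<sigma>" by (cases \<sigma>) simp_all
    ultimately show ?thesis using strand_cases[of \<tau> \<sigma>] by auto
  qed simp
  have adjR: "arcs D' g (d, Leftward) = arcs D' g (c, Rightward)"
    "arcs D' g (d, Rightward) = arcs D' g (c, Leftward)"
    if "g \<in> insert None (Some ` crossings D)" for g
    using adj[OF that, of Rightward] adj[OF that, of Leftward] by simp_all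
  show old: "cycle_product D' g h = cycle_product D g h"
    if g: "g \<in> insert None (Some ` crossings D)" "h \<in> insert None (Some ` crossings D)"
      for g h
  proof (rule cycle_product_inserted[OF wf pos strict_mono_insert_2_2, of "{c, d}"])
    show "(\<Sum>e\<in>{c, d}. local_term D' g h e) = 0"
      using cd adjR[OF g(1)] adjR[OF g(2)] by (simp add: local_term_def)
  qed (use cr c g in auto)
  let ?C = "arcs D' (Some c)" and ?D = "arcs D' (Some d)"
  have self: "?C (c, \<tau>) = 0" "?D (d, \<tau>) = 0" for \<tau> by (rule arcs_self)+
  note big = between_bigon[OF ij q]
  have sum1: "?C l + ?D l = 1" if "fst l \<in> crossings D" for l
    using big(1,2)[OF ne[OF that]] p by (cases \<sigma>) (simp_all add: arcs.simps(2))
  have cross: "?C (d, Rightward) = ?D (c, Leftward)" "?C (d, Leftward) = ?D (c, Rightward)"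
    using big(3-6) p by (cases \<sigma>; simp add: arcs.simps(2))+
  have cc: "Some c \<in> insert None (Some ` crossings D')"
    "Some d \<in> insert None (Some ` crossings D')" using cr by simp_all
  have fin: "finite (crossings D)" by (rule finite_crossings)
  \<comment> \<open>The column of \<open>d\<close> is left out here; it follows from the others by
    skew symmetry.\<close>
  have main:
    "2 * cycle_product D' (Some c) h + 2 * cycle_product D' (Some d) h
    = 2 * cycle_product D' None h"
    if h: "h \<in> insert None (Some ` crossings D')" and hd: "h \<noteq> Some d" for h
  proof -
    have sums:
      "(\<Sum>e\<in>crossings D. local_term D' (Some c) h e) + (\<Sum>e\<in>crossings D. local_term D' (Some d) h e) =
        (\<Sum>e\<in>crossings D. local_term D' None h e)"
      unfolding sum.distrib[symmetric]
    proof (rule sum.cong)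
      fix e assume e: "e \<in> crossings D"
      have D: "?D (e, \<tau>) = 1 - ?C (e, \<tau>)" for \<tau> using sum1[of "(e, \<tau>)"] e
        by simp
      show "local_term D' (Some c) h e + local_term D' (Some d) h e = local_term D' None h e"
        unfolding local_term_def D by (simp add: algebra_simps)
    qed simp
    have N: "corner D' None h = 0" by (cases h) simp_all
    have "2 * ((\<Sum>e\<in>{c, d}. local_term D' (Some c) h e)
      + (\<Sum>e\<in>{c, d}. local_term D' (Some d) h e)
          - (\<Sum>e\<in>{c, d}. local_term D' None h e)) +
        corner D' h (Some c) + corner D' h (Some d) - corner D' (Some c) h - corner D' (Some d) h = 0"
    proof (cases "h = Some c")
      case True
      then show ?thesis using cd cross self by (simp add: local_term_def)
    next
      case False
      then have h': "h \<in> insert None (Some ` crossings D)" using h hd cr by auto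
      have "corner D' (Some c) h + corner D' (Some d) h = 0"
      proof (cases h)
        case (Some k)
        then have "k \<in> crossings D" using h' by auto
        then show ?thesis using Some sum1[of "(k, Leftward)"] sum1[of "(k, Rightward)"]
          by simp
      qed simp
      moreover have "corner D' h (Some c) + corner D' h (Some d) = 0"
        using adjR[OF h'] by simp
      moreover have
        "(\<Sum>e\<in>{c, d}. local_term D' (Some c) h e) + (\<Sum>e\<in>{c, d}. local_term D' (Some d) h e)
          - (\<Sum>e\<in>{c, d}. local_term D' None h e) = 0"
        using cd cross self adjR[OF h'] by (simp add: local_term_def algebra_simps)
      ultimately show ?thesis by simp
    qed
    then show ?thesis
      unfolding twice_cycle_product[OF wf(2) cc(1) h] twice_cycle_product[OF wf(2) cc(2) h]
        twice_cycle_product[OF wf(2) insertI1 h] cr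
      using c cd fin sums N by simp 
  qed
  show "cycle_product D' (Some c) h + cycle_product D' (Some d) h = cycle_product D' None h"
    if h: "h \<in> insert None (Some ` crossings D')" for h
  proof (cases "h = Some d")
    case True
    \<comment> \<open>Write s for the whole curve. The column of c gives d.c = s.c, and that of s
      gives c.s = - d.s; by skew symmetry c.d = c.s = s.d, while d.d = 0.\<close>
    have "cycle_product D' (Some d) (Some d) = 0"
      "cycle_product D' (Some c) (Some d) = - cycle_product D' (Some d) (Some c)"
      "cycle_product D' None (Some c) = - cycle_product D' (Some c) None"
      "cycle_product D' None (Some d) = - cycle_product D' (Some d) None"
      "cycle_product D' (Some c) (Some c) = 0" "cycle_product D' None None = 0"
      using cycle_product_skew[OF wf(2)] cc by (metis insertI1 add.inverse_inverse neg_equal_zero)+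
    then show ?thesis using main[OF cc(1)] main[of None] cd True by simp
  next
    case False
    then show ?thesis using main[OF h] by simp
  qed
qed

section \<open>Third moves\<close>

text \<open>Passages and order flags are independent parameters, so the code before the move, the
  code after it and both cyclic orders of the strands are instances.\<close>

definition triangle_word ::
  "bool \<Rightarrow> bool \<Rightarrow> bool \<Rightarrow> passage list \<Rightarrow> passage \<Rightarrow> passage \<Rightarrow> passage list \<Rightarrow> passage \<Rightarrow> passage \<Rightarrow>
    passage list \<Rightarrow> passage \<Rightarrow> passage \<Rightarrow> passage list \<Rightarrow> passage list" where
  "triangle_word e1 e2 e3 t p1 q1 u p2 q2 v p3 q3 w =
     t @ side e1 p1 q1 @ u @ side e2 p2 q2 @ v @ side e3 p3 q3 @ w"

lemma idx_side: "p \<noteq> q \<Longrightarrow> idx (side e p q) p = (if e then 0 else 1)"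
  "p \<noteq> q \<Longrightarrow> idx (side e p q) q = (if e then 1 else 0)"
  by (auto simp: side_def)

lemma set_side: "set (side e p q) = {p, q}"
  by (auto simp: side_def)

lemma length_side: "length (side e p q) = 2"
  by (auto simp: side_def)

lemma idx_triangle_word:
  assumes "distinct (triangle_word e1 e2 e3 t p1 q1 u p2 q2 v p3 q3 w)"
  defines "j \<equiv> length t + 2 + length u"
  defines "k \<equiv> j + 2 + length v"
  shows "distinct [p1, q1, p2, q2, p3, q3]"
    "idx (triangle_word e1 e2 e3 t p1 q1 u p2 q2 v p3 q3 w) p1
      = (if e1 then length t else Suc (length t))"
    "idx (triangle_word e1 e2 e3 t p1 q1 u p2 q2 v p3 q3 w) q1
      = (if e1 then Suc (length t) else length t)"
    "idx (triangle_word e1 e2 e3 t p1 q1 u p2 q2 v p3 q3 w) p2 = (if e2 then j else Suc j)"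
    "idx (triangle_word e1 e2 e3 t p1 q1 u p2 q2 v p3 q3 w) q2 = (if e2 then Suc j else j)"
    "idx (triangle_word e1 e2 e3 t p1 q1 u p2 q2 v p3 q3 w) p3 = (if e3 then k else Suc k)"
    "idx (triangle_word e1 e2 e3 t p1 q1 u p2 q2 v p3 q3 w) q3 = (if e3 then Suc k else k)"
proof -
  have d: "distinct (t @ [p1, q1] @ u @ [p2, q2] @ v @ [p3, q3] @ w)"
    using assms(1) by (cases e1; cases e2; cases e3) (auto simp: triangle_word_def side_def)
  then show "distinct [p1, q1, p2, q2, p3, q3]" by auto
  have n: "p1 \<notin> set t" "q1 \<notin> set t" "p2 \<notin> set t" "q2 \<notin> set t"
    "p3 \<notin> set t" "q3 \<notin> set t"
    "p2 \<notin> set u" "q2 \<notin> set u" "p3 \<notin> set u" "q3 \<notin> set u"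
      "p3 \<notin> set v" "q3 \<notin> set v"
    "p1 \<noteq> q1" "p2 \<noteq> q2" "p3 \<noteq> q3" "p2 \<notin> {p1, q1}" "q2 \<notin> {p1, q1}"
    "p3 \<notin> {p1, q1}" "q3 \<notin> {p1, q1}" "p3 \<notin> {p2, q2}" "q3 \<notin> {p2, q2}"
    using d by auto
  note s = triangle_word_def idx_append set_side length_side idx_side n j_def k_def
  show "idx (triangle_word e1 e2 e3 t p1 q1 u p2 q2 v p3 q3 w) p1
    = (if e1 then length t else Suc (length t))"
    "idx (triangle_word e1 e2 e3 t p1 q1 u p2 q2 v p3 q3 w) q1
      = (if e1 then Suc (length t) else length t)"
    by (simp_all add: s)
  show "idx (triangle_word e1 e2 e3 t p1 q1 u p2 q2 v p3 q3 w) p2 = (if e2 then j else Suc j)"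
    "idx (triangle_word e1 e2 e3 t p1 q1 u p2 q2 v p3 q3 w) q2 = (if e2 then Suc j else j)"
    using n by (simp_all add: s)
  show "idx (triangle_word e1 e2 e3 t p1 q1 u p2 q2 v p3 q3 w) p3 = (if e3 then k else Suc k)"
    "idx (triangle_word e1 e2 e3 t p1 q1 u p2 q2 v p3 q3 w) q3 = (if e3 then Suc k else k)"
    using n by (simp_all add: s)
qed

lemma idx_triangle_word_other:
  assumes "l \<notin> {p1, q1, p2, q2, p3, q3}"
    "l \<in> set (triangle_word e1 e2 e3 t p1 q1 u p2 q2 v p3 q3 w)"
  defines "j \<equiv> length t + 2 + length u"
  defines "k \<equiv> j + 2 + length v"
  shows "idx (triangle_word e1' e2' e3' t p1 q1 u p2 q2 v p3 q3 w) l =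
      idx (triangle_word e1 e2 e3 t p1 q1 u p2 q2 v p3 q3 w) l"
    "idx (triangle_word e1 e2 e3 t p1 q1 u p2 q2 v p3 q3 w) l \<notin>
      {length t, Suc (length t), j, Suc j, k, Suc k}"
  using assms(1,2) idx_less[of l t] idx_less[of l u] idx_less[of l v]
  by (auto simp: triangle_word_def idx_append set_side length_side j_def k_def)

text \<open>The side on the strand \<open>j\<close> occupies the positions \<open>i\<^sub>j\<close> and \<open>i\<^sub>j + 1\<close>, before and after the move.\<close>

definition triangle ::
  "bool \<Rightarrow> bool \<Rightarrow> bool \<Rightarrow> diagram \<Rightarrow> diagram \<Rightarrow> nat \<Rightarrow> nat \<Rightarrow> nat \<Rightarrow>
    nat \<Rightarrow> nat \<Rightarrow> nat \<Rightarrow> bool" where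
  "triangle d1 d2 d3 D D' x y z i1 i2 i3 \<longleftrightarrow>
     wf_diagram D \<and> wf_diagram D' \<and> crossings D' = crossings D \<and> distinct [x, y, z] \<and>
     x \<in> crossings D \<and> y \<in> crossings D \<and> z \<in> crossings D \<and>
     position D (z, opposite (dir d3 d1)) = (if d1 then i1 else Suc i1) \<and>
     position D (x, dir d1 d2) = (if d1 then Suc i1 else i1) \<and>
     position D (x, opposite (dir d1 d2)) = (if d2 then i2 else Suc i2) \<and>
     position D (y, dir d2 d3) = (if d2 then Suc i2 else i2) \<and>
     position D (y, opposite (dir d2 d3)) = (if d3 then i3 else Suc i3) \<and>
     position D (z, dir d3 d1) = (if d3 then Suc i3 else i3) \<and>
     position D' (z, opposite (dir d3 d1)) = (if d1 then Suc i1 else i1) \<and>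
     position D' (x, dir d1 d2) = (if d1 then i1 else Suc i1) \<and>
     position D' (x, opposite (dir d1 d2)) = (if d2 then Suc i2 else i2) \<and>
     position D' (y, dir d2 d3) = (if d2 then i2 else Suc i2) \<and>
     position D' (y, opposite (dir d2 d3)) = (if d3 then Suc i3 else i3) \<and>
     position D' (z, dir d3 d1) = (if d3 then i3 else Suc i3) \<and>
     (\<forall>l::passage. fst l \<in> crossings D - {x, y, z} \<longrightarrow>
        position D' l = position D l \<and> position D l \<notin> {i1, Suc i1, i2, Suc i2, i3, Suc i3})"

lemma distinct_swap_pairs:
  "distinct [a, b, e, f, c, d] \<Longrightarrow> distinct [a, b, c, d, e, f]"
  by auto

text \<open>The passages are anonymous slots here; only the second and third slot are exchanged
  between the two cyclic orders.\<close>

lemma triangle_word_positions: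
  assumes wf: "wf_diagram D" "wf_diagram D'"
    and w: "word D = triangle_word e1 e2 e3 t p1 q1 u p2 q2 v p3 q3 w"
      "word D' = triangle_word (\<not> e1) (\<not> e2) (\<not> e3) t p1 q1 u p2 q2 v p3 q3 w"
  shows "crossings D' = crossings D" "{p1, q1, p2, q2, p3, q3} \<subseteq> set (word D)"
    "distinct [p1, q1, p2, q2, p3, q3]"
    "\<exists>i j k. Suc i < j \<and> Suc j < k \<and>
      position D p1 = (if e1 then i else Suc i) \<and> position D q1 = (if e1 then Suc i else i) \<and>
      position D p2 = (if e2 then j else Suc j) \<and> position D q2 = (if e2 then Suc j else j) \<and>
      position D p3 = (if e3 then k else Suc k) \<and> position D q3 = (if e3 then Suc k else k) \<and>
      position D' p1 = (if e1 then Suc i else i) \<and> position D' q1 = (if e1 then i else Suc i) \<and>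
      position D' p2 = (if e2 then Suc j else j) \<and> position D' q2 = (if e2 then j else Suc j) \<and>
      position D' p3 = (if e3 then Suc k else k) \<and> position D' q3 = (if e3 then k else Suc k) \<and>
      (\<forall>l\<in>set (word D). l \<notin> {p1, q1, p2, q2, p3, q3} \<longrightarrow>
        position D' l = position D l \<and> position D l \<notin> {i, Suc i, j, Suc j, k, Suc k})"
proof -
  have sets: "set (word D') = set (word D)"
    and S: "{p1, q1, p2, q2, p3, q3} \<subseteq> set (word D)"
    by (auto simp: w triangle_word_def set_side)
  then show "crossings D' = crossings D" "{p1, q1, p2, q2, p3, q3} \<subseteq> set (word D)"
    by (simp_all add: crossings_def)
  have dist: "distinct (word D)" "distinct (word D')" using wf by (auto simp: wf_diagram_def)
  note I = idx_triangle_word[OF dist(1)[unfolded w]]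
    and I' = idx_triangle_word[OF dist(2)[unfolded w]]
  show "distinct [p1, q1, p2, q2, p3, q3]" by (rule I(1))
  have pos: "position D l = idx (triangle_word e1 e2 e3 t p1 q1 u p2 q2 v p3 q3 w) l"
    "position D' l = idx (triangle_word (\<not> e1) (\<not> e2) (\<not> e3) t p1 q1 u p2 q2 v p3 q3 w) l"
    if "l \<in> set (word D)" for l
    using position_eq_idx[OF wf(1)] position_eq_idx[OF wf(2)] sets that unfolding w by simp_all
  let ?i = "length t" and ?j = "length t + 2 + length u"
    and ?k = "length t + 2 + length u + 2 + length v"
  have mem: "p1 \<in> set (word D)" "q1 \<in> set (word D)" "p2 \<in> set (word D)"
    "q2 \<in> set (word D)"
    "p3 \<in> set (word D)" "q3 \<in> set (word D)" using S by auto
  have other: "\<forall>l\<in>set (word D). l \<notin> {p1, q1, p2, q2, p3, q3} \<longrightarrow>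
    position D' l = position D l \<and> position D l \<notin> {?i, Suc ?i, ?j, Suc ?j, ?k, Suc ?k}"
  proof (intro ballI impI)
    fix l assume l: "l \<in> set (word D)" "l \<notin> {p1, q1, p2, q2, p3, q3}"
    note O = idx_triangle_word_other[OF l(2) l(1)[unfolded w]]
    show "position D' l = position D l \<and> position D l \<notin> {?i, Suc ?i, ?j, Suc ?j, ?k, Suc ?k}"
      unfolding pos[OF l(1)] using O by blast
  qed
  show "\<exists>i j k. Suc i < j \<and> Suc j < k \<and>
      position D p1 = (if e1 then i else Suc i) \<and> position D q1 = (if e1 then Suc i else i) \<and>
      position D p2 = (if e2 then j else Suc j) \<and> position D q2 = (if e2 then Suc j else j) \<and>
      position D p3 = (if e3 then k else Suc k) \<and> position D q3 = (if e3 then Suc k else k) \<and>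
      position D' p1 = (if e1 then Suc i else i) \<and> position D' q1 = (if e1 then i else Suc i) \<and>
      position D' p2 = (if e2 then Suc j else j) \<and> position D' q2 = (if e2 then j else Suc j) \<and>
      position D' p3 = (if e3 then Suc k else k) \<and> position D' q3 = (if e3 then k else Suc k) \<and>
      (\<forall>l\<in>set (word D). l \<notin> {p1, q1, p2, q2, p3, q3} \<longrightarrow>
        position D' l = position D l \<and> position D l \<notin> {i, Suc i, j, Suc j, k, Suc k})"
    by (rule exI[of _ ?i], rule exI[of _ ?j], rule exI[of _ ?k], intro conjI other)
      (simp_all add: pos mem I I')
qed

lemma oriented_move3_triangle:
  assumes "oriented_move3 d1 d2 d3 D D' x y z"
  shows "\<exists>i1 i2 i3. triangle d1 d2 d3 D D' x y z i1 i2 i3 \<and>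
    (Suc i1 < i2 \<and> Suc i2 < i3 \<or> Suc i1 < i3 \<and> Suc i3 < i2)"
proof -
  define p1 q1 p2 q2 p3 q3 where pq: "p1 = (z, opposite (dir d3 d1))" "q1 = (x, dir d1 d2)"
    "p2 = (x, opposite (dir d1 d2))" "q2 = (y, dir d2 d3)"
    "p3 = (y, opposite (dir d2 d3))" "q3 = (z, dir d3 d1)"
  have wf: "wf_diagram D" "wf_diagram D'" using assms by (auto simp: oriented_move3_def)
  \<comment> \<open>A crossing has only two passages, so if two of the crossings coincided, two of
    the six passages would.\<close>
  have xyz: "distinct [x, y, z]" if "distinct [p1, q1, p2, q2, p3, q3]"
    using that unfolding pq by (cases "dir d1 d2"; cases "dir d2 d3"; cases "dir d3 d1") auto
  have mem: "x \<in> crossings D \<and> y \<in> crossings D \<and> z \<in> crossings D"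
    if "{p1, q1, p2, q2, p3, q3} \<subseteq> set (word D)"
    using that wf_diagram_passage[OF wf(1)] unfolding pq by auto
  have other: "\<forall>l::passage. fst l \<in> crossings D - {x, y, z} \<longrightarrow> R l"
    if "\<forall>l\<in>set (word D). l \<notin> {p1, q1, p2, q2, p3, q3} \<longrightarrow> R l"
      for R :: "passage \<Rightarrow> bool"
  proof (intro allI impI)
    fix l :: passage assume l: "fst l \<in> crossings D - {x, y, z}"
    then have "l \<in> set (word D)" "l \<notin> {p1, q1, p2, q2, p3, q3}"
      using wf_diagram_passage[OF wf(1)] unfolding pq by auto
    then show "R l" using that by blast
  qed
  obtain t u v w where W:
    "word D = triangle_word d1 d2 d3 t p1 q1 u p2 q2 v p3 q3 w \<and>
     word D' = triangle_word (\<not> d1) (\<not> d2) (\<not> d3) t p1 q1 u p2 q2 v p3 q3 w \<or>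
     word D = triangle_word d1 d3 d2 t p1 q1 u p3 q3 v p2 q2 w \<and>
     word D' = triangle_word (\<not> d1) (\<not> d3) (\<not> d2) t p1 q1 u p3 q3 v p2 q2 w"
    using assms unfolding oriented_move3_def triangle_word_def Let_def pq by blast
  then show ?thesis
  proof
    assume "word D = triangle_word d1 d2 d3 t p1 q1 u p2 q2 v p3 q3 w \<and>
     word D' = triangle_word (\<not> d1) (\<not> d2) (\<not> d3) t p1 q1 u p2 q2 v p3 q3 w"
    then have w: "word D = triangle_word d1 d2 d3 t p1 q1 u p2 q2 v p3 q3 w"
     "word D' = triangle_word (\<not> d1) (\<not> d2) (\<not> d3) t p1 q1 u p2 q2 v p3 q3 w"
       by simp_all
    note P = triangle_word_positions[OF wf w]
    obtain i1 i2 i3 where Q: "Suc i1 < i2 \<and> Suc i2 < i3 \<and>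
      position D p1 = (if d1 then i1 else Suc i1) \<and> position D q1 = (if d1 then Suc i1 else i1) \<and>
      position D p2 = (if d2 then i2 else Suc i2) \<and> position D q2 = (if d2 then Suc i2 else i2) \<and>
      position D p3 = (if d3 then i3 else Suc i3) \<and> position D q3 = (if d3 then Suc i3 else i3) \<and>
      position D' p1 = (if d1 then Suc i1 else i1) \<and> position D' q1 = (if d1 then i1 else Suc i1) \<and>
      position D' p2 = (if d2 then Suc i2 else i2) \<and> position D' q2 = (if d2 then i2 else Suc i2) \<and>
      position D' p3 = (if d3 then Suc i3 else i3) \<and> position D' q3 = (if d3 then i3 else Suc i3) \<and>
      (\<forall>l\<in>set (word D). l \<notin> {p1, q1, p2, q2, p3, q3} \<longrightarrow>
        position D' l = position D l \<and> position D l \<notin> {i1, Suc i1, i2, Suc i2, i3, Suc i3})"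
      using P(4) by blast
    then have "\<forall>l. fst l \<in> crossings D - {x, y, z} \<longrightarrow>
        position D' l = position D l \<and> position D l \<notin> {i1, Suc i1, i2, Suc i2, i3, Suc i3}"
      by (intro other) blast
    then have "triangle d1 d2 d3 D D' x y z i1 i2 i3"
      unfolding triangle_def pq[symmetric] using wf P(1) xyz[OF P(3)] mem[OF P(2)] Q by blast
    then show ?thesis using Q by blast
  next
    \<comment> \<open>Strand 3 comes before strand 2: the same facts with these slots exchanged,
      after reordering the sets of passages and positions.\<close>
    assume "word D = triangle_word d1 d3 d2 t p1 q1 u p3 q3 v p2 q2 w \<and>
     word D' = triangle_word (\<not> d1) (\<not> d3) (\<not> d2) t p1 q1 u p3 q3 v p2 q2 w"
    then have w: "word D = triangle_word d1 d3 d2 t p1 q1 u p3 q3 v p2 q2 w"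
     "word D' = triangle_word (\<not> d1) (\<not> d3) (\<not> d2) t p1 q1 u p3 q3 v p2 q2 w"
       by simp_all
    note P = triangle_word_positions[OF wf w]
    obtain i1 i3 i2 where Q: "Suc i1 < i3 \<and> Suc i3 < i2 \<and>
      position D p1 = (if d1 then i1 else Suc i1) \<and> position D q1 = (if d1 then Suc i1 else i1) \<and>
      position D p3 = (if d3 then i3 else Suc i3) \<and> position D q3 = (if d3 then Suc i3 else i3) \<and>
      position D p2 = (if d2 then i2 else Suc i2) \<and> position D q2 = (if d2 then Suc i2 else i2) \<and>
      position D' p1 = (if d1 then Suc i1 else i1) \<and> position D' q1 = (if d1 then i1 else Suc i1) \<and>
      position D' p3 = (if d3 then Suc i3 else i3) \<and> position D' q3 = (if d3 then i3 else Suc i3) \<and>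
      position D' p2 = (if d2 then Suc i2 else i2) \<and> position D' q2 = (if d2 then i2 else Suc i2) \<and>
      (\<forall>l\<in>set (word D). l \<notin> {p1, q1, p3, q3, p2, q2} \<longrightarrow>
        position D' l = position D l \<and> position D l \<notin> {i1, Suc i1, i3, Suc i3, i2, Suc i2})"
      using P(4) by blast
    have S: "{p1, q1, p3, q3, p2, q2} = {p1, q1, p2, q2, p3, q3}"
      "{i1, Suc i1, i3, Suc i3, i2, Suc i2} = {i1, Suc i1, i2, Suc i2, i3, Suc i3}" by blast+
    have "\<forall>l. fst l \<in> crossings D - {x, y, z} \<longrightarrow>
        position D' l = position D l \<and> position D l \<notin> {i1, Suc i1, i2, Suc i2, i3, Suc i3}"
      using Q unfolding S by (intro other) blast
    then have "triangle d1 d2 d3 D D' x y z i1 i2 i3"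
      unfolding triangle_def pq[symmetric]
      using wf P(1) xyz[OF distinct_swap_pairs[OF P(3)]] mem[OF P(2)[unfolded S]] Q by blast
    then show ?thesis using Q by blast
  qed
qed

text \<open>Seen from a position off both sides, it does not matter which of the two places of its
  side an end of the arc occupies. So halves of triangle crossings look alike before and after the
  move.\<close>

lemma between_coarse:
  assumes "p = i \<or> p = Suc i" "q = j \<or> q = Suc j" "Suc i < j \<or> Suc j < i"
    "l \<notin> {i, Suc i, j, Suc j}"
  shows "between p l q \<longleftrightarrow> between i l j"
  using assms unfolding between_def by auto

lemma arcs_pair:
  assumes "position D l = i \<or> position D l = Suc i"
    "position D l' = i \<or> position D l' = Suc i"
    and "\<And>\<tau>. position D (k, \<tau>) \<noteq> i"
      "\<And>\<tau>. position D (k, \<tau>) \<noteq> Suc i"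
  shows "arcs D (Some k) l = arcs D (Some k) l'"
  using assms between_adjacent[of "position D (k, Leftward)" i "position D (k, Rightward)"]
  by (auto simp: arcs.simps(2))

definition apart :: "nat \<Rightarrow> nat \<Rightarrow> nat \<Rightarrow> bool" where
  "apart i1 i2 i3 \<longleftrightarrow> Suc i1 < i2 \<and> Suc i2 < i3 \<or> Suc i1 < i3
    \<and> Suc i3 < i2"

section \<open>Multiplicities of the cycles at a triangle\<close>

lemma triangle_near:
  assumes tri: "triangle d1 d2 d3 D D' x y z i1 i2 i3" and E: "E = D \<or> E = D'"
  shows "position E (z, opposite (dir d3 d1)) = i1 \<or> position E (z, opposite (dir d3 d1))
    = Suc i1"
    "position E (x, dir d1 d2) = i1 \<or> position E (x, dir d1 d2) = Suc i1"
    "position E (x, opposite (dir d1 d2)) = i2 \<or> position E (x, opposite (dir d1 d2)) = Suc i2"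
    "position E (y, dir d2 d3) = i2 \<or> position E (y, dir d2 d3) = Suc i2"
    "position E (y, opposite (dir d2 d3)) = i3 \<or> position E (y, opposite (dir d2 d3)) = Suc i3"
    "position E (z, dir d3 d1) = i3 \<or> position E (z, dir d3 d1) = Suc i3"
  using tri E unfolding triangle_def by presburger+

text \<open>A cycle that does not turn at the triangle has one multiplicity on each of the three
  sides, and reversing the order on a side does not affect it.\<close>

lemma triangle_outer_arcs:
  assumes tri: "triangle d1 d2 d3 D D' x y z i1 i2 i3"
    and g: "g \<in> insert None (Some ` (crossings D - {x, y, z}))"
  shows "fst l \<in> crossings D - {x, y, z} \<Longrightarrow> arcs D' g l = arcs D g l"
    "arcs D g (x, dir d1 d2) = arcs D g (z, opposite (dir d3 d1))"
    "arcs D g (y, dir d2 d3) = arcs D g (x, opposite (dir d1 d2))"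
    "arcs D g (z, dir d3 d1) = arcs D g (y, opposite (dir d2 d3))"
    "arcs D' g (x, \<tau>) = arcs D g (x, \<tau>)" "arcs D' g (y, \<tau>) = arcs D g (y, \<tau>)"
    "arcs D' g (z, \<tau>) = arcs D g (z, \<tau>)"
proof -
  note T = tri[unfolded triangle_def]
  have "(fst l \<in> crossings D - {x, y, z} \<longrightarrow> arcs D' g l = arcs D g l) \<and>
    arcs D g (x, dir d1 d2) = arcs D g (z, opposite (dir d3 d1)) \<and>
    arcs D g (y, dir d2 d3) = arcs D g (x, opposite (dir d1 d2)) \<and>
    arcs D g (z, dir d3 d1) = arcs D g (y, opposite (dir d2 d3)) \<and>
    arcs D' g (x, \<tau>) = arcs D g (x, \<tau>) \<and> arcs D' g (y, \<tau>) = arcs D g (y, \<tau>) \<and>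
    arcs D' g (z, \<tau>) = arcs D g (z, \<tau>)"
  proof (cases g)
    case (Some k)
    then have "fst (k, \<upsilon>) \<in> crossings D - {x, y, z}" for \<upsilon> :: strand using g
      by auto
    then have k: "position D' (k, \<upsilon>) = position D (k, \<upsilon>)"
      "position D (k, \<upsilon>) \<notin> {i1, Suc i1, i2, Suc i2, i3, Suc i3}" for \<upsilon>
      using T by blast+
    then have n: "position D (k, \<upsilon>) \<noteq> i1"
      "position D (k, \<upsilon>) \<noteq> Suc i1" "position D (k, \<upsilon>) \<noteq> i2"
      "position D (k, \<upsilon>) \<noteq> Suc i2" "position D (k, \<upsilon>) \<noteq> i3"
        "position D (k, \<upsilon>) \<noteq> Suc i3" for \<upsilon>
      by auto
    have old: "arcs D' g l = arcs D g l" if "fst l \<in> crossings D - {x, y, z}"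
    proof -
      have "position D' l = position D l" using T that by blast
      then show ?thesis using Some k(1) by (simp add: arcs.simps(2))
    qed
    note W = triangle_near[OF tri disjI1[OF refl]] and W' = triangle_near[OF tri disjI2[OF refl]]
    have eq: "arcs D g (x, dir d1 d2) = arcs D g (z, opposite (dir d3 d1))"
      "arcs D g (y, dir d2 d3) = arcs D g (x, opposite (dir d1 d2))"
      "arcs D g (z, dir d3 d1) = arcs D g (y, opposite (dir d2 d3))"
      unfolding Some
      by (rule arcs_pair[OF W(2) W(1) n(1,2)], rule arcs_pair[OF W(4) W(3) n(3,4)],
          rule arcs_pair[OF W(6) W(5) n(5,6)])
    have new: "arcs D' g l = arcs D g l"
      if "position D l = i \<or> position D l = Suc i"
        "position D' l = i \<or> position D' l = Suc i"
        "i = i1 \<or> i = i2 \<or> i = i3" for l i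
    proof -
      have "position D (k, \<upsilon>) \<noteq> i" "position D (k, \<upsilon>) \<noteq> Suc i"
        for \<upsilon>
        using that(3) by (elim disjE; simp add: n)+
      from between_adjacent[OF this this] that(1,2) show ?thesis
        unfolding Some arcs.simps(2) k(1) by auto
    qed
    have "arcs D' g (x, dir d1 d2) = arcs D g (x, dir d1 d2)"
      "arcs D' g (z, opposite (dir d3 d1)) = arcs D g (z, opposite (dir d3 d1))"
      by (rule new[OF W(2) W'(2)], simp, rule new[OF W(1) W'(1)], simp)
    moreover have "arcs D' g (y, dir d2 d3) = arcs D g (y, dir d2 d3)"
      "arcs D' g (x, opposite (dir d1 d2)) = arcs D g (x, opposite (dir d1 d2))"
      by (rule new[OF W(4) W'(4)], simp, rule new[OF W(3) W'(3)], simp)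
    moreover have "arcs D' g (z, dir d3 d1) = arcs D g (z, dir d3 d1)"
      "arcs D' g (y, opposite (dir d2 d3)) = arcs D g (y, opposite (dir d2 d3))"
      by (rule new[OF W(6) W'(6)], simp, rule new[OF W(5) W'(5)], simp)
    ultimately show ?thesis
      using eq old strand_cases[of \<tau> "dir d1 d2"] strand_cases[of \<tau>
        "dir d2 d3"] strand_cases[of \<tau> "dir d3 d1"]
      by metis
  qed simp
  then show "fst l \<in> crossings D - {x, y, z} \<Longrightarrow> arcs D' g l = arcs D g l"
    "arcs D g (x, dir d1 d2) = arcs D g (z, opposite (dir d3 d1))"
    "arcs D g (y, dir d2 d3) = arcs D g (x, opposite (dir d1 d2))"
    "arcs D g (z, dir d3 d1) = arcs D g (y, opposite (dir d2 d3))"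
    "arcs D' g (x, \<tau>) = arcs D g (x, \<tau>)" "arcs D' g (y, \<tau>) = arcs D g (y, \<tau>)"
    "arcs D' g (z, \<tau>) = arcs D g (z, \<tau>)"
    by blast+
qed

lemma triangle_inner_arcs:
  assumes tri: "triangle d1 d2 d3 D D' x y z i1 i2 i3" and ap: "apart i1 i2 i3"
    and l: "fst l \<in> crossings D - {x, y, z}"
  shows "arcs D (Some x) l = of_bool (if d1 = d2 then between i2 (position D l) i1 else between i1 (position D l) i2)"
    "arcs D (Some y) l = of_bool (if d2 = d3 then between i3 (position D l) i2 else between i2 (position D l) i3)"
    "arcs D (Some z) l = of_bool (if d3 = d1 then between i1 (position D l) i3 else between i3 (position D l) i1)"
    "arcs D' (Some x) l = arcs D (Some x) l" "arcs D' (Some y) l = arcs D (Some y) l"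
    "arcs D' (Some z) l = arcs D (Some z) l"
proof -
  note T = tri[unfolded triangle_def]
  have pl: "position D' l = position D l"
    "position D l \<notin> {i1, Suc i1, i2, Suc i2, i3, Suc i3}"
    using T l by blast+
  have d: "Suc i1 < i2 \<or> Suc i2 < i1" "Suc i2 < i3 \<or> Suc i3 < i2"
    "Suc i1 < i3 \<or> Suc i3 < i1"
    using ap by (auto simp: apart_def)
  have X: "arcs E (Some x) l = of_bool (if d1 = d2 then between i2 (position D l) i1 else between i1 (position D l) i2)"
    if E: "E = D \<or> E = D'" for E
  proof -
    note W = triangle_near[OF tri E]
    have p: "position E l = position D l" using E pl(1) by blast
    show ?thesis
    proof (cases "d1 = d2")
      case True
      then have "dir d1 d2 = Rightward" by (simp add: dir_def)
      then have
        "between (position E (x, Leftward)) (position D l) (position E (x, Rightward)) \<longleftrightarrow>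
          between i2 (position D l) i1"
        using W(2,3) d(1) by (intro between_coarse) (use pl(2) in auto)
      then show ?thesis using True by (simp add: arcs.simps(2) p)
    next
      case False
      then have "dir d1 d2 = Leftward" by (simp add: dir_def)
      then have
        "between (position E (x, Leftward)) (position D l) (position E (x, Rightward)) \<longleftrightarrow>
          between i1 (position D l) i2"
        using W(2,3) d(1) by (intro between_coarse) (use pl(2) in auto)
      then show ?thesis using False by (simp add: arcs.simps(2) p)
    qed
  qed
  have Y: "arcs E (Some y) l = of_bool (if d2 = d3 then between i3 (position D l) i2 else between i2 (position D l) i3)"
    if E: "E = D \<or> E = D'" for E
  proof -
    note W = triangle_near[OF tri E]
    have p: "position E l = position D l" using E pl(1) by blast
    show ?thesis
    proof (cases "d2 = d3")
      case True
      then have "dir d2 d3 = Rightward" by (simp add: dir_def)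
      then have
        "between (position E (y, Leftward)) (position D l) (position E (y, Rightward)) \<longleftrightarrow>
          between i3 (position D l) i2"
        using W(4,5) d(2) by (intro between_coarse) (use pl(2) in auto)
      then show ?thesis using True by (simp add: arcs.simps(2) p)
    next
      case False
      then have "dir d2 d3 = Leftward" by (simp add: dir_def)
      then have
        "between (position E (y, Leftward)) (position D l) (position E (y, Rightward)) \<longleftrightarrow>
          between i2 (position D l) i3"
        using W(4,5) d(2) by (intro between_coarse) (use pl(2) in auto)
      then show ?thesis using False by (simp add: arcs.simps(2) p)
    qed
  qed
  have Z: "arcs E (Some z) l = of_bool (if d3 = d1 then between i1 (position D l) i3 else between i3 (position D l) i1)"
    if E: "E = D \<or> E = D'" for E
  proof -
    note W = triangle_near[OF tri E]
    have p: "position E l = position D l" using E pl(1) by blast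
    show ?thesis
    proof (cases "d3 = d1")
      case True
      then have "dir d3 d1 = Rightward" by (simp add: dir_def)
      then have
        "between (position E (z, Leftward)) (position D l) (position E (z, Rightward)) \<longleftrightarrow>
          between i1 (position D l) i3"
        using W(6,1) d(3) by (intro between_coarse) (use pl(2) in auto)
      then show ?thesis using True by (simp add: arcs.simps(2) p)
    next
      case False
      then have "dir d3 d1 = Leftward" by (simp add: dir_def)
      then have
        "between (position E (z, Leftward)) (position D l) (position E (z, Rightward)) \<longleftrightarrow>
          between i3 (position D l) i1"
        using W(6,1) d(3) by (intro between_coarse) (use pl(2) in auto)
      then show ?thesis using False by (simp add: arcs.simps(2) p)
    qed
  qed
  show "arcs D (Some x) l = of_bool (if d1 = d2 then between i2 (position D l) i1 else between i1 (position D l) i2)"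
    "arcs D (Some y) l = of_bool (if d2 = d3 then between i3 (position D l) i2 else between i2 (position D l) i3)"
    "arcs D (Some z) l = of_bool (if d3 = d1 then between i1 (position D l) i3 else between i3 (position D l) i1)"
    "arcs D' (Some x) l = arcs D (Some x) l" "arcs D' (Some y) l = arcs D (Some y) l"
    "arcs D' (Some z) l = arcs D (Some z) l"
    using X[of D] X[of D'] Y[of D] Y[of D'] Z[of D] Z[of D'] by simp_all
qed

text \<open>The flag \<open>s\<close> is true for the diagram before the move and false for the one after it. With it,
  a statement about one of the three crossings yields those about the others by rotation.\<close>

definition corner_positions ::
  "diagram \<Rightarrow> bool \<Rightarrow> bool \<Rightarrow> bool \<Rightarrow> bool \<Rightarrow> nat \<Rightarrow> nat \<Rightarrow> nat \<Rightarrow>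
    nat \<Rightarrow> nat \<Rightarrow> nat \<Rightarrow> bool" where
  "corner_positions E s d1 d2 d3 x y z i1 i2 i3 \<longleftrightarrow>
     position E (z, opposite (dir d3 d1)) = (if d1 = s then i1 else Suc i1) \<and>
     position E (x, dir d1 d2) = (if d1 = s then Suc i1 else i1) \<and>
     position E (x, opposite (dir d1 d2)) = (if d2 = s then i2 else Suc i2) \<and>
     position E (y, dir d2 d3) = (if d2 = s then Suc i2 else i2) \<and>
     position E (y, opposite (dir d2 d3)) = (if d3 = s then i3 else Suc i3) \<and>
     position E (z, dir d3 d1) = (if d3 = s then Suc i3 else i3)"

lemma triangle_corner_positions:
  assumes "triangle d1 d2 d3 D D' x y z i1 i2 i3"
  shows "corner_positions D True d1 d2 d3 x y z i1 i2 i3"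
    "corner_positions D' False d1 d2 d3 x y z i1 i2 i3"
  using assms unfolding corner_positions_def triangle_def by presburger+

lemma corner_positions_rotate:
  "corner_positions E s d1 d2 d3 x y z i1 i2 i3 \<Longrightarrow> corner_positions E s d2 d3 d1 y z x i2 i3 i1"
  unfolding corner_positions_def by blast

text \<open>Weaker than \<open>apart\<close>, which puts strand 1 first in the code, but invariant
  under permutations of the strands; the rotations below depend on that.\<close>

definition separate :: "nat \<Rightarrow> nat \<Rightarrow> nat \<Rightarrow> bool" where
  "separate i1 i2 i3 \<longleftrightarrow> (Suc i1 < i2 \<or> Suc i2 < i1) \<and> (Suc i2 < i3
    \<or> Suc i3 < i2) \<and> (Suc i3 < i1 \<or> Suc i1 < i3)"

lemma between_rotate: "between p l q \<longleftrightarrow> between l q p"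
  by (auto simp: between_def)

text \<open>Offsets by one matter only between the two places on the same side. Everything else is
  decided by \<open>between i2 i3 i1\<close>, the cyclic order in which the knot runs through the
  strands.\<close>

lemma separate_between:
  assumes "separate i1 i2 i3"
  shows "between i1 i3 i2 \<longleftrightarrow> \<not> between i2 i3 i1"
    "between (if a then i2 else Suc i2) (if b then i3 else Suc i3) (if c then i1 else Suc i1)
      \<longleftrightarrow> between i2 i3 i1"
    "between (if a then i1 else Suc i1) (if b then i3 else Suc i3) (if c then i2 else Suc i2)
      \<longleftrightarrow> \<not> between i2 i3 i1"
    "between (if a then i2 else Suc i2) i1 (Suc i1)"
    "\<not> between (if a then i2 else Suc i2) (Suc i1) i1"
    "between i1 (Suc i1) (if a then i2 else Suc i2)"
    "\<not> between (Suc i1) i1 (if a then i2 else Suc i2)"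
proof -
  note S = assms[unfolded separate_def]
  show "between i1 i3 i2 \<longleftrightarrow> \<not> between i2 i3 i1"
    using S by (elim conjE disjE; simp add: between_def)
  show "between (if a then i2 else Suc i2) (if b then i3 else Suc i3) (if c then i1 else Suc i1)
    \<longleftrightarrow> between i2 i3 i1"
    using S by (elim conjE disjE; cases a; cases b; cases c; simp add: between_def)
  show "between (if a then i1 else Suc i1) (if b then i3 else Suc i3) (if c then i2 else Suc i2)
    \<longleftrightarrow> \<not> between i2 i3 i1"
    using S by (elim conjE disjE; cases a; cases b; cases c; simp add: between_def)
  show "between (if a then i2 else Suc i2) i1 (Suc i1)"
    using S by (elim conjE disjE; cases a; simp add: between_def)
  show "\<not> between (if a then i2 else Suc i2) (Suc i1) i1"
    using S by (elim conjE disjE; cases a; simp add: between_def)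
  show "between i1 (Suc i1) (if a then i2 else Suc i2)"
    using S by (elim conjE disjE; cases a; simp add: between_def)
  show "\<not> between (Suc i1) i1 (if a then i2 else Suc i2)"
    using S by (elim conjE disjE; cases a; simp add: between_def)
qed

text \<open>The crossing x lies on strands 1 and 2. At the far ends of these sides its multiplicity
  depends on the order on the side, hence on s; on strand 3 it depends only on the cyclic order and
  the two directions.\<close>

lemma arcs_at_corner:
  assumes cp: "corner_positions E s d1 d2 d3 x y z i1 i2 i3" and ap: "separate i1 i2 i3"
  shows "arcs E (Some x) (z, opposite (dir d3 d1)) = of_bool (d2 = s)"
    "arcs E (Some x) (y, dir d2 d3) = of_bool (d1 = s)"
    "arcs E (Some x) (y, opposite (dir d2 d3)) = of_bool ((d1 = d2) = between i2 i3 i1)"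
    "arcs E (Some x) (z, dir d3 d1) = of_bool ((d1 = d2) = between i2 i3 i1)"
proof -
  note P = cp[unfolded corner_positions_def]
  \<comment> \<open>Exchanging strands 1 and 2 yields the comparisons along side 2 from those along
    side 1.\<close>
  have ap': "separate i2 i1 i3" using ap by (auto simp: separate_def)
  note S = separate_between[OF ap] and S' = separate_between[OF ap']
  show "arcs E (Some x) (z, opposite (dir d3 d1)) = of_bool (d2 = s)"
    using P S(4-7)[of True] S(4-7)[of False] unfolding arcs.simps(2)
    by (cases d1; cases d2; cases s) (simp_all add: dir_def)
  show "arcs E (Some x) (y, dir d2 d3) = of_bool (d1 = s)"
    using P S'(4-7)[of True] S'(4-7)[of False] unfolding arcs.simps(2)
    by (cases d1; cases d2; cases s) (simp_all add: dir_def)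
  have "arcs E (Some x) l = of_bool ((d1 = d2) = between i2 i3 i1)"
    if l: "position E l = (if b then i3 else Suc i3)" for l b
  proof (cases "d1 = d2")
    case True
    then have "position E (x, Leftward) = (if d2 = s then i2 else Suc i2)"
      "position E (x, Rightward) = (if d1 \<noteq> s then i1 else Suc i1)" using P
        by (simp_all add: dir_def)
    then show ?thesis unfolding arcs.simps(2) l using S(2) True by simp
  next
    case False
    then have "position E (x, Rightward) = (if d2 = s then i2 else Suc i2)"
      "position E (x, Leftward) = (if d1 \<noteq> s then i1 else Suc i1)" using P
        by (simp_all add: dir_def)
    then show ?thesis unfolding arcs.simps(2) l using S(3) False by simp
  qed
  from this[of _ "d3 = s"] this[of _ "d3 \<noteq> s"]
  show "arcs E (Some x) (y, opposite (dir d2 d3)) = of_bool ((d1 = d2) = between i2 i3 i1)"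
    "arcs E (Some x) (z, dir d3 d1) = of_bool ((d1 = d2) = between i2 i3 i1)"
    using P by simp_all
qed

text \<open>The three crossings are permuted by rotation, which leaves the cyclic order \<beta>
  alone.\<close>

lemma arcs_at_corners:
  assumes cp: "corner_positions E s d1 d2 d3 x y z i1 i2 i3" and ap: "separate i1 i2 i3"
  defines "\<beta> \<equiv> between i2 i3 i1"
  shows "arcs E (Some x) (z, opposite (dir d3 d1)) = of_bool (d2 = s)"
    "arcs E (Some x) (y, dir d2 d3) = of_bool (d1 = s)"
    "arcs E (Some x) (y, opposite (dir d2 d3)) = of_bool ((d1 = d2) = \<beta>)"
    "arcs E (Some x) (z, dir d3 d1) = of_bool ((d1 = d2) = \<beta>)"
    "arcs E (Some y) (x, opposite (dir d1 d2)) = of_bool (d3 = s)"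
    "arcs E (Some y) (z, dir d3 d1) = of_bool (d2 = s)"
    "arcs E (Some y) (z, opposite (dir d3 d1)) = of_bool ((d2 = d3) = \<beta>)"
    "arcs E (Some y) (x, dir d1 d2) = of_bool ((d2 = d3) = \<beta>)"
    "arcs E (Some z) (y, opposite (dir d2 d3)) = of_bool (d1 = s)"
    "arcs E (Some z) (x, dir d1 d2) = of_bool (d3 = s)"
    "arcs E (Some z) (x, opposite (dir d1 d2)) = of_bool ((d3 = d1) = \<beta>)"
    "arcs E (Some z) (y, dir d2 d3) = of_bool ((d3 = d1) = \<beta>)"
proof -
  have ap2: "separate i2 i3 i1" "separate i3 i1 i2" using ap by (auto simp: separate_def)
  have \<beta>: "between i3 i1 i2 = \<beta>" "between i1 i2 i3 = \<beta>"
    unfolding \<beta>_def using between_rotate by metis+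
  note cp2 = corner_positions_rotate[OF cp]
  note cp3 = corner_positions_rotate[OF cp2]
  show "arcs E (Some x) (z, opposite (dir d3 d1)) = of_bool (d2 = s)"
    "arcs E (Some x) (y, dir d2 d3) = of_bool (d1 = s)"
    "arcs E (Some x) (y, opposite (dir d2 d3)) = of_bool ((d1 = d2) = \<beta>)"
    "arcs E (Some x) (z, dir d3 d1) = of_bool ((d1 = d2) = \<beta>)"
    unfolding \<beta>_def by (rule arcs_at_corner[OF cp ap])+
  show "arcs E (Some y) (x, opposite (dir d1 d2)) = of_bool (d3 = s)"
    "arcs E (Some y) (z, dir d3 d1) = of_bool (d2 = s)"
    "arcs E (Some y) (z, opposite (dir d3 d1)) = of_bool ((d2 = d3) = \<beta>)"
    "arcs E (Some y) (x, dir d1 d2) = of_bool ((d2 = d3) = \<beta>)"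
    by (rule arcs_at_corner[OF cp2 ap2(1), unfolded \<beta>])+
  show "arcs E (Some z) (y, opposite (dir d2 d3)) = of_bool (d1 = s)"
    "arcs E (Some z) (x, dir d1 d2) = of_bool (d3 = s)"
    "arcs E (Some z) (x, opposite (dir d1 d2)) = of_bool ((d3 = d1) = \<beta>)"
    "arcs E (Some z) (y, dir d2 d3) = of_bool ((d3 = d1) = \<beta>)"
    by (rule arcs_at_corner[OF cp3 ap2(2), unfolded \<beta>])+
qed

section \<open>Invariance under third moves\<close>

definition triangle_part ::
  "diagram \<Rightarrow> nat \<Rightarrow> nat \<Rightarrow> nat \<Rightarrow> nat option \<Rightarrow> nat option \<Rightarrow> int" where
  "triangle_part D x y z g h =
     2 * (local_term D g h x + local_term D g h y + local_term D g h z) + corner D h g - corner D g h"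

text \<open>Separates the part that the move can affect; the local terms at all other crossings are
  unchanged one by one.\<close>

lemma twice_cycle_product_triangle:
  assumes wf: "wf_diagram D"
    and xyz: "distinct [x, y, z]" "x \<in> crossings D" "y \<in> crossings D" "z \<in> crossings D"
    and g: "g \<in> insert None (Some ` crossings D)" "h \<in> insert None (Some ` crossings D)"
  shows "2 * cycle_product D g h =
    2 * (\<Sum>e\<in>crossings D - {x, y, z}. local_term D g h e) + triangle_part D x y z g h"
proof -
  have "(\<Sum>e\<in>crossings D. local_term D g h e) =
      (\<Sum>e\<in>crossings D - {x, y, z}. local_term D g h e) + (\<Sum>e\<in>{x, y, z}. local_term D g h e)"
    by (rule sum.subset_diff) (use xyz finite_crossings in auto)
  also have
    "(\<Sum>e\<in>{x, y, z}. local_term D g h e) = local_term D g h x + local_term D g h y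
    + local_term D g h z"
    using xyz(1) by simp
  finally show ?thesis unfolding twice_cycle_product[OF wf g] triangle_part_def by simp
qed

lemma triangle_part_skew: "triangle_part D x y z h g = - triangle_part D x y z g h"
  by (simp add: triangle_part_def local_term_def)

lemma triangle_part_self: "triangle_part D x y z g g = 0"
  by (simp add: triangle_part_def local_term_def)

lemma apart_separate: "apart i1 i2 i3 \<Longrightarrow> separate i1 i2 i3"
  by (auto simp: apart_def separate_def)

text \<open>For m = x only the multiplicities at z along strand 1 and at y along strand 2 change. In
  the determinants both are multiplied by the value of \<open>h\<close> on strand 3, with opposite
  signs. The other crossings behave alike under rotation.\<close>

lemma triangle_inner_outer:
  assumes tri: "triangle d1 d2 d3 D D' x y z i1 i2 i3" and ap: "apart i1 i2 i3"
    and h: "h \<in> insert None (Some ` (crossings D - {x, y, z}))" and m: "m \<in> {x, y, z}"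
  shows "triangle_part D' x y z (Some m) h = triangle_part D x y z (Some m) h"
proof -
  note O = triangle_outer_arcs[OF tri h] and I = triangle_inner_arcs[OF tri ap]
  have c1: "corner D' (Some m) h = corner D (Some m) h"
  proof (rule corner_cong)
    fix c and \<sigma> :: strand assume "h = Some c"
    then have "fst (c, \<sigma>) \<in> crossings D - {x, y, z}" using h by auto
    from I(4-6)[OF this] show "arcs D' (Some m) (c, \<sigma>) = arcs D (Some m) (c, \<sigma>)"
      using m by auto
  qed
  have c2: "corner D' h (Some m) = corner D h (Some m)"
    by (rule corner_cong) (use m O(5-7) in auto)
  note V = arcs_at_corners[OF triangle_corner_positions(1)[OF tri] apart_separate[OF ap]]
  note V' = arcs_at_corners[OF triangle_corner_positions(2)[OF tri] apart_separate[OF ap]]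
  have "local_term D' (Some m) h x + local_term D' (Some m) h y + local_term D' (Some m) h z =
    local_term D (Some m) h x + local_term D (Some m) h y + local_term D (Some m) h z"
    using m
  proof (elim insertE emptyE)
    assume m: "m = x"
    show ?thesis
      using V(1-4) V'(1-4) O(2-4) unfolding m
      by (cases d1; cases d2; cases d3; simp add: local_term_def arcs_self dir_def O(5-7))
  next
    assume m: "m = y"
    show ?thesis
      using V(5-8) V'(5-8) O(2-4) unfolding m
      by (cases d1; cases d2; cases d3; simp add: local_term_def arcs_self dir_def O(5-7))
  next
    assume m: "m = z"
    show ?thesis
      using V(9-12) V'(9-12) O(2-4) unfolding m
      by (cases d1; cases d2; cases d3; simp add: local_term_def arcs_self dir_def O(5-7))
  qed
  then show ?thesis unfolding triangle_part_def c1 c2 by simp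
qed

text \<open>Here the corner terms do change, and the local term at the third crossing makes up for
  it. All multiplicities are known, so this is a finite check over the directions and the cyclic
  order.\<close>

lemma triangle_inner_inner:
  assumes tri: "triangle d1 d2 d3 D D' x y z i1 i2 i3" and ap: "apart i1 i2 i3"
  shows "triangle_part D' x y z (Some x) (Some y) = triangle_part D x y z (Some x) (Some y)"
    "triangle_part D' x y z (Some y) (Some z) = triangle_part D x y z (Some y) (Some z)"
    "triangle_part D' x y z (Some z) (Some x) = triangle_part D x y z (Some z) (Some x)"
proof -
  note V = arcs_at_corners[OF triangle_corner_positions(1)[OF tri] apart_separate[OF ap]]
  note V' = arcs_at_corners[OF triangle_corner_positions(2)[OF tri] apart_separate[OF ap]]
  show "triangle_part D' x y z (Some x) (Some y) = triangle_part D x y z (Some x) (Some y)"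
    using V(1-8) V'(1-8)
    by (cases d1; cases d2; cases d3; cases "between i2 i3 i1";
        simp add: triangle_part_def local_term_def arcs_self dir_def)
  show "triangle_part D' x y z (Some y) (Some z) = triangle_part D x y z (Some y) (Some z)"
    using V(5-12) V'(5-12)
    by (cases d1; cases d2; cases d3; cases "between i2 i3 i1";
        simp add: triangle_part_def local_term_def arcs_self dir_def)
  show "triangle_part D' x y z (Some z) (Some x) = triangle_part D x y z (Some z) (Some x)"
    using V(1-4) V'(1-4) V(9-12) V'(9-12)
    by (cases d1; cases d2; cases d3; cases "between i2 i3 i1";
        simp add: triangle_part_def local_term_def arcs_self dir_def)
qed

lemma triangle_arcs_away:
  assumes tri: "triangle d1 d2 d3 D D' x y z i1 i2 i3" and ap: "apart i1 i2 i3"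
    and g: "g \<in> insert None (Some ` crossings D)" and l: "fst l \<in> crossings D - {x, y, z}"
  shows "arcs D' g l = arcs D g l"
proof (cases "g \<in> {Some x, Some y, Some z}")
  case True
  then show ?thesis using triangle_inner_arcs(4-6)[OF tri ap l] by auto
next
  case False
  then have "g \<in> insert None (Some ` (crossings D - {x, y, z}))" using g by auto
  from triangle_outer_arcs(1)[OF tri this l] show ?thesis .
qed

text \<open>Elements are sorted into corners of the triangle and all others; pairs in the
  unfavourable order follow by skew symmetry, and diagonal pairs vanish.\<close>

lemma triangle_part_invariant:
  assumes tri: "triangle d1 d2 d3 D D' x y z i1 i2 i3" and ap: "apart i1 i2 i3"
    and g: "g \<in> insert None (Some ` crossings D)" "h \<in> insert None (Some ` crossings D)"
  shows "triangle_part D' x y z g h = triangle_part D x y z g h"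
proof -
  let ?O = "insert None (Some ` (crossings D - {x, y, z}))"
  have cases: "u \<in> ?O \<or> (\<exists>m\<in>{x, y, z}. u = Some m)"
    if "u \<in> insert None (Some ` crossings D)" for u
    using that by auto
  note io = triangle_inner_outer[OF tri ap] and ii = triangle_inner_inner[OF tri ap]
  consider "g \<in> ?O" "h \<in> ?O" | m where "m \<in> {x, y, z}" "g = Some m" "h \<in> ?O"
    | m where "m \<in> {x, y, z}" "h = Some m" "g \<in> ?O"
    | m n where "m \<in> {x, y, z}" "g = Some m" "n \<in> {x, y, z}" "h = Some n"
  proof (cases "g \<in> ?O"; cases "h \<in> ?O")
    assume "g \<in> ?O" "h \<in> ?O"
    then show thesis by (rule that(1))
  next
    assume a: "g \<notin> ?O" "h \<in> ?O"
    then obtain m where "m \<in> {x, y, z}" "g = Some m" using cases[OF g(1)] by metis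
    then show thesis using that(2) a(2) by metis
  next
    assume a: "g \<in> ?O" "h \<notin> ?O"
    then obtain m where "m \<in> {x, y, z}" "h = Some m" using cases[OF g(2)] by metis
    then show thesis using that(3) a(1) by metis
  next
    assume "g \<notin> ?O" "h \<notin> ?O"
    then obtain m n where "m \<in> {x, y, z}" "g = Some m" "n \<in> {x, y, z}" "h = Some n"
      using cases[OF g(1)] cases[OF g(2)] by metis
    then show thesis by (rule that(4))
  qed
  then show ?thesis
  proof cases
    case 1
    have c: "corner D' v u = corner D v u" if "u \<in> ?O" "v \<in> ?O" for u v
    proof (rule corner_cong)
      fix c and \<sigma> :: strand assume "u = Some c"
      then have "fst (c, \<sigma>) \<in> crossings D - {x, y, z}" using that by auto
      from triangle_outer_arcs(1)[OF tri that(2) this] show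
        "arcs D' v (c, \<sigma>) = arcs D v (c, \<sigma>)" .
    qed
    show ?thesis
      unfolding triangle_part_def local_term_def c[OF 1] c[OF 1(2,1)]
        triangle_outer_arcs(5-7)[OF tri 1(1)] triangle_outer_arcs(5-7)[OF tri 1(2)] ..
  next
    case (2 m)
    then show ?thesis using io by blast
  next
    case (3 m)
    then have "triangle_part D' x y z h g = triangle_part D x y z h g" using io by blast
    then show ?thesis using triangle_part_skew[of D x y z g h] triangle_part_skew[of D' x y z g h]
      by simp
  next
    case (4 m n)
    have *: "triangle_part D' x y z (Some n) (Some m) = triangle_part D x y z (Some n) (Some m)"
      if "triangle_part D' x y z (Some m) (Some n) = triangle_part D x y z (Some m) (Some n)"
        for m n
      using that triangle_part_skew[of D x y z "Some n" "Some m"] triangle_part_skew[of D' x y z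
        "Some n" "Some m"]
      by simp
    from 4 ii *[OF ii(1)] *[OF ii(2)] *[OF ii(3)] show ?thesis
      by (auto simp: triangle_part_self)
  qed
qed

lemma triangle_cycle_product:
  assumes tri: "triangle d1 d2 d3 D D' x y z i1 i2 i3" and ap: "apart i1 i2 i3"
    and g: "g \<in> insert None (Some ` crossings D)" "h \<in> insert None (Some ` crossings D)"
  shows "cycle_product D' g h = cycle_product D g h"
proof -
  have T: "wf_diagram D" "wf_diagram D'" "crossings D' = crossings D" "distinct [x, y, z]"
    "x \<in> crossings D" "y \<in> crossings D" "z \<in> crossings D"
    using tri unfolding triangle_def by blast+
  have "(\<Sum>e\<in>crossings D - {x, y, z}. local_term D' g h e)
    = (\<Sum>e\<in>crossings D - {x, y, z}. local_term D g h e)"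
    by (rule sum.cong)
      (simp_all add: local_term_def triangle_arcs_away[OF tri ap g(1)] triangle_arcs_away[OF tri ap g(2)])
  then have "2 * cycle_product D' g h = 2 * cycle_product D g h"
    using twice_cycle_product_triangle[OF T(1,4-7) g] twice_cycle_product_triangle[of D' x y z g h]
      triangle_part_invariant[OF tri ap g] T g by simp
  then show ?thesis by simp
qed

text \<open>The arcs from side 1 to 2, 2 to 3 and 3 to 1 close up to a path that winds round the
  code once or twice, depending on the cyclic order. Reversed arcs are complements.\<close>

lemma between_thirds:
  assumes "separate i1 i2 i3" "l \<notin> {i1, i2, i3}"
  shows "of_bool (between i1 l i2) + of_bool (between i2 l i3) + of_bool (between i3 l i1) =
      (if between i2 i3 i1 then 1 else (2 :: int))"
    "between i2 l i1 \<longleftrightarrow> \<not> between i1 l i2"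
      "between i3 l i2 \<longleftrightarrow> \<not> between i2 l i3"
    "between i1 l i3 \<longleftrightarrow> \<not> between i3 l i1"
proof -
  have l: "l < i1 \<or> i1 < l" "l < i2 \<or> i2 < l" "l < i3 \<or> i3 < l" using assms(2) by auto
  note S = assms(1)[unfolded separate_def]
  show "of_bool (between i1 l i2) + of_bool (between i2 l i3) + of_bool (between i3 l i1) =
      (if between i2 i3 i1 then 1 else (2 :: int))"
    using S l by (elim conjE disjE; simp add: between_def)
  have *: "between b l a \<longleftrightarrow> \<not> between a l b"
    if "a < b \<or> b < a" "l < a \<or> a < l" "l < b \<or> b < l" for a b
    using that by (elim disjE; simp add: between_def)
  show "between i2 l i1 \<longleftrightarrow> \<not> between i1 l i2"
    "between i3 l i2 \<longleftrightarrow> \<not> between i2 l i3"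
    "between i1 l i3 \<longleftrightarrow> \<not> between i3 l i1"
    by (rule *; use S l in linarith)+
qed

text \<open>At an incoherent triangle exactly two strands agree in direction; this is their
  crossing. At a coherent one the value is a default that is multiplied by 0 wherever it
  occurs.\<close>

definition odd_vertex ::
  "bool \<Rightarrow> bool \<Rightarrow> bool \<Rightarrow> nat \<Rightarrow> nat \<Rightarrow> nat \<Rightarrow> nat" where
  "odd_vertex d1 d2 d3 x y z = (if d1 = d2 then x else if d2 = d3 then y else z)"

definition coherent :: "bool \<Rightarrow> bool \<Rightarrow> bool \<Rightarrow> bool" where
  "coherent d1 d2 d3 \<longleftrightarrow> d1 = d2 \<and> d2 = d3"

text \<open>Let N be the winding number of the three arcs, 1 or 2. At a coherent triangle all three
  halves are complements of them, which gives 3 - N. Otherwise the only complement is the half at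
  the odd vertex, and splitting off twice that half leaves N - 1.\<close>

definition curve_multiplicity :: "bool \<Rightarrow> bool \<Rightarrow> int" where
  "curve_multiplicity coh \<beta> = (if \<beta> then (if coh then 2 else 0) else 1)"

lemma triangle_arcs_sum:
  assumes tri: "triangle d1 d2 d3 D D' x y z i1 i2 i3" and ap: "apart i1 i2 i3"
    and l: "fst l \<in> crossings D - {x, y, z}"
  shows "arcs D (Some x) l + arcs D (Some y) l + arcs D (Some z) l =
    curve_multiplicity (coherent d1 d2 d3) (between i2 i3 i1) +
    2 * of_bool (\<not> coherent d1 d2 d3) * arcs D (Some (odd_vertex d1 d2 d3 x y z)) l"
proof -
  have "position D l \<notin> {i1, i2, i3}" using tri l unfolding triangle_def by blast
  note B = between_thirds[OF apart_separate[OF ap] this]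
  note I = triangle_inner_arcs(1-3)[OF tri ap l, unfolded B(2-4) if_distrib[of of_bool] of_bool_not_iff]
  \<comment> \<open>Eliminating one of the three indicators by the winding number turns each choice
    of directions into a linear identity in the other two.\<close>
  have B1: "of_bool (between i1 (position D l) i2) = (if between i2 i3 i1 then 1 else (2 :: int)) -
      of_bool (between i2 (position D l) i3) - of_bool (between i3 (position D l) i1)"
    using B(1) by linarith
  show ?thesis
    unfolding odd_vertex_def if_distrib[of Some] if_distrib[of "\<lambda>g. arcs D g l"] I B1
    by (cases d1; cases d2; cases d3; simp add: curve_multiplicity_def coherent_def)
qed

text \<open>Away from the triangle the identity holds for multiplicities and is inherited by
  determinants. At the corners the halves turn, so the doubled contributions are compared case by
  case, with \<open>h\<close> a corner or not.\<close>

lemma triangle_part_sum: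
  assumes tri: "triangle d1 d2 d3 D D' x y z i1 i2 i3" and ap: "apart i1 i2 i3"
    and h: "h \<in> insert None (Some ` crossings D)"
  shows "triangle_part D x y z (Some x) h + triangle_part D x y z (Some y) h
    + triangle_part D x y z (Some z) h =
    curve_multiplicity (coherent d1 d2 d3) (between i2 i3 i1) * triangle_part D x y z None h +
    2 * of_bool (\<not> coherent d1 d2 d3) * triangle_part D x y z (Some (odd_vertex d1 d2 d3 x y z)) h"
proof -
  note V = arcs_at_corners[OF triangle_corner_positions(1)[OF tri] apart_separate[OF ap]]
  note defs = triangle_part_def local_term_def arcs_self dir_def curve_multiplicity_def coherent_def odd_vertex_def
  consider "h = Some x" | "h = Some y" | "h = Some z"
    | "h \<in> insert None (Some ` (crossings D - {x, y, z}))" using h by auto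
  then show ?thesis
  proof cases
    case 1
    show ?thesis unfolding 1 using V
      by (cases d1; cases d2; cases d3; cases "between i2 i3 i1"; simp add: defs)
  next
    case 2
    show ?thesis unfolding 2 using V
      by (cases d1; cases d2; cases d3; cases "between i2 i3 i1"; simp add: defs)
  next
    case 3
    show ?thesis unfolding 3 using V
      by (cases d1; cases d2; cases d3; cases "between i2 i3 i1"; simp add: defs)
  next
    case 4
    note O = triangle_outer_arcs(2-4)[OF tri 4]
    have "corner D (Some x) h + corner D (Some y) h + corner D (Some z) h =
      2 * of_bool (\<not> coherent d1 d2 d3) * corner D (Some (odd_vertex d1 d2 d3 x y z)) h"
    proof (cases h)
      case (Some c)
      then have "fst (c, \<sigma>) \<in> crossings D - {x, y, z}" for \<sigma> :: strand using 4
        by auto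
      from triangle_arcs_sum[OF tri ap this] have A:
        "arcs D (Some x) (c, \<sigma>) + arcs D (Some y) (c, \<sigma>)
        + arcs D (Some z) (c, \<sigma>) =
        curve_multiplicity (coherent d1 d2 d3) (between i2 i3 i1) +
        2 * of_bool (\<not> coherent d1 d2 d3) * arcs D (Some (odd_vertex d1 d2 d3 x y z)) (c, \<sigma>)" for \<sigma> .
      show ?thesis unfolding Some corner.simps right_diff_distrib
        using A[of Leftward] A[of Rightward] by linarith
    qed simp
    moreover have "corner D None h = 0" by (cases h) simp_all
    moreover have
      "2 * (local_term D (Some x) h x + local_term D (Some x) h y + local_term D (Some x) h z) +
        2 * (local_term D (Some y) h x + local_term D (Some y) h y + local_term D (Some y) h z) +
        2 * (local_term D (Some z) h x + local_term D (Some z) h y + local_term D (Some z) h z) +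
        corner D h (Some x) + corner D h (Some y) + corner D h (Some z) =
      curve_multiplicity (coherent d1 d2 d3) (between i2 i3 i1) *
        (2 * (local_term D None h x + local_term D None h y + local_term D None h z)) +
      2 * of_bool (\<not> coherent d1 d2 d3) *
        (2 * (local_term D (Some (odd_vertex d1 d2 d3 x y z)) h x + local_term D (Some (odd_vertex d1 d2 d3 x y z)) h y +
          local_term D (Some (odd_vertex d1 d2 d3 x y z)) h z) + corner D h (Some (odd_vertex d1 d2 d3 x y z)))"
      using V O
      by (cases d1; cases d2; cases d3; cases "between i2 i3 i1"; simp add: defs)
    ultimately show ?thesis
      unfolding triangle_part_def by (simp add: algebra_simps)
  qed
qed

lemma triangle_cycle_product_sum:
  assumes tri: "triangle d1 d2 d3 D D' x y z i1 i2 i3" and ap: "apart i1 i2 i3"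
    and h: "h \<in> insert None (Some ` crossings D)"
  shows "cycle_product D (Some x) h + cycle_product D (Some y) h + cycle_product D (Some z) h =
    curve_multiplicity (coherent d1 d2 d3) (between i2 i3 i1) * cycle_product D None h +
    2 * of_bool (\<not> coherent d1 d2 d3) * cycle_product D (Some (odd_vertex d1 d2 d3 x y z)) h"
proof -
  have T: "wf_diagram D" "distinct [x, y, z]" "x \<in> crossings D" "y \<in> crossings D"
    "z \<in> crossings D"
    using tri unfolding triangle_def by blast+
  let ?k = "curve_multiplicity (coherent d1 d2 d3) (between i2 i3 i1)"
  let ?e = "2 * of_bool (\<not> coherent d1 d2 d3) :: int" and ?m = "odd_vertex d1 d2 d3 x y z"
  let ?R = "crossings D - {x, y, z}"
  have m: "?m \<in> crossings D" using T by (auto simp: odd_vertex_def)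
  have "(\<Sum>e\<in>?R. local_term D (Some x) h e) + (\<Sum>e\<in>?R. local_term D (Some y) h e) + (\<Sum>e\<in>?R. local_term D (Some z) h e) =
      ?k * (\<Sum>e\<in>?R. local_term D None h e) + ?e * (\<Sum>e\<in>?R. local_term D (Some ?m) h e)"
    unfolding sum_distrib_left sum.distrib[symmetric]
  proof (rule sum.cong)
    fix e assume "e \<in> ?R"
    then have "fst (e, \<sigma>) \<in> ?R" for \<sigma> :: strand by simp
    from triangle_arcs_sum[OF tri ap this] have A: "arcs D (Some z) (e, \<sigma>) =
      ?k + ?e * arcs D (Some ?m) (e, \<sigma>) - arcs D (Some x) (e, \<sigma>) - arcs D (Some y) (e, \<sigma>)" for \<sigma>
      by (simp add: algebra_simps)
    show "local_term D (Some x) h e + local_term D (Some y) h e + local_term D (Some z) h e =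
      ?k * local_term D None h e + ?e * local_term D (Some ?m) h e"
      unfolding local_term_def A by (simp add: algebra_simps)
  qed simp
  note R = arg_cong[OF this, of "\<lambda>t. 2 * t"]
  have N: "insert None (Some ` crossings D) = insert None (Some ` crossings D)" ..
  note tw = twice_cycle_product_triangle[OF T]
  have "2 * (cycle_product D (Some x) h + cycle_product D (Some y) h + cycle_product D (Some z) h) =
      2 * (?k * cycle_product D None h + ?e * cycle_product D (Some ?m) h)"
  proof -
    have "2 * (cycle_product D (Some x) h + cycle_product D (Some y) h
      + cycle_product D (Some z) h) =
      2 * cycle_product D (Some x) h + 2 * cycle_product D (Some y) h + 2 * cycle_product D (Some z) h" by simp
    also have "\<dots> = ?k * (2 * cycle_product D None h) + ?e * (2 * cycle_product D (Some ?m) h)"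
      using R triangle_part_sum[OF tri ap h] tw[of "Some x" h] tw[of "Some y" h] tw[of "Some z" h]
        tw[of None h] tw[of "Some ?m" h] h m T(3-5) by (simp add: algebra_simps)
    finally show ?thesis by (simp add: algebra_simps)
  qed
  then show ?thesis by simp
qed

section \<open>Isotopies\<close>

lemma idx_map:
  assumes "inj_on f (insert l (set w))"
  shows "idx (map f w) (f l) = idx w l"
  using assms by (induction w) (auto simp: inj_on_def)

text \<open>A change of base point rotates the positions, and cyclic order does not see it.\<close>

lemma between_rotated:
  assumes "p < n" "l < n" "q < n" "m \<le> n"
  defines "s \<equiv> \<lambda>i. if i < m then i + (n - m) else i - m"
  shows "between (s p) (s l) (s q) \<longleftrightarrow> between p l q"
  using assms(1-4) unfolding s_def
  by (cases "p < m"; cases "l < m"; cases "q < m"; auto simp: between_def)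

lemma isotopy_positions:
  assumes "isotopy \<phi> D D'"
  shows "wf_diagram D" "wf_diagram D'" "inj_on \<phi> (crossings D)"
    "crossings D' = \<phi> ` crossings D"
    "\<exists>m\<le>length (word D). \<forall>l. fst l \<in> crossings D
      \<longrightarrow> position D' (map_prod \<phi> id l) =
      (if position D l < m then position D l + (length (word D) - m) else position D l - m)"
proof -
  show wf: "wf_diagram D" "wf_diagram D'" and inj: "inj_on \<phi> (crossings D)"
    using assms by (auto simp: isotopy_def)
  obtain k where k: "word D' = rotate k (map (map_prod \<phi> id) (word D))"
    using assms by (auto simp: isotopy_def)
  show cr: "crossings D' = \<phi> ` crossings D" by (simp add: crossings_def k image_image)
  let ?n = "length (word D)" and ?w = "word D"
  let ?m = "k mod ?n" and ?f = "map_prod \<phi> (id :: strand \<Rightarrow> strand)"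
  have w': "word D' = map ?f (drop ?m ?w) @ map ?f (take ?m ?w)"
    by (simp add: k rotate_drop_take drop_map take_map)
  have "position D' (?f l) = (if position D l < ?m then position D l
    + (?n - ?m) else position D l - ?m)"
    if l: "fst l \<in> crossings D" for l
  proof -
    have lw: "l \<in> set ?w" "?f l \<in> set (word D')"
      using l wf cr by (auto simp: wf_diagram_passage)
    from length_pos_if_in_set[OF lw(1)] have m: "?m \<le> ?n" by (simp add: less_imp_le)
    have inj_f: "inj_on ?f (set ?w)"
    proof (rule inj_onI)
      fix a b assume ab: "a \<in> set ?w" "b \<in> set ?w" "?f a = ?f b"
      then have "fst a \<in> crossings D" "fst b \<in> crossings D"
        "\<phi> (fst a) = \<phi> (fst b)" "snd a = snd b"
        using wf(1)
          by (simp_all only: wf_diagram_passage) (metis fst_map_prod, metis snd_map_prod id_apply)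
      then show "a = b" using inj_onD[OF inj] by (simp add: prod_eq_iff)
    qed
    have split: "idx ?w l = (if l \<in> set (take ?m ?w) then idx (take ?m ?w) l
        else ?m + idx (drop ?m ?w) l)"
      using idx_append[of "take ?m ?w" "drop ?m ?w" l] m by (simp add: min_absorb2)
    have mem: "?f l \<in> ?f ` set (drop ?m ?w) \<longleftrightarrow> l \<in> set (drop ?m ?w)"
      by (rule inj_on_image_mem_iff[OF inj_f lw(1) set_drop_subset])
    have sub: "insert l (set (take ?m ?w)) \<subseteq> set ?w"
      "insert l (set (drop ?m ?w)) \<subseteq> set ?w"
      using lw(1) set_take_subset[of ?m ?w] set_drop_subset[of ?m ?w] by auto
    note im = idx_map[OF inj_on_subset[OF inj_f sub(1)]] idx_map[OF inj_on_subset[OF inj_f sub(2)]]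
    have un: "set ?w = set (take ?m ?w) \<union> set (drop ?m ?w)"
      by (metis append_take_drop_id set_append)
    have "distinct (take ?m ?w @ drop ?m ?w)" using wf(1) by (simp add: wf_diagram_def)
    then have dis: "set (take ?m ?w) \<inter> set (drop ?m ?w) = {}" by (simp only: distinct_append)
    show ?thesis
    proof (cases "l \<in> set (take ?m ?w)")
      case True
      then have "l \<notin> set (drop ?m ?w)" using dis by blast
      moreover have "idx (take ?m ?w) l < ?m" using idx_less[OF True] m by simp
      ultimately show ?thesis
        unfolding position_eq_idx[OF wf(1) lw(1)] position_eq_idx[OF wf(2) lw(2)] split unfolding w'
        using True mem m by (simp add: idx_append im)
    next
      case False
      then have "l \<in> set (drop ?m ?w)" using lw(1) un by blast
      then show ?thesis
        unfolding position_eq_idx[OF wf(1) lw(1)] position_eq_idx[OF wf(2) lw(2)] split unfolding w'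
        using False mem m by (simp add: idx_append im)
    qed
  qed
  note pos = this
  show "\<exists>m\<le>?n. \<forall>l. fst l \<in> crossings D
    \<longrightarrow> position D' (?f l) =
      (if position D l < m then position D l + (?n - m) else position D l - m)"
  \<comment> \<open>For the empty code \<open>k mod 0\<close> is \<open>k\<close> and may exceed the
    length, so this case is split off.\<close>
  proof (cases "?n = 0")
    case True
    then have "crossings D = {}" by (simp add: crossings_def)
    then show ?thesis by auto
  next
    case False
    then have "?m \<le> ?n" by (simp add: less_imp_le)
    then show ?thesis using pos by blast
  qed
qed

lemma isotopy_arcs:
  assumes iso: "isotopy \<phi> D D'" and g: "g \<in> insert None (Some ` crossings D)"
    and e: "e \<in> crossings D"
  shows "arcs D' (map_option \<phi> g) (\<phi> e, \<sigma>) = arcs D g (e, \<sigma>)"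
proof (cases g)
  case (Some c)
  then have c: "c \<in> crossings D" using g by auto
  note I = isotopy_positions[OF iso]
  obtain m where m: "m \<le> length (word D)" and
    pos: "\<forall>l. fst l \<in> crossings D \<longrightarrow> position D' (map_prod \<phi> id l) =
      (if position D l < m then position D l + (length (word D) - m) else position D l - m)"
    using I(5) by blast
  have pos': "position D' (\<phi> a, \<tau>) =
      (if position D (a, \<tau>) < m then position D (a, \<tau>) + (length (word D) - m) else position D (a, \<tau>) - m)"
    if "a \<in> crossings D" for a \<tau>
    using pos[rule_format, of "(a, \<tau>)"] that by simp
  have less: "position D (a, \<tau>) < length (word D)" if "a \<in> crossings D" for a \<tau>
    using position_less[OF I(1), of "(a, \<tau>)"] that by simp
  show ?thesis
    using between_rotated[OF less[OF c] less[OF e] less[OF c] m, of Leftward \<sigma> Rightward]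
    by (simp add: Some arcs.simps(2) pos'[OF c] pos'[OF e])
qed simp

lemma isotopy_cycle_product:
  assumes iso: "isotopy \<phi> D D'"
    and g: "g \<in> insert None (Some ` crossings D)" "h \<in> insert None (Some ` crossings D)"
  shows "cycle_product D' (map_option \<phi> g) (map_option \<phi> h) = cycle_product D g h"
proof (rule cycle_product_eqI)
  note I = isotopy_positions[OF iso] and A = isotopy_arcs[OF iso]
  show "wf_diagram D" "wf_diagram D'" by (fact I)+
  show "g \<in> insert None (Some ` crossings D)" "h \<in> insert None (Some ` crossings D)"
    by (fact g)+
  show "map_option \<phi> g \<in> insert None (Some ` crossings D')"
    "map_option \<phi> h \<in> insert None (Some ` crossings D')"
    using g I(4) by auto
  have "(\<Sum>e\<in>crossings D'. local_term D' (map_option \<phi> g) (map_option \<phi> h) e) =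
      (\<Sum>e\<in>crossings D. local_term D' (map_option \<phi> g) (map_option \<phi> h) (\<phi> e))"
    unfolding I(4) by (simp add: sum.reindex[OF I(3)])
  also have "\<dots> = (\<Sum>e\<in>crossings D. local_term D g h e)"
    by (rule sum.cong) (simp_all only: local_term_def A[OF g(1)] A[OF g(2)])
  moreover have corner: "corner D' (map_option \<phi> v) (map_option \<phi> u) = corner D v u"
    if "u \<in> insert None (Some ` crossings D)" "v \<in> insert None (Some ` crossings D)" for u v
  proof (cases u)
    case (Some c)
    then have "c \<in> crossings D" using that by auto
    from A[OF that(2) this] show ?thesis by (simp add: Some)
  qed simp
  ultimately show
    "2 * (\<Sum>e\<in>crossings D'. local_term D' (map_option \<phi> g) (map_option \<phi> h) e) +
      corner D' (map_option \<phi> h) (map_option \<phi> g) - corner D' (map_option \<phi> g) (map_option \<phi> h) =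
      2 * (\<Sum>e\<in>crossings D. local_term D g h e) + corner D h g - corner D g h"
    unfolding corner[OF g] corner[OF g(2,1)] by presburger
qed

section \<open>Parity\<close>

text \<open>Well-formedness of the matrix of a diagram is read off from a chain to
  \<open>Tp\<close>.\<close>

lemma homologous_wf: "homologous T Tp \<Longrightarrow> primitive Tp \<Longrightarrow> wf_matrix T"
  using chain_to_primitive unfolding homologous_def by blast

lemma infinite_nat_option: "infinite (UNIV :: nat option set)"
  by simp

lemma extends_diagram_matrix:
  assumes "wf_matrix (diagram_matrix D :: (nat option, 'h::comm_ring_1) based_matrix)"
    "wf_matrix (diagram_matrix D' :: (nat option, 'h) based_matrix)"
    "crossings D' = N \<union> crossings D" "N \<inter> crossings D = {}"
    "\<And>g h. g \<in> insert None (Some ` crossings D) \<Longrightarrow> h \<in> insert None (Some ` crossings D) \<Longrightarrow>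
      cycle_product D' g h = cycle_product D g h"
  shows "extends (diagram_matrix D :: (nat option, 'h) based_matrix) (Some ` N) (diagram_matrix D')"
  unfolding extends_def
proof (intro conjI ballI)
  fix g h assume "g \<in> elems (diagram_matrix D :: (nat option, 'h) based_matrix)"
    "h \<in> elems (diagram_matrix D :: (nat option, 'h) based_matrix)"
  then show "form (diagram_matrix D') g h = (form (diagram_matrix D) g h :: 'h)"
    unfolding diagram_matrix_simps using assms(5) by metis
qed (use assms in \<open>auto simp: diagram_matrix_simps\<close>)

lemma move1_operation:
  assumes m: "move1 D D' c"
    and wf: "wf_matrix (diagram_matrix D :: (nat option, 'h::comm_ring_1) based_matrix)"
      "wf_matrix (diagram_matrix D' :: (nat option, 'h) based_matrix)"
  shows "operation (diagram_matrix D :: (nat option, 'h) based_matrix) (diagram_matrix D')"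
    "\<exists>k::int. \<forall>h\<in>elems (diagram_matrix D' :: (nat option, 'h) based_matrix).
      form (diagram_matrix D') (Some c) h = (of_int k * form (diagram_matrix D') None h :: 'h)"
proof -
  note M = move1_cycle_product[OF m]
  let ?T = "diagram_matrix D :: (nat option, 'h) based_matrix"
  let ?T' = "diagram_matrix D' :: (nat option, 'h) based_matrix"
  have "extends ?T (Some ` {c}) ?T'"
    by (rule extends_diagram_matrix[OF wf]) (use M(1-3) in auto)
  then have ext: "extends ?T {Some c} ?T'" by simp
  have *: "(\<forall>h\<in>elems ?T'. form ?T' (Some c) h = 0) \<or>
      (\<forall>h\<in>elems ?T'. form ?T' (Some c) h = form ?T' None h)"
    using M(4) unfolding diagram_matrix_simps by auto
  have "Some c \<in> proper_elems ?T'" using M(2) by (simp add: diagram_matrix_simps(1,2))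
  with * have "annihilating ?T' (Some c) \<or> core ?T' (Some c)"
    unfolding annihilating_def core_def diagram_matrix_simps(2) by blast
  then have "cancels ?T' {Some c} False \<or> cancels ?T' {Some c} True"
    by (simp add: cancels_annihilating cancels_core)
  then show "operation ?T ?T'" using operationI[OF ext] by blast
  show "\<exists>k::int. \<forall>h\<in>elems ?T'. form ?T' (Some c) h = of_int k * form ?T' None h"
    using *
  proof
    assume "\<forall>h\<in>elems ?T'. form ?T' (Some c) h = 0"
    then show ?thesis by (intro exI[of _ 0]) simp
  next
    assume "\<forall>h\<in>elems ?T'. form ?T' (Some c) h = form ?T' None h"
    then show ?thesis by (intro exI[of _ 1]) simp
  qed
qed

lemma move2_operation:
  assumes m: "move2 D D' c d"
    and wf: "wf_matrix (diagram_matrix D :: (nat option, 'h::comm_ring_1) based_matrix)"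
      "wf_matrix (diagram_matrix D' :: (nat option, 'h) based_matrix)"
  shows "operation (diagram_matrix D :: (nat option, 'h) based_matrix) (diagram_matrix D')"
    "\<And>h. h \<in> elems (diagram_matrix D' :: (nat option, 'h) based_matrix) \<Longrightarrow>
      form (diagram_matrix D') (Some c) h + form (diagram_matrix D') (Some d) h =
        (form (diagram_matrix D') None h :: 'h)"
proof -
  note M = move2_cycle_product[OF m]
  let ?T = "diagram_matrix D :: (nat option, 'h) based_matrix"
  let ?T' = "diagram_matrix D' :: (nat option, 'h) based_matrix"
  have "extends ?T (Some ` {c, d}) ?T'"
    by (rule extends_diagram_matrix[OF wf]) (use M(2-5) in auto)
  then have ext: "extends ?T {Some c, Some d} ?T'" by simp
  show row: "form ?T' (Some c) h + form ?T' (Some d) h = form ?T' None h" if "h \<in> elems ?T'"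
    for h
    using M(6)[of h] that unfolding diagram_matrix_simps by (metis of_int_add)
  have "complementary ?T' (Some c) (Some d)"
    unfolding complementary_def using M(1,4) row by (auto simp: diagram_matrix_simps(1,2))
  then have "cancels ?T' {Some c, Some d} True"
    using cancels_complementary[of "Some c" "Some d" ?T' True] M(1) by simp
  then show "operation ?T ?T'" by (rule operationI[OF ext])
qed

text \<open>The coefficient ring enters here: at an incoherent triangle the sum of the three rows
  contains twice the row of the odd vertex, which vanishes if 2 = 0.\<close>

lemma oriented_move3_form:
  assumes m: "oriented_move3 d1 d2 d3 D D' x y z"
    and k: "coherent d1 d2 d3 \<or> (2 :: 'h::comm_ring_1) = 0"
  shows "matrix_iso id (diagram_matrix D :: (nat option, 'h) based_matrix) (diagram_matrix D')"
    "distinct [x, y, z]" "{x, y, z} \<subseteq> crossings D"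
    "\<exists>k::int. \<forall>h\<in>elems (diagram_matrix D :: (nat option, 'h) based_matrix).
      form (diagram_matrix D) (Some x) h + form (diagram_matrix D) (Some y) h + form (diagram_matrix D) (Some z) h =
        (of_int k * form (diagram_matrix D) None h :: 'h)"
proof -
  obtain i1 i2 i3 where tri: "triangle d1 d2 d3 D D' x y z i1 i2 i3" and ap: "apart i1 i2 i3"
    using oriented_move3_triangle[OF m] unfolding apart_def by blast
  have T: "crossings D' = crossings D" "distinct [x, y, z]" "x \<in> crossings D"
    "y \<in> crossings D" "z \<in> crossings D"
    using tri unfolding triangle_def by blast+
  then show "distinct [x, y, z]" "{x, y, z} \<subseteq> crossings D" by auto
  show "matrix_iso id (diagram_matrix D :: (nat option, 'h) based_matrix) (diagram_matrix D')"
    by (rule matrix_iso_id)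
      (use T(1) triangle_cycle_product[OF tri ap] in \<open>simp_all add: diagram_matrix_simps\<close>)
  let ?k = "curve_multiplicity (coherent d1 d2 d3) (between i2 i3 i1)"
  let ?e = "of_bool (\<not> coherent d1 d2 d3) :: int"
  have e: "(of_int (2 * ?e) :: 'h) = 0" using k by auto
  have "(of_int (cycle_product D (Some x) h) + of_int (cycle_product D (Some y) h) +
      of_int (cycle_product D (Some z) h) :: 'h) = of_int ?k * of_int (cycle_product D None h)"
    if h: "h \<in> insert None (Some ` crossings D)" for h
  proof -
    have "(of_int (cycle_product D (Some x) h) + of_int (cycle_product D (Some y) h) +
        of_int (cycle_product D (Some z) h) :: 'h) =
      of_int (cycle_product D (Some x) h + cycle_product D (Some y) h + cycle_product D (Some z) h)"
      by (simp only: of_int_add)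
    also have "\<dots> = of_int ?k * of_int (cycle_product D None h) +
        of_int (2 * ?e) * of_int (cycle_product D (Some (odd_vertex d1 d2 d3 x y z)) h)"
      unfolding triangle_cycle_product_sum[OF tri ap h] by (simp only: of_int_add of_int_mult)
    finally show ?thesis unfolding e by simp
  qed
  then show
    "\<exists>k::int. \<forall>h\<in>elems (diagram_matrix D :: (nat option, 'h) based_matrix).
      form (diagram_matrix D) (Some x) h + form (diagram_matrix D) (Some y) h + form (diagram_matrix D) (Some z) h =
        (of_int k * form (diagram_matrix D) None h :: 'h)"
    unfolding diagram_matrix_simps by (intro exI[of _ ?k] ballI) simp
qed

text \<open>Surviving crossings must keep their values at every third move, coherent or not, so
  invariance of the matrix is stated without a condition on directions or coefficients.\<close>

lemma move3_matrix_iso: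
  assumes "move3 D D' x y z"
  shows "matrix_iso id (diagram_matrix D :: (nat option, 'h::comm_ring_1) based_matrix) (diagram_matrix D')"
proof -
  obtain d1 d2 d3 where "oriented_move3 d1 d2 d3 D D' x y z" using assms unfolding move3_def
    by blast
  from oriented_move3_triangle[OF this] obtain i1 i2 i3
    where tri: "triangle d1 d2 d3 D D' x y z i1 i2 i3" and ap: "apart i1 i2 i3"
    unfolding apart_def by blast
  have "crossings D' = crossings D" using tri unfolding triangle_def by blast
  then show ?thesis
    by (intro matrix_iso_id)
      (use triangle_cycle_product[OF tri ap] in \<open>simp_all add: diagram_matrix_simps\<close>)
qed

lemma isotopy_matrix_iso:
  assumes "isotopy \<phi> D D'"
  shows "matrix_iso (map_option \<phi>) (diagram_matrix D :: (nat option, 'h::comm_ring_1) based_matrix) (diagram_matrix D')"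
proof -
  note I = isotopy_positions[OF assms]
  have "inj_on (map_option \<phi>) (insert None (Some ` crossings D))"
    using I(3) by (auto simp: inj_on_def)
  moreover have
    "map_option \<phi> ` insert None (Some ` crossings D) = insert None (Some ` crossings D')"
    by (auto simp: I(4) image_image)
  ultimately show ?thesis
    unfolding matrix_iso_def diagram_matrix_simps bij_betw_def
    using isotopy_cycle_product[OF assms] by auto
qed

text \<open>Covers the integral and the mod 2 statement at once: \<Delta> may be any set of third
  moves at which the surplus row vanishes, by coherence or because 2 = 0.\<close>

lemma reduced_stable_parity_on:
  fixes Tp :: "(nat option, 'h::comm_ring_1) based_matrix"
  assumes prim: "primitive Tp"
    and hom: "\<And>D. D \<in> K \<Longrightarrow> homologous (diagram_matrix D) Tp"
    and \<Delta>: "\<And>D D' x y z. \<Delta> D D' x y z \<Longrightarrow>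
      \<exists>d1 d2 d3. oriented_move3 d1 d2 d3 D D' x y z \<and> (coherent d1 d2 d3 \<or> (2 :: 'h) = 0)"
  shows "parity_on \<Delta> K (stable_coeffs Tp) (\<lambda>D c. reduced_stable_parity Tp (diagram_matrix D) (Some c))"
proof -
  note ip = infinite_nat_option prim
  have wf: "wf_matrix (diagram_matrix D :: (nat option, 'h) based_matrix)" if "D \<in> K" for D
    using homologous_wf[OF hom[OF that] prim] .
  have el: "Some c \<in> elems (diagram_matrix D :: (nat option, 'h) based_matrix)"
    if "c \<in> crossings D" for c D
    using that by (simp add: diagram_matrix_simps)
  have base: "base (diagram_matrix D :: (nat option, 'h) based_matrix) = None" for D
    by (rule diagram_matrix_simps)
  show ?thesis
    unfolding parity_on_def
  proof (intro conjI ballI allI impI)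
    show "comm_group (stable_coeffs Tp)" by (rule comm_group_stable_coeffs[OF ip])
  next
    fix D c assume "D \<in> K" "c \<in> crossings D"
    then show
      "reduced_stable_parity Tp (diagram_matrix D) (Some c) \<in> carrier (stable_coeffs Tp)"
      by (intro parity_carrier[OF ip] hom)
  next
    fix D D' \<phi> c assume K: "D \<in> K" "D' \<in> K" and iso: "isotopy \<phi> D D'"
      and c: "c \<in> crossings D"
    from parity_iso[OF ip isotopy_matrix_iso[OF iso] hom[OF K(1)] hom[OF K(2)] el[OF c]]
    show "reduced_stable_parity Tp (diagram_matrix D') (Some (\<phi> c)) =
        reduced_stable_parity Tp (diagram_matrix D) (Some c)" by simp
  next
    fix D D' c assume K: "D \<in> K" "D' \<in> K" and r: "reidemeister D D'"
      and c: "c \<in> crossings D \<inter> crossings D'"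
    then have cD: "c \<in> crossings D" by simp
    from r consider a where "move1 D D' a" | a b where "move2 D D' a b" | x y z
      where "move3 D D' x y z"
      unfolding reidemeister_def by blast
    then show "reduced_stable_parity Tp (diagram_matrix D') (Some c) =
        reduced_stable_parity Tp (diagram_matrix D) (Some c)"
    proof cases
      case (1 a)
      show ?thesis
        by (rule parity_operation[OF ip move1_operation(1)[OF 1 wf[OF K(1)] wf[OF K(2)]]
              hom[OF K(1)] hom[OF K(2)] el[OF cD]])
    next
      case (2 a b)
      show ?thesis
        by (rule parity_operation[OF ip move2_operation(1)[OF 2 wf[OF K(1)] wf[OF K(2)]]
              hom[OF K(1)] hom[OF K(2)] el[OF cD]])
    next
      case (3 x y z)
      from parity_iso[OF ip move3_matrix_iso[OF 3] hom[OF K(1)] hom[OF K(2)] el[OF cD]]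
      show ?thesis by simp
    qed
  next
    fix D D' c assume K: "D \<in> K" "D' \<in> K" and m: "move1 D D' c"
    have "c \<in> crossings D'" using move1_cycle_product(2)[OF m] by simp
    moreover obtain k :: int
      where "\<forall>h\<in>elems (diagram_matrix D' :: (nat option, 'h) based_matrix).
        form (diagram_matrix D') (Some c) h = (of_int k * form (diagram_matrix D') None h :: 'h)"
      using move1_operation(2)[OF m wf[OF K(1)] wf[OF K(2)]] by blast
    ultimately show
      "reduced_stable_parity Tp (diagram_matrix D') (Some c) = \<one>\<^bsub>stable_coeffs Tp\<^esub>"
      by (intro parity_one[OF ip hom[OF K(2)] el, where k = k]) (simp_all add: base)
  next
    fix D D' c d assume K: "D \<in> K" "D' \<in> K" and m: "move2 D D' c d"
    note M = move2_cycle_product[OF m]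
    note row = move2_operation(2)[OF m wf[OF K(1)] wf[OF K(2)]]
    show "reduced_stable_parity Tp (diagram_matrix D') (Some c) \<otimes>\<^bsub>stable_coeffs Tp\<^esub>
        reduced_stable_parity Tp (diagram_matrix D') (Some d) = \<one>\<^bsub>stable_coeffs Tp\<^esub>"
      by (rule parity_two[OF ip hom[OF K(2)] el el,
        where k = 1]) (use M(1,4) row in \<open>simp_all add: base\<close>)
  next
    fix D D' x y z assume K: "D \<in> K" "D' \<in> K" and m: "\<Delta> D D' x y z"
    obtain d1 d2 d3 where m: "oriented_move3 d1 d2 d3 D D' x y z"
      and k: "coherent d1 d2 d3 \<or> (2 :: 'h) = 0"
      using \<Delta>[OF m] by blast
    note M = oriented_move3_form[OF m k]
    have xyz: "x \<in> crossings D" "y \<in> crossings D" "z \<in> crossings D" using M(3) by auto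
    obtain k :: int
      where row: "\<forall>h\<in>elems (diagram_matrix D :: (nat option, 'h) based_matrix).
      form (diagram_matrix D) (Some x) h + form (diagram_matrix D) (Some y) h + form (diagram_matrix D) (Some z) h =
        (of_int k * form (diagram_matrix D) None h :: 'h)"
      using M(4) by blast
    show "reduced_stable_parity Tp (diagram_matrix D) (Some x) \<otimes>\<^bsub>stable_coeffs Tp\<^esub>
        reduced_stable_parity Tp (diagram_matrix D) (Some y) \<otimes>\<^bsub>stable_coeffs Tp\<^esub>
        reduced_stable_parity Tp (diagram_matrix D) (Some z) = \<one>\<^bsub>stable_coeffs Tp\<^esub>"
      by (rule parity_three[OF ip hom[OF K(1)] el[OF xyz(1)] el[OF xyz(2)] el[OF xyz(3)],
        where k = k])
        (use M(2) row in \<open>simp_all add: base\<close>)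
  qed
qed

theorem proposition4:
  fixes K :: "diagram set"
    and TZ :: "(nat option, int) based_matrix"
    and T2 :: "(nat option, bit) based_matrix"
  assumes "K \<in> knots"
  shows "(primitive TZ \<and> (\<forall>D\<in>K. homologous (diagram_matrix D) TZ) \<longrightarrow>
            parity_on coherent_move3 K (stable_coeffs TZ)
              (\<lambda>D c. reduced_stable_parity TZ (diagram_matrix D) (Some c))) \<and>
         (primitive T2 \<and> (\<forall>D\<in>K. homologous (diagram_matrix D) T2) \<longrightarrow>
            parity_on move3 K (stable_coeffs T2)
              (\<lambda>D c. reduced_stable_parity T2 (diagram_matrix D) (Some c)))"
proof (intro conjI impI)
  assume "primitive TZ \<and> (\<forall>D\<in>K. homologous (diagram_matrix D) TZ)"
  then show "parity_on coherent_move3 K (stable_coeffs TZ)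
      (\<lambda>D c. reduced_stable_parity TZ (diagram_matrix D) (Some c))"
    by (intro reduced_stable_parity_on) (auto simp: coherent_move3_def coherent_def)
next
  assume "primitive T2 \<and> (\<forall>D\<in>K. homologous (diagram_matrix D) T2)"
  then show "parity_on move3 K (stable_coeffs T2)
      (\<lambda>D c. reduced_stable_parity T2 (diagram_matrix D) (Some c))"
    by (intro reduced_stable_parity_on) (auto simp: move3_def)
qed

end
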